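(* Let $b$ be a prime, let $\alpha>1/2$ be real and let $\boldsymbol{\gamma}=(\gamma_u)_u$, $\boldsymbol{\gamma}'=(\gamma'_u)_u$ be families of non-negative real weights such that $\gamma_v\ge\gamma_u$ whenever $v\subset u$. For $s,m\in\mathbb{N}$ let $p\in\mathbb{F}_b[x]$ be irreducible with $\deg(p)=m$ and let $\boldsymbol{q}\in(G_m\setminus\{0\})^s$ be a vector constructed by the component-by-component (CBC) algorithm for polynomial lattice rules based on the criterion $P_{\alpha,\boldsymbol{\gamma},b^m}$. Let $k_2=1$ and $k_b=1+1/\sin(\pi/b)$ for a prime $b>2$. Then the following holds. 1. (General weights.) Assume that there exist $\lambda,\delta,q,q',q''\ge0$ such that $1/(2\alpha)<\lambda<1$, $0<\delta<1/(\alpha\lambda)$, $$\sup_{s\in\mathbb{N}}\frac1{s^q}\sum_{\emptyset\ne u\subseteq\{1,\ldots,s\}}\gamma_u^\lambda\left(\frac{b-1}{b^{2\alpha\lambda}-b}\right)^{|u|}<\infty,\qquad \sup_{s\in\mathbb{N}}\frac1{s^{q'}}\sum_{\emptyset\ne u\subseteq\{1,\ldots,s\}}\gamma'_u|u|<\infty,$$ and $$\sup_{s,m\in\mathbb{N}}\frac1{s^{q''}b^{m\delta}}\sum_{\emptyset\ne u\subseteq\{1,\ldots,s\}}\frac{\gamma'_u}{\gamma_u^{1/(2\alpha)}}(k_b(m+1))^{|u|}<\infty.$$ Then the weighted star discrepancy $D^*_{\boldsymbol{\gamma}',b^m}(\boldsymbol{q})$ depends only polynomially on $s$: there is a constant $C>0$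 independent of $s$ and $m$ such that $$D^*_{\boldsymbol{\gamma}',b^m}(\boldsymbol{q})\le C\,s^{\max(q',\,q/(2\alpha\lambda)+q'')}\,b^{-m(1/(2\alpha\lambda)-\delta)}.$$ If there exist $\lambda,\delta$ with $1/(2\alpha)<\lambda<1$ and $0<\delta<1/(\alpha\lambda)$ such that $$\sup_{s\in\mathbb{N}}\sum_{\emptyset\ne u\subseteq\{1,\ldots,s\}}\gamma_u^\lambda\left(\frac{b-1}{b^{2\alpha\lambda}-b}\right)^{|u|}<\infty,\qquad \sup_{s\in\mathbb{N}}\sum_{\emptyset\ne u\subseteq\{1,\ldots,s\}}\gamma'_u|u|<\infty,$$ and $$\sup_{s,m\in\mathbb{N}}\frac1{b^{m\delta}}\sum_{\emptyset\ne u\subseteq\{1,\ldots,s\}}\frac{\gamma'_u}{\gamma_u^{1/(2\alpha)}}(k_b(m+1))^{|u|}<\infty$$ (the case $q=q'=q''=0$), then $D^*_{\boldsymbol{\gamma}',b^m}(\boldsymbol{q})$ is bounded independently of $s$. 2. (Product weights.) Suppose $\boldsymbol{\gamma}$ and $\boldsymbol{\gamma}'$ are product weights, $\gamma_u=\prod_{j\in u}\gamma_j$ and $\gamma'_u=\prod_{j\in u}\gamma'_j$ with $\gamma_j,\gamma'_j\ge0$, and that there exists $\lambda\in(1/(2\alpha),1]$ such that $$\sum_{j=1}^\infty\gamma_j^\lambda<\infty\quad\text{and}\quad\sum_{j=1}^\infty\frac{\gamma'_j}{\gamma_j^{1/(2\alpha)}}<\infty.$$ Then for arbitrarily small $\delta>0$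 there is a constant $C>0$ (which may depend on $\delta$) independent of $s$ and $m$ such that $$D^*_{\boldsymbol{\gamma}',b^m}(\boldsymbol{q})\le C\,b^{-m(1/(2\alpha\lambda)-\delta)}.$$
   Context: $\mathbb{N}$ is the set of positive integers; $\mathbb{F}_b$ is the field with $b$ elements, identified with $\{0,\ldots,b-1\}$; $G_m=\{g\in\mathbb{F}_b[x]:\deg(g)<m\}$ (including $0$). Weights are families $\boldsymbol{\gamma}=(\gamma_u)$ of non-negative reals indexed by the finite non-empty subsets $u\subset\mathbb{N}$. Polynomial lattice point set: for a formal Laurent series put $\nu_m\bigl(\sum_{i=w}^\infty t_ix^{-i}\bigr)=\sum_{i=\max(w,1)}^m t_ib^{-i}\in[0,1)$. The point set $P(p,\boldsymbol{q})$ consists of the $b^m$ points (counted with multiplicity) $\bigl(\nu_m(nq_1/p),\ldots,\nu_m(nq_s/p)\bigr)$, $n\in G_m$, where $nq_j/p$ is expanded as a Laurent series in $x^{-1}$ over $\mathbb{F}_b$. Weighted star discrepancy: for a point set $P$ of $N$ points in $[0,1)^s$ and non-empty $u\subseteq\{1,\ldots,s\}$, let $P_u$ be the projection (with multiplicity) of $P$ onto the coordinates in $u$. For $\boldsymbol{y}_u\in[0,1)^{|u|}$ let $$\Delta_{P_u}(\boldsymbol{y}_u)=\frac1N\sum_{\boldsymbol{x}_u\in P_u}1_{[\boldsymbol{0},\boldsymbol{y}_u)}(\boldsymbol{x}_u)-\prod_{j\in u}y_j,\qquad [\boldsymbol{0},\boldsymbol{y}_u)=\prod_{j\in u}[0,y_j),$$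 and $$D^*_{\boldsymbol{\gamma},N}(P)=\max_{\emptyset\ne u\subseteq\{1,\ldots,s\}}\gamma_u\sup_{\boldsymbol{y}_u\in[0,1)^{|u|}}|\Delta_{P_u}(\boldsymbol{y}_u)|.$$ Write $D^*_{\boldsymbol{\gamma},b^m}(\boldsymbol{q})=D^*_{\boldsymbol{\gamma},b^m}(P(p,\boldsymbol{q}))$. Criterion: for an integer $k\ge0$ with $b$-adic expansion $k=\kappa_0+\kappa_1b+\cdots$ let $\mathrm{tr}_m(k)=\kappa_0+\kappa_1x+\cdots+\kappa_{m-1}x^{m-1}\in G_m$. For $k=\kappa_0+\cdots+\kappa_{a-1}b^{a-1}\in\mathbb{N}$ with $\kappa_{a-1}\ne0$ let $\mu(k)=a$; for $\boldsymbol{k}_u\in\mathbb{N}^{|u|}$ let $\mu(\boldsymbol{k}_u)=\sum_{j\in u}\mu(k_j)$. For non-empty $u\subseteq\{1,\ldots,s\}$ let $$P_u^\perp(p,\boldsymbol{q})=\Bigl\{\boldsymbol{k}_u\in\mathbb{N}^{|u|}:\sum_{j\in u}\mathrm{tr}_m(k_j)\,q_j\equiv0 \pmod p\Bigr\},$$ and $$P_{\alpha,\boldsymbol{\gamma},b^m}(\boldsymbol{q})=\sum_{\emptyset\ne u\subseteq\{1,\ldots,s\}}\ \sum_{\boldsymbol{k}_u\in P_u^\perp(p,\boldsymbol{q})}\gamma_u\,b^{-2\alpha\mu(\boldsymbol{k}_u)}.$$ The same definition is used for vectors of any length $\ell$ (with $s$ replaced by $\ell$). CBC algorithm for polynomial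 lattice rules (with modulus $p$) based on $P_{\alpha,\boldsymbol{\gamma},b^m}$: set $q^*_1=1\in\mathbb{F}_b[x]$; for $\ell=1,\ldots,s-1$ successively, with $q^*_1,\ldots,q^*_\ell$ kept fixed, let $q^*_{\ell+1}$ be a minimizer of $P_{\alpha,\boldsymbol{\gamma},b^m}(q^*_1,\ldots,q^*_\ell,q_{\ell+1})$ over $q_{\ell+1}\in G_m\setminus\{0\}$. The output is $\boldsymbol{q}=(q^*_1,\ldots,q^*_s)$. Convention: $0/0=0$, and $c/0=+\infty$ for $c>0$, in the ratios of weights. *)

theory Defs
  imports
    "HOL-Analysis.Analysis"
    "HOL-Computational_Algebra.Formal_Laurent_Series"
    "HOL-Number_Theory.Cong"
    "Berlekamp_Zassenhaus.Finite_Field"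
begin

text \<open>
  The field with \<open>b\<close> elements, \<open>b\<close> prime, is \<open>'a mod_ring\<close> with \<open>'a :: prime_card\<close> and
  \<open>b = CARD('a)\<close>; \<open>to_int_mod_ring\<close> and \<open>of_nat\<close> realise its identification with
  \<open>{0, \<dots>, b - 1}\<close>.  Vectors indexed by \<open>{1..s}\<close>, and points indexed by \<open>u \<subseteq> {1..s}\<close>,
  are functions on \<open>nat\<close> of which only the values on the index set matter.
\<close>

definition nonempty_subsets :: "nat \<Rightarrow> nat set set" where
  "nonempty_subsets s = {u. u \<noteq> {} \<and> u \<subseteq> {1..s}}"

definition weight_index :: "nat set set" where
  "weight_index = {u. finite u \<and> u \<noteq> {} \<and> u \<subseteq> {1..}}"

definition G :: "nat \<Rightarrow> 'a::prime_card mod_ring poly set" where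
  "G m = {g. g = 0 \<or> degree g < m}"

subsection \<open>Polynomial lattice point sets\<close>

text \<open>
  Laurent series in \<open>x\<^sup>-\<^sup>1\<close> are elements of \<open>fls\<close> whose variable stands for \<open>x\<^sup>-\<^sup>1\<close>, so a
  polynomial is evaluated at \<open>fls_X_inv\<close>, and \<open>fls_nth f i\<close> is the coefficient of \<open>x\<^sup>-\<^sup>i\<close>.
\<close>

definition laurent_of_poly :: "'a::prime_card mod_ring poly \<Rightarrow> 'a mod_ring fls" where
  "laurent_of_poly g = poly (map_poly fls_const g) fls_X_inv"

text \<open>Coefficients below the order \<open>w\<close> of the series vanish, so the sum may start at \<open>1\<close>.\<close>

definition nu :: "nat \<Rightarrow> 'a::prime_card mod_ring fls \<Rightarrow> real" where
  "nu m f = (\<Sum>i=1..m. real_of_int (to_int_mod_ring (fls_nth f (int i))) / real CARD('a) ^ i)"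

definition lattice_point ::
  "nat \<Rightarrow> 'a::prime_card mod_ring poly \<Rightarrow> (nat \<Rightarrow> 'a mod_ring poly) \<Rightarrow>
    'a mod_ring poly \<Rightarrow> nat \<Rightarrow> real" where
  "lattice_point m p q n j = nu m (laurent_of_poly (n * q j) / laurent_of_poly p)"

subsection \<open>Weighted star discrepancy\<close>

text \<open>
  A point set with multiplicity is a family \<open>x\<close> of points over a finite index set \<open>I\<close>, so that
  \<open>N = card I\<close>.
\<close>

definition local_disc ::
  "'i set \<Rightarrow> ('i \<Rightarrow> nat \<Rightarrow> real) \<Rightarrow> nat set \<Rightarrow> (nat \<Rightarrow> real) \<Rightarrow> real" where
  "local_disc I x u y =
     1 / real (card I) * (\<Sum>i\<in>I. indicator (PiE u (\<lambda>j. {0..<y j})) (restrict (x i) u))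
       - (\<Prod>j\<in>u. y j)"

definition weighted_star_disc ::
  "(nat set \<Rightarrow> real) \<Rightarrow> nat \<Rightarrow> 'i set \<Rightarrow> ('i \<Rightarrow> nat \<Rightarrow> real) \<Rightarrow> real" where
  "weighted_star_disc \<gamma> s I x =
     (MAX u\<in>nonempty_subsets s.
        \<gamma> u * (SUP y\<in>PiE u (\<lambda>_. {0..<1}). \<bar>local_disc I x u y\<bar>))"

definition lattice_star_disc ::
  "(nat set \<Rightarrow> real) \<Rightarrow> nat \<Rightarrow> nat \<Rightarrow> 'a::prime_card mod_ring poly \<Rightarrow>
    (nat \<Rightarrow> 'a mod_ring poly) \<Rightarrow> real" where
  "lattice_star_disc \<gamma> s m p q = weighted_star_disc \<gamma> s (G m) (lattice_point m p q)"

subsection \<open>The quality criterion\<close>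

definition digit :: "nat \<Rightarrow> nat \<Rightarrow> nat \<Rightarrow> nat" where
  "digit b k i = k div b ^ i mod b"

definition tr :: "nat \<Rightarrow> nat \<Rightarrow> 'a::prime_card mod_ring poly" where
  "tr m k = (\<Sum>i<m. Polynomial.monom (of_nat (digit CARD('a) k i)) i)"

definition mu :: "nat \<Rightarrow> nat \<Rightarrow> nat" where
  "mu b k = Suc (Max {i. digit b k i \<noteq> 0})"

definition dual_net ::
  "nat \<Rightarrow> 'a::prime_card mod_ring poly \<Rightarrow> (nat \<Rightarrow> 'a mod_ring poly) \<Rightarrow> nat set \<Rightarrow>
    (nat \<Rightarrow> nat) set" where
  "dual_net m p q u = {k \<in> PiE u (\<lambda>_. {1..}). [(\<Sum>j\<in>u. tr m (k j) * q j) = 0] (mod p)}"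

text \<open>
  For \<open>\<alpha> > 1/2\<close> the inner series converges, because
  \<open>\<Sum>k\<ge>1. b powr (- 2 * \<alpha> * mu b k) = (b - 1) / (b powr (2 * \<alpha>) - b)\<close>.
\<close>

definition criterion ::
  "real \<Rightarrow> (nat set \<Rightarrow> real) \<Rightarrow> nat \<Rightarrow> 'a::prime_card mod_ring poly \<Rightarrow> nat \<Rightarrow>
    (nat \<Rightarrow> 'a mod_ring poly) \<Rightarrow> real" where
  "criterion \<alpha> \<gamma> m p l q =
     (\<Sum>u\<in>nonempty_subsets l. \<Sum>\<^sub>\<infinity>k\<in>dual_net m p q u.
        \<gamma> u * real CARD('a) powr (- 2 * \<alpha> * real (\<Sum>j\<in>u. mu CARD('a) (k j))))"

definition cbc_vector ::
  "real \<Rightarrow> (nat set \<Rightarrow> real) \<Rightarrow> nat \<Rightarrow> 'a::prime_card mod_ring poly \<Rightarrow> nat \<Rightarrow>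
    (nat \<Rightarrow> 'a mod_ring poly) \<Rightarrow> bool" where
  "cbc_vector \<alpha> \<gamma> m p s q \<longleftrightarrow>
     q 1 = 1 \<and>
     (\<forall>l\<in>{1..<s}. is_arg_min (\<lambda>h. criterion \<alpha> \<gamma> m p (l + 1) (q(l + 1 := h)))
                     (\<lambda>h. h \<in> G m - {0}) (q (l + 1)))"

subsection \<open>Constants and ratios of weights\<close>

definition k_const :: "nat \<Rightarrow> real" where
  "k_const b = (if b = 2 then 1 else 1 + 1 / sin (pi / real b))"

text \<open>
  Division in \<open>ennreal\<close> follows the convention \<open>0 / 0 = 0\<close> and \<open>c / 0 = \<infinity>\<close> for \<open>c > 0\<close>.
\<close>

definition weight_ratio :: "real \<Rightarrow> real \<Rightarrow> real \<Rightarrow> ennreal" where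
  "weight_ratio \<alpha> c d = ennreal c / ennreal (d powr (1 / (2 * \<alpha>)))"

lemma weight_ratio_zero: "weight_ratio \<alpha> 0 d = 0"
  by (simp add: weight_ratio_def)

lemma weight_ratio_top: "c > 0 \<Longrightarrow> weight_ratio \<alpha> c 0 = \<infinity>"
  by (simp add: weight_ratio_def ennreal_divide_zero)

end

theory Submission
  imports Defs "HOL-Library.Log_Nat"
begin

text \<open>
  Expanding the indicator functions of \<open>[0, y\<^sub>j)\<close> into Walsh functions turns the local discrepancy
  of the projection onto \<open>u\<close>, up to an error of at most \<open>|u| b\<^sup>-\<^sup>m\<close>, into a sum over the nonzero
  vectors \<open>K\<close> of the dual net, with coefficients bounded by \<open>\<Prod>\<^sub>j k\<^sub>b b^(-\<mu>(K\<^sub>j))\<close>.  If every nonzero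
  dual vector satisfies \<open>\<mu>(K) > A\<close>, then by the pigeonhole principle each of the at most
  \<open>(m + 1)^|u|\<close> classes of vectors with prescribed \<open>\<mu>(K\<^sub>j)\<close> contributes at most \<open>b^(-A)\<close>.  A single
  term of the criterion \<open>P\<close> shows that \<open>A\<close> can be chosen with \<open>b^(-A) \<le> b (P / \<gamma>\<^sub>u)^(1/(2\<alpha>))\<close>; dual
  vectors supported on some \<open>v \<subset> u\<close> are covered because \<open>\<gamma>\<^sub>v \<ge> \<gamma>\<^sub>u\<close>.

  The criterion is bounded by Jensen's inequality and averaging over the candidates for the new
  component: if \<open>b\<^sup>m\<close> does not divide the new entry of \<open>k\<close>, at most one of the \<open>b\<^sup>m - 1\<close> candidates
  puts \<open>k\<close> into the dual net, and the entries divisible by \<open>b\<^sup>m\<close> have small total weight.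
\<close>

section \<open>Additive characters and polynomials of bounded degree\<close>

text \<open>The grid of points with \<open>m\<close> digits is the group \<open>G m\<close>, and the
  lattice points lie on it; the Walsh expansion used is therefore finite and exact there, and the
  only error is that the zeroth coefficient differs from \<open>y j\<close>. Two index sets have to
  be matched. The expansion runs over \<open>G m\<close> and admits zero entries. The criterion runs
  over positive integers of any size, and \<open>tr\<close> annihilates the multiples of
  \<open>b^m\<close>. Such integers make the criterion positive as soon as one weight is, so that
  quotients and roots of it can be compared with powers of \<open>b\<close>. The constant
  \<open>k_b\<close> is a partial geometric sum of roots of unity plus one incomplete cell; the
  factor \<open>b\<close> comes from rounding the root of the criterion to a power of
  \<open>b\<close>. Jensen's inequality has exponent \<open>r > 1/(2\<alpha>)\<close>, so that the
  series of \<open>b^(-2\<alpha>r \<mu>(k))\<close> converges; its value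
  \<open>(b-1)/(b^(2\<alpha>r)-b)\<close> is the base in the first condition on the weights.
  Averaging yields \<open>P^r = O(1/(b^m - 1))\<close>, hence
  \<open>P^(1/(2\<alpha>)) = O(b^(-m/(2\<alpha>r)))\<close>. Since \<gamma> enters through the
  criterion and \<gamma>' through the discrepancy, the ratios
  \<open>\<gamma>'_u / \<gamma>_u^(1/(2\<alpha>))\<close> appear.\<close>

definition add_char :: "'a::prime_card mod_ring \<Rightarrow> complex" where
  "add_char x = cis (2 * pi * real_of_int (to_int_mod_ring x) / real CARD('a))"

lemma two_le_card: "2 \<le> CARD('a::prime_card)"
  using prime_card prime_ge_2_nat by blast

lemma to_int_mod_ring_of_nat:
  "d < CARD('a) \<Longrightarrow> to_int_mod_ring (of_nat d :: 'a::prime_card mod_ring) = int d"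
  by (simp add: of_nat_of_int_mod_ring)

lemma to_int_mod_ring_bounds:
  fixes x :: "'a::prime_card mod_ring"
  shows "0 \<le> to_int_mod_ring x" "to_int_mod_ring x < int CARD('a)"
proof -
  have "to_int_mod_ring x \<in> {0..<int CARD('a)}"
    using range_to_int_mod_ring[where 'a='a] by blast
  then show "0 \<le> to_int_mod_ring x" "to_int_mod_ring x < int CARD('a)" by auto
qed

lemma norm_add_char [simp]: "norm (add_char x) = 1"
  by (simp add: add_char_def)

lemma add_char_0 [simp]: "add_char 0 = 1"
  by (simp add: add_char_def)

lemma add_char_add:
  fixes x y :: "'a::prime_card mod_ring"
  shows "add_char (x + y) = add_char x * add_char y"
proof -
  let ?b = "int CARD('a)"
  let ?t = "to_int_mod_ring x + to_int_mod_ring y"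
  have "?t = to_int_mod_ring (x + y) + ?b * (?t div ?b)"
    by (simp add: to_int_mod_ring_add)
  then have "real_of_int ?t = real_of_int (to_int_mod_ring (x + y)) + real CARD('a) * real_of_int (?t div ?b)"
    by (metis of_int_add of_int_mult of_int_of_nat_eq)
  then have "2 * pi * real_of_int ?t / real CARD('a) =
      2 * pi * real_of_int (to_int_mod_ring (x + y)) / real CARD('a) + 2 * pi * real_of_int (?t div ?b)"
    by (simp add: field_simps)
  then have "cis (2 * pi * real_of_int ?t / real CARD('a)) = add_char (x + y)"
    by (simp add: add_char_def cis_mult[symmetric] cis_multiple_2pi)
  then show ?thesis
    by (simp add: add_char_def cis_mult add_divide_distrib distrib_left)
qed

lemma add_char_sum: "add_char (sum f A) = (\<Prod>i\<in>A. add_char (f i))"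
  by (induction A rule: infinite_finite_induct) (simp_all add: add_char_add)

lemma add_char_mult_of_nat: "add_char (x * of_nat d) = add_char x ^ d"
  by (induction d) (simp_all add: add_char_add distrib_left)

text \<open>For 2t <= b this is monotonicity of the sine up to pi/2; otherwise the reflection of t
  to b - t leads back to that case.\<close>

lemma sin_pi_div_le:
  fixes t b :: nat
  assumes "0 < t" "t < b"
  shows "sin (pi / b) \<le> sin (pi * t / b)"
proof (cases "2 * t \<le> b")
  case True
  have "pi / b \<le> pi * t / b" using assms by (simp add: divide_right_mono)
  moreover have "pi * t / b \<le> pi / 2" using True assms
    by (simp add: field_simps flip: of_nat_mult)
  ultimately show ?thesis
    by (intro sin_monotone_2pi_le) (auto intro: order_trans[of _ 0])
next
  case False
  have 1: "sin (pi * t / b) = sin (pi * (b - t) / b)"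
  proof -
    have "pi * (b - t) / b = pi - pi * t / b" using assms by (simp add: field_simps of_nat_diff)
    then show ?thesis by simp
  qed
  have "pi / b \<le> pi * (b - t) / b" using assms
    by (intro divide_right_mono) (auto simp: of_nat_diff)
  moreover have "pi * (b - t) / b \<le> pi / 2" using False assms
    by (simp add: field_simps of_nat_diff)
  ultimately show ?thesis unfolding 1
    by (intro sin_monotone_2pi_le) (auto intro: order_trans[of _ 0])
qed

text \<open>The chord from 1 to exp(i theta) has length 2 |sin(theta/2)|, and the nontrivial b-th
  roots of unity closest to 1 are its two neighbours.\<close>

lemma norm_add_char_minus_1:
  fixes x :: "'a::prime_card mod_ring"
  assumes "x \<noteq> 0"
  shows "2 * sin (pi / CARD('a)) \<le> norm (add_char x - 1)"
proof -
  define t where "t = nat (to_int_mod_ring x)"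
  have t: "0 < t" "t < CARD('a)" "real t = real_of_int (to_int_mod_ring x)"
    using to_int_mod_ring_bounds[of x] assms unfolding t_def
    by (auto simp: to_int_mod_ring_hom.hom_0_iff order_less_le)
  have "add_char x = exp (\<i> * of_real (2 * pi * t / CARD('a)))"
    unfolding add_char_def t by (simp add: cis_conv_exp)
  then have "norm (add_char x - 1) = 2 * \<bar>sin (pi * t / CARD('a))\<bar>"
    by (simp only: dist_exp_i_1) simp
  moreover have "sin (pi / CARD('a)) \<le> sin (pi * t / CARD('a))"
    using sin_pi_div_le[OF t(1,2)] .
  ultimately show ?thesis by linarith
qed

lemma sin_pi_div_card_pos: "0 < sin (pi / CARD('a::prime_card))"
  using two_le_card[where 'a='a] by (intro sin_gt_zero) (auto simp: field_simps)

lemma add_char_neq_1: "x \<noteq> 0 \<Longrightarrow> add_char (x :: 'a::prime_card mod_ring) \<noteq> 1"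
  using norm_add_char_minus_1[of x] sin_pi_div_card_pos[where 'a='a] by auto

text \<open>A geometric sum whose numerator has norm at most 2. The bound does not depend on
  \<open>D\<close>; it is the origin of 1/sin(pi/b) in \<open>k_const\<close>.\<close>

lemma norm_sum_add_char:
  fixes x :: "'a::prime_card mod_ring"
  assumes "x \<noteq> 0"
  shows "norm (\<Sum>d<D. add_char (x * of_nat d)) \<le> 1 / sin (pi / CARD('a))"
proof -
  let ?s = "sin (pi / CARD('a))"
  have "(\<Sum>d<D. add_char (x * of_nat d)) = (add_char x ^ D - 1) / (add_char x - 1)"
    by (simp add: add_char_mult_of_nat geometric_sum[OF add_char_neq_1[OF assms]])
  also have "norm \<dots> \<le> 2 / (2 * ?s)"
    unfolding norm_divide
  proof (rule frac_le)
    show "norm (add_char x ^ D - 1) \<le> 2"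
      using norm_triangle_ineq4[of "add_char x ^ D" 1] by (simp add: norm_power)
  qed (use norm_add_char_minus_1[OF assms] sin_pi_div_card_pos[where 'a='a] in auto)
  finally show ?thesis by simp
qed

lemma sum_mod_ring:
  "(\<Sum>c\<in>UNIV. f (c :: 'a::prime_card mod_ring)) = (\<Sum>d<CARD('a). f (of_nat d))"
proof -
  have "inj_on (of_nat :: nat \<Rightarrow> 'a mod_ring) {..<CARD('a)}"
    by (rule inj_onI) (metis lessThan_iff of_nat_eq_iff to_int_mod_ring_of_nat)
  moreover have "of_nat ` {..<CARD('a)} = (UNIV :: 'a mod_ring set)"
    using surj_of_nat_mod_ring by (auto simp: image_iff)
  ultimately show ?thesis by (metis (no_types, lifting) sum.reindex_cong)
qed

lemma sum_add_char:
  fixes x :: "'a::prime_card mod_ring"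
  shows "(\<Sum>c\<in>UNIV. add_char (x * c)) = (if x = 0 then of_nat CARD('a) else 0)"
proof (cases "x = 0")
  case False
  have "add_char x ^ CARD('a) = 1"
    by (simp flip: add_char_mult_of_nat)
  then show ?thesis using False
    by (simp add: sum_mod_ring add_char_mult_of_nat geometric_sum[OF add_char_neq_1[OF False]])
qed simp

section \<open>The finite groups \<open>G m\<close> and their characters\<close>

lemma G_0: "G 0 = {0}"
  by (auto simp: G_def)

text \<open>The recursion behind most inductions on \<open>m\<close>: the constant coefficient is
  the leading digit in \<open>digit_val\<close>, so splitting it off means zooming into one cell of
  length 1/b.\<close>

lemma G_Suc: "G (Suc m) = (\<lambda>(c, g). pCons c g) ` (UNIV \<times> G m)"
proof -
  have "pCons c g \<in> G (Suc m) \<longleftrightarrow> g \<in> G m" for c :: "'a mod_ring" and g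
    by (auto simp: G_def)
  then show ?thesis
    by (auto simp: image_iff) (metis pCons_cases)
qed

lemma sum_G_Suc: "sum f (G (Suc m)) = (\<Sum>c\<in>UNIV. \<Sum>g\<in>G m. f (pCons c g))"
proof -
  have "inj_on (\<lambda>(c, g). pCons c g) (UNIV \<times> G m)" by (auto simp: inj_on_def)
  then show ?thesis
    unfolding G_Suc by (subst sum.reindex) (simp_all add: sum.cartesian_product case_prod_unfold)
qed

lemma finite_G [simp]: "finite (G m)"
  by (induction m) (simp_all add: G_0 G_Suc)

lemma card_G: "card (G m :: 'a::prime_card mod_ring poly set) = CARD('a) ^ m"
proof (induction m)
  case (Suc m)
  then show ?case using sum_G_Suc[of "\<lambda>_ :: 'a mod_ring poly. 1::nat" m] by simp
qed (simp add: G_0)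

lemma G_iff_coeff: "g \<in> G m \<longleftrightarrow> (\<forall>i\<ge>m. poly.coeff g i = 0)"
proof
  assume "g \<in> G m" then show "\<forall>i\<ge>m. poly.coeff g i = 0"
    by (auto simp: G_def coeff_eq_0)
next
  assume "\<forall>i\<ge>m. poly.coeff g i = 0" then show "g \<in> G m"
    unfolding G_def by (metis (mono_tags, lifting) leading_coeff_0_iff mem_Collect_eq not_less)
qed

lemma zero_in_G [simp]: "0 \<in> G m"
  by (simp add: G_def)

lemma G_diff: "g \<in> G m \<Longrightarrow> h \<in> G m \<Longrightarrow> g - h \<in> G m"
  by (simp add: G_iff_coeff)

text \<open>With \<open>add_char\<close> applied, this gives all characters of \<open>G m\<close>,
  indexed by \<open>K\<close> in \<open>G m\<close>: the Walsh functions on the grid of points with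
  \<open>m\<close> digits.\<close>

definition pairing :: "nat \<Rightarrow> 'a::comm_semiring_0 poly \<Rightarrow> 'a poly \<Rightarrow> 'a" where
  "pairing m K Z = (\<Sum>i<m. poly.coeff K i * poly.coeff Z i)"

lemma pairing_0 [simp]: "pairing 0 K Z = 0" "pairing m 0 Z = 0" "pairing m K 0 = 0"
  by (simp_all add: pairing_def)

lemma pairing_pCons [simp]:
  "pairing (Suc m) (pCons c K) (pCons d Z) = c * d + pairing m K Z"
  unfolding pairing_def by (subst sum.lessThan_Suc_shift) simp

lemma pairing_commute: "pairing m K Z = pairing m Z K"
  by (simp add: pairing_def mult.commute)

lemma sum_add_char_pairing:
  fixes K :: "'a::prime_card mod_ring poly"
  assumes "K \<in> G m"
  shows "(\<Sum>Z\<in>G m. add_char (pairing m K Z)) = (if K = 0 then of_nat CARD('a) ^ m else 0)"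
  using assms
proof (induction m arbitrary: K)
  case (Suc m)
  obtain c K' where K: "K = pCons c K'" "K' \<in> G m"
    using Suc.prems by (auto simp: G_Suc)
  have "(\<Sum>Z\<in>G (Suc m). add_char (pairing (Suc m) K Z)) =
      (\<Sum>d\<in>UNIV. add_char (c * d)) * (\<Sum>Z\<in>G m. add_char (pairing m K' Z))"
    by (simp add: sum_G_Suc K add_char_add sum_product)
  then show ?case
    by (simp add: sum_add_char Suc.IH[OF K(2)] K(1))
qed (simp add: G_0)

section \<open>Walsh coefficients of anchored intervals\<close>

text \<open>Low degree means high significance: the coefficient of x^i is the digit of b^-(i+1).
  With this orientation the degree of \<open>K\<close> measures how fine the Walsh function of
  \<open>K\<close> is.\<close>

definition digit_val :: "nat \<Rightarrow> 'a::prime_card mod_ring poly \<Rightarrow> real" where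
  "digit_val m Z = (\<Sum>i<m. real_of_int (to_int_mod_ring (poly.coeff Z i)) / real CARD('a) ^ Suc i)"

lemma digit_val_0 [simp]: "digit_val 0 Z = 0"
  by (simp add: digit_val_def)

lemma digit_val_pCons [simp]:
  fixes c :: "'a::prime_card mod_ring"
  shows "digit_val (Suc m) (pCons c Z) = (real_of_int (to_int_mod_ring c) + digit_val m Z) / real CARD('a)"
  unfolding digit_val_def by (subst sum.lessThan_Suc_shift) (simp add: add_divide_distrib sum_divide_distrib mult.commute)

lemma digit_val_bounds: "Z \<in> G m \<Longrightarrow> 0 \<le> digit_val m Z \<and> digit_val m Z < 1"
proof (induction m arbitrary: Z)
  case (Suc m)
  then obtain c :: "'a mod_ring" and Z' where Z: "Z = pCons c Z'" "Z' \<in> G m" by (auto simp: G_Suc)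
  have "to_int_mod_ring c + 1 \<le> int CARD('a)" using to_int_mod_ring_bounds[of c] by simp
  then have "real_of_int (to_int_mod_ring c) + 1 \<le> real CARD('a)" by linarith
  moreover have "0 \<le> real_of_int (to_int_mod_ring c)" using to_int_mod_ring_bounds[of c] by simp
  ultimately show ?case using Suc.IH[OF Z(2)] two_le_card[where 'a='a]
    by (simp add: Z(1) divide_less_eq)
qed simp

text \<open>The counterpart of \<open>mu\<close> on digit polynomials, extended by 0 at 0 so that
  zero entries of a dual vector add nothing to its weight.\<close>

definition mu_poly :: "'a::zero poly \<Rightarrow> nat" where
  "mu_poly K = (if K = 0 then 0 else Suc (degree K))"

lemma mu_poly_0 [simp]: "mu_poly 0 = 0"
  by (simp add: mu_poly_def)

lemma mu_poly_pCons:
  "mu_poly (pCons c K) = (if K = 0 then (if c = 0 then 0 else 1) else Suc (mu_poly K))"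
  by (simp add: mu_poly_def)

lemma mu_poly_le_iff: "mu_poly K \<le> m \<longleftrightarrow> K \<in> G m"
  by (auto simp: mu_poly_def G_def)

text \<open>An unnormalised Walsh coefficient of the indicator of [0, y), summed over the grid;
  leaving out b^-m keeps the recursion in \<open>m\<close> simple.\<close>

definition walsh_sum :: "nat \<Rightarrow> 'a::prime_card mod_ring poly \<Rightarrow> real \<Rightarrow> complex" where
  "walsh_sum m K y = (\<Sum>Z\<in>G m. of_bool (digit_val m Z < y) * add_char (pairing m K Z))"

lemma walsh_sum_0: "walsh_sum 0 K y = of_bool (0 < y)"
  by (simp add: walsh_sum_def G_0)

lemma walsh_sum_zero_poly:
  "walsh_sum m (0 :: 'a::prime_card mod_ring poly) y =
     of_nat (card {Z \<in> G m :: 'a mod_ring poly set. digit_val m Z < y})"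
  by (simp add: walsh_sum_def Collect_conj_eq)

lemma card_digit_val_less_le:
  "card {Z \<in> G m :: 'a::prime_card mod_ring poly set. digit_val m Z < y} \<le> CARD('a) ^ m"
  unfolding card_G[symmetric] by (intro card_mono) auto

text \<open>The interval [0, y) consists of \<open>D\<close> complete cells of length 1/b and a part
  of the next one. A complete cell contributes a full character sum in the remaining digits, which
  vanishes unless \<open>K = 0\<close>; the incomplete cell, magnified by b, is again an interval
  [0, b y - D).\<close>

lemma walsh_sum_pCons:
  fixes K :: "'a::prime_card mod_ring poly" and y :: real
  assumes K: "K \<in> G m" and y: "0 \<le> y" "y < 1"
    and D: "D = nat \<lfloor>CARD('a) * y\<rfloor>"
  shows "walsh_sum (Suc m) (pCons c K) y =
    (\<Sum>d<D. add_char (c * of_nat d)) * (if K = 0 then of_nat CARD('a) ^ m else 0) +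
    add_char (c * of_nat D) * walsh_sum m K (CARD('a) * y - D)"
proof -
  let ?b = "CARD('a)"
  let ?F = "\<lambda>d. \<Sum>Z\<in>G m. of_bool (real d + digit_val m Z < ?b * y) * add_char (pairing m K Z)"
  let ?h = "\<lambda>d. add_char (c * of_nat d) * ?F d"
  have D1: "real D \<le> ?b * y" "?b * y < real D + 1"
    using y unfolding D by (auto simp: of_nat_nat)
  have "?b * y < real ?b" using y two_le_card[where 'a='a] by simp
  then have Db: "D < ?b" using D1 by linarith
  have full: "?F d = (if K = 0 then of_nat ?b ^ m else 0)" if "d < D" for d
  proof -
    have "?F d = (\<Sum>Z\<in>G m. add_char (pairing m K Z))"
    proof (rule sum.cong)
      fix Z :: "'a mod_ring poly" assume "Z \<in> G m"
      then have "real d + digit_val m Z < ?b * y"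
        using digit_val_bounds[of Z m] that D1 by linarith
      then show "of_bool (real d + digit_val m Z < ?b * y) * add_char (pairing m K Z) = add_char (pairing m K Z)"
        by simp
    qed simp
    then show ?thesis by (simp add: sum_add_char_pairing[OF K])
  qed
  have empty: "?F d = 0" if "D < d" for d
  proof (rule sum.neutral, rule ballI)
    fix Z :: "'a mod_ring poly" assume "Z \<in> G m"
    then have "\<not> real d + digit_val m Z < ?b * y"
      using digit_val_bounds[of Z m] that D1 by linarith
    then show "of_bool (real d + digit_val m Z < ?b * y) * add_char (pairing m K Z) = 0"
      by simp
  qed
  have "walsh_sum (Suc m) (pCons c K) y = (\<Sum>d<?b. ?h d)"
    unfolding walsh_sum_def sum_G_Suc sum_mod_ring
  proof (rule sum.cong)
    fix d assume "d \<in> {..<?b}"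
    then have d: "to_int_mod_ring (of_nat d :: 'a mod_ring) = int d"
      by (simp add: to_int_mod_ring_of_nat)
    show "(\<Sum>Z\<in>G m. of_bool (digit_val (Suc m) (pCons (of_nat d) Z) < y) *
        add_char (pairing (Suc m) (pCons c K) (pCons (of_nat d) Z))) = ?h d"
      using two_le_card[where 'a='a]
      by (simp add: d add_char_add sum_distrib_left mult_ac divide_less_eq del: sum_of_bool_mult_eq sum_mult_of_bool_eq)
  qed simp
  also have "\<dots> = (\<Sum>d<Suc D. ?h d)"
    using Db empty by (intro sum.mono_neutral_right) auto
  also have "\<dots> = (\<Sum>d<D. ?h d) + ?h D" by simp
  also have "(\<Sum>d<D. ?h d) = (\<Sum>d<D. add_char (c * of_nat d)) * (if K = 0 then of_nat ?b ^ m else 0)"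
    unfolding sum_distrib_right by (rule sum.cong) (simp_all only: full lessThan_iff)
  also have "?F D = walsh_sum m K (?b * y - D)"
    by (simp add: walsh_sum_def less_diff_eq add.commute)
  finally show ?thesis .
qed

text \<open>Complete cells contain exactly the expected number of grid points, so the error passes
  unchanged to the magnified incomplete cell, down to a single point.\<close>

lemma norm_walsh_sum_zero_poly:
  fixes y :: real
  assumes "0 \<le> y" "y < 1"
  shows "norm (walsh_sum m (0 :: 'a::prime_card mod_ring poly) y - of_real (y * real CARD('a) ^ m)) \<le> 1"
  using assms
proof (induction m arbitrary: y)
  case 0
  have "walsh_sum 0 (0 :: 'a mod_ring poly) y - of_real y = of_real (of_bool (0 < y) - y)"
    by (simp add: walsh_sum_0)
  then show ?case using 0 by (simp only: power_0 mult_1_right norm_of_real) simp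
next
  case (Suc m)
  define D where "D = nat \<lfloor>CARD('a) * y\<rfloor>"
  define \<theta> where "\<theta> = CARD('a) * y - D"
  have \<theta>: "0 \<le> \<theta>" "\<theta> < 1"
    using Suc.prems unfolding \<theta>_def D_def by (auto simp: of_nat_nat) linarith+
  have "walsh_sum (Suc m) (pCons 0 0 :: 'a mod_ring poly) y - of_real (y * real CARD('a) ^ Suc m) =
      walsh_sum m (0 :: 'a mod_ring poly) \<theta> - of_real (\<theta> * real CARD('a) ^ m)"
    by (subst walsh_sum_pCons[OF _ Suc.prems D_def]) (simp_all add: \<theta>_def algebra_simps)
  then show ?case using Suc.IH[OF \<theta>] by simp
qed

lemma k_const_ge_1: "1 \<le> k_const CARD('a::prime_card)"
  using sin_pi_div_card_pos[where 'a='a] by (simp add: k_const_def)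

text \<open>While higher coefficients of \<open>K\<close> remain, complete cells cancel and the
  estimate is inherited from the magnified interval, each level gaining a factor 1/b. Only at the
  top coefficient do the complete cells survive, weighted by a geometric sum.\<close>

lemma norm_walsh_sum:
  fixes K :: "'a::prime_card mod_ring poly" and y :: real
  assumes "K \<in> G m" "0 \<le> y" "y < 1"
  shows "norm (walsh_sum m K y) \<le> k_const CARD('a) * real CARD('a) ^ m / real CARD('a) ^ mu_poly K"
  using assms
proof (induction m arbitrary: K y)
  case 0
  then show ?case using k_const_ge_1[where 'a='a] by (simp add: walsh_sum_0 G_0)
next
  case (Suc m)
  let ?b = "CARD('a)"
  have b: "0 < real ?b" using two_le_card[where 'a='a] by simp
  obtain c K' where K: "K = pCons c K'" "K' \<in> G m"
    using Suc.prems(1) unfolding G_Suc by fast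
  define D where "D = nat \<lfloor>?b * y\<rfloor>"
  define \<theta> where "\<theta> = ?b * y - D"
  have \<theta>: "0 \<le> \<theta>" "\<theta> < 1"
    using Suc.prems unfolding \<theta>_def D_def by (auto simp: of_nat_nat) linarith+
  note rec = walsh_sum_pCons[OF K(2) Suc.prems(2,3) D_def, folded \<theta>_def]
  consider "K = 0" | "K' \<noteq> 0" | "K' = 0" "c \<noteq> 0" using K(1) by fastforce
  then show ?case
  proof cases
    case 1
    have "real (card {Z \<in> G (Suc m) :: 'a mod_ring poly set. digit_val (Suc m) Z < y}) \<le> 1 * real ?b ^ Suc m"
      using card_digit_val_less_le[of "Suc m" y, where 'a='a]
      by (simp flip: of_nat_power del: power_Suc)
    also have "\<dots> \<le> k_const ?b * real ?b ^ Suc m"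
      by (intro mult_right_mono k_const_ge_1) simp
    finally show ?thesis by (simp add: 1 walsh_sum_zero_poly del: power_Suc)
  next
    case 2
    then show ?thesis using Suc.IH[OF K(2) \<theta>] b
      by (simp add: K(1) rec norm_mult mu_poly_pCons)
  next
    case 3
    define N where "N = card {Z \<in> G m :: 'a mod_ring poly set. digit_val m Z < \<theta>}"
    have N: "walsh_sum m (0 :: 'a mod_ring poly) \<theta> = of_nat N" "real N \<le> real ?b ^ m"
      using card_digit_val_less_le[of m \<theta>, where 'a='a] unfolding N_def
      by (simp_all add: walsh_sum_zero_poly flip: of_nat_power)
    let ?g = "\<Sum>d<D. add_char (c * of_nat d)"
    have "norm (?g * of_nat ?b ^ m + add_char (c * of_nat D) * of_nat N) \<le> k_const ?b * real ?b ^ m"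
    proof (cases "?b = 2")
      case False
      have "norm (?g * of_nat ?b ^ m + add_char (c * of_nat D) * of_nat N) \<le>
          norm ?g * real ?b ^ m + real N"
        by (rule order.trans[OF norm_triangle_ineq]) (simp add: norm_mult norm_power)
      \<comment> \<open>The two summands of \<open>k_const\<close>: 1/sin(pi/b) for the complete
        cells, 1 for the incomplete one.\<close>
      also have "\<dots> \<le> 1 / sin (pi / ?b) * real ?b ^ m + real ?b ^ m"
        by (intro add_mono mult_right_mono norm_sum_add_char 3 N) simp
      finally show ?thesis using False by (simp add: k_const_def algebra_simps)
    next
      case True
      \<comment> \<open>For b = 2 the triangle inequality would only give the constant 2. Here the
        character takes the value -1, so with one complete cell the two contributions have opposite
        signs and the norm is 2^m - N.\<close>
      have "to_int_mod_ring c = 1"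
      proof -
        have "to_int_mod_ring c \<noteq> 0" using 3(2) by simp
        then show ?thesis using to_int_mod_ring_bounds[of c] True by linarith
      qed
      then have c: "add_char c = -1" by (simp add: add_char_def True)
      have "?b * y < real ?b" using Suc.prems b by simp
      then have "D < 2" using \<theta> True unfolding \<theta>_def by linarith
      then consider "D = 0" | "D = 1" by linarith
      then have "norm (?g * of_nat ?b ^ m + add_char (c * of_nat D) * of_nat N) \<le> real ?b ^ m"
      proof cases
        case 2
        have "of_nat ?b ^ m + add_char c * of_nat N = complex_of_real (real ?b ^ m - real N)"
          by (simp add: c)
        then show ?thesis using 2 N(2) by (simp del: of_real_diff)
      qed (use N in simp)
      then show ?thesis by (simp add: k_const_def True)
    qed
    then show ?thesis using 3(2) b by (simp add: K(1) rec[unfolded 3(1)] 3(1) mu_poly_pCons N(1))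
  qed
qed

text \<open>The Fourier coefficient on the group \<open>G m\<close>; the sign in \<open>- K\<close>
  conjugates the character.\<close>

definition walsh_coeff :: "nat \<Rightarrow> real \<Rightarrow> 'a::prime_card mod_ring poly \<Rightarrow> complex" where
  "walsh_coeff m y K = walsh_sum m (- K) y / of_nat CARD('a) ^ m"

text \<open>Fourier inversion on a finite group: no tail of a Walsh series occurs, because only
  points with \<open>m\<close> digits are evaluated.\<close>

lemma walsh_expansion:
  fixes Z :: "'a::prime_card mod_ring poly"
  assumes "Z \<in> G m"
  shows "(\<Sum>K\<in>G m. walsh_coeff m y K * add_char (pairing m K Z)) = of_bool (digit_val m Z < y)"
proof -
  let ?b = "of_nat CARD('a) :: complex"
  have orth: "(\<Sum>K\<in>G m. add_char (pairing m (- K) W) * add_char (pairing m K Z)) = (if W = Z then ?b ^ m else 0)"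
    if "W \<in> G m" for W
  proof -
    have "add_char (pairing m (- K) W) * add_char (pairing m K Z) = add_char (pairing m (Z - W) K)" for K
      unfolding add_char_add[symmetric]
      by (simp add: pairing_def sum_subtractf sum_negf algebra_simps)
    then show ?thesis using sum_add_char_pairing[OF G_diff[OF assms that]] by auto
  qed
  have "(\<Sum>K\<in>G m. walsh_coeff m y K * add_char (pairing m K Z)) =
      (\<Sum>W\<in>G m. of_bool (digit_val m W < y) *
        (\<Sum>K\<in>G m. add_char (pairing m (- K) W) * add_char (pairing m K Z))) / ?b ^ m"
    unfolding walsh_coeff_def walsh_sum_def sum_distrib_left sum_divide_distrib sum_distrib_right
    by (subst sum.swap) (simp add: mult_ac)
  also have "\<dots> = (\<Sum>W\<in>G m. of_bool (digit_val m W < y) * (if W = Z then ?b ^ m else 0)) / ?b ^ m"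
    using orth by simp
  also have "\<dots> = of_bool (digit_val m Z < y)"
    using assms two_le_card[where 'a='a] by (simp add: if_distrib sum.delta cong: if_cong)
  finally show ?thesis .
qed

lemma norm_walsh_coeff:
  fixes K :: "'a::prime_card mod_ring poly" and y :: real
  assumes "K \<in> G m" "0 \<le> y" "y < 1"
  shows "norm (walsh_coeff m y K) \<le> k_const CARD('a) / real CARD('a) ^ mu_poly K"
proof -
  have "- K \<in> G m" using assms by (simp add: G_iff_coeff)
  from norm_walsh_sum[OF this assms(2,3)] show ?thesis using two_le_card[where 'a='a]
    by (cases "K = 0") (simp_all add: walsh_coeff_def norm_divide norm_power divide_le_eq mu_poly_def)
qed

text \<open>The first estimate is the error per coordinate; the second permits comparing the
  products over all coordinates factor by factor.\<close>

lemma norm_walsh_coeff_0: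
  fixes y :: real
  assumes "0 \<le> y" "y < 1"
  shows "norm (walsh_coeff m y (0 :: 'a::prime_card mod_ring poly) - of_real y) \<le> 1 / real CARD('a) ^ m"
    and "norm (walsh_coeff m y (0 :: 'a mod_ring poly)) \<le> 1"
proof -
  let ?b = "real CARD('a)"
  have b: "0 < ?b" using two_le_card[where 'a='a] by simp
  have "walsh_coeff m y (0 :: 'a mod_ring poly) - of_real y =
      (walsh_sum m (0 :: 'a mod_ring poly) y - of_real (y * ?b ^ m)) / of_real (?b ^ m)"
    using b by (simp add: walsh_coeff_def field_simps)
  then show "norm (walsh_coeff m y (0 :: 'a mod_ring poly) - of_real y) \<le> 1 / ?b ^ m"
    using norm_walsh_sum_zero_poly[OF assms, of m, where 'a='a] b
    by (simp only: norm_divide norm_of_real) (simp add: divide_right_mono)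
  have "real (card {Z \<in> G m :: 'a mod_ring poly set. digit_val m Z < y}) \<le> ?b ^ m"
    using card_digit_val_less_le[of m y, where 'a='a] by (simp flip: of_nat_power)
  then show "norm (walsh_coeff m y (0 :: 'a mod_ring poly)) \<le> 1" using b
    by (simp add: walsh_coeff_def walsh_sum_zero_poly norm_divide norm_power)
qed

section \<open>Digits of polynomial lattice points\<close>

interpretation fls_const_hom: comm_ring_hom "fls_const :: 'a::comm_ring_1 \<Rightarrow> 'a fls"
  by unfold_locales (simp_all add: fls_const_mult_const fls_plus_const)

interpretation fls_const_poly_hom: map_poly_comm_ring_hom "fls_const :: 'a::comm_ring_1 \<Rightarrow> 'a fls" ..

lemma laurent_of_poly_simps [simp]:
  "laurent_of_poly 0 = 0"
  "laurent_of_poly (g + h) = laurent_of_poly g + laurent_of_poly h"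
  "laurent_of_poly (g * h) = laurent_of_poly g * laurent_of_poly h"
  "laurent_of_poly (Polynomial.smult c g) = fls_const c * laurent_of_poly g"
  by (simp_all add: laurent_of_poly_def fls_const_hom.map_poly_hom_add
      fls_const_hom.map_poly_hom_smult fls_const_poly_hom.hom_mult)

lemma laurent_of_poly_pCons:
  "laurent_of_poly (pCons c g) = fls_const c + fls_X_inv * laurent_of_poly g"
  by (simp add: laurent_of_poly_def fls_const_hom.map_poly_pCons_hom)

lemma laurent_of_poly_monom: "laurent_of_poly (Polynomial.monom 1 i) = fls_X_inv ^ i"
  by (simp add: laurent_of_poly_def map_poly_monom poly_monom)

lemma fls_nth_laurent_of_poly:
  "fls_nth (laurent_of_poly g) n = (if n \<le> 0 then poly.coeff g (nat (- n)) else 0)"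
proof (induction g arbitrary: n)
  case (pCons c g)
  then show ?case
    by (auto simp: laurent_of_poly_pCons fls_X_inv_times_conv_shift coeff_pCons nat_diff_distrib' split: nat.splits)
qed simp

lemma fls_subdegree_laurent_of_poly:
  "g \<noteq> 0 \<Longrightarrow> fls_subdegree (laurent_of_poly g) = - int (degree g)"
  by (rule fls_subdegree_eqI) (auto simp: fls_nth_laurent_of_poly coeff_eq_0)

lemma laurent_of_poly_eq_0_iff [simp]: "laurent_of_poly g = 0 \<longleftrightarrow> g = 0"
proof
  assume "laurent_of_poly g = 0"
  then have "fls_nth (laurent_of_poly g) (- int (degree g)) = 0" by simp
  then show "g = 0" by (simp add: fls_nth_laurent_of_poly)
qed simp

text \<open>A linear functional of \<open>h\<close>: the coefficient of x^-1 in h/p. All other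
  digits of h/p are its values at x^i h.\<close>

definition residue :: "'a::prime_card mod_ring poly \<Rightarrow> 'a mod_ring poly \<Rightarrow> 'a mod_ring" where
  "residue p h = fls_nth (laurent_of_poly h / laurent_of_poly p) 1"

lemma residue_simps [simp]:
  "residue p 0 = 0"
  "residue p (g + h) = residue p g + residue p h"
  "residue p (Polynomial.smult c h) = c * residue p h"
  by (simp_all add: residue_def fls_divide_add flip: times_divide_eq_right)

lemma residue_sum: "residue p (sum f A) = (\<Sum>i\<in>A. residue p (f i))"
  by (induction A rule: infinite_finite_induct) simp_all

lemma residue_monom_mult:
  "residue p (Polynomial.monom 1 i * h) = fls_nth (laurent_of_poly h / laurent_of_poly p) (int (Suc i))"
  by (simp add: residue_def laurent_of_poly_monom fls_X_inv_power_times_conv_shift fls_divide_shift_numer)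

lemma residue_poly_mult:
  assumes "K \<in> G m"
  shows "residue p (K * h) = (\<Sum>i<m. poly.coeff K i * residue p (Polynomial.monom 1 i * h))"
proof -
  have "K = (\<Sum>i<m. Polynomial.monom (poly.coeff K i) i)"
    using assms by (intro poly_eqI) (auto simp: coeff_sum G_iff_coeff not_less if_distrib cong: if_cong)
  also have "\<dots> = (\<Sum>i<m. Polynomial.smult (poly.coeff K i) (Polynomial.monom 1 i))"
    by (simp add: smult_monom)
  finally have "K * h = (\<Sum>i<m. Polynomial.smult (poly.coeff K i) (Polynomial.monom 1 i * h))"
    by (metis (no_types, lifting) mult_smult_left sum.cong sum_distrib_right)
  then show ?thesis by (simp add: residue_sum)
qed

definition digit_poly :: "nat \<Rightarrow> 'a::prime_card mod_ring poly \<Rightarrow> 'a mod_ring poly \<Rightarrow> 'a mod_ring poly" where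
  "digit_poly m p h = (\<Sum>i<m. Polynomial.monom (residue p (Polynomial.monom 1 i * h)) i)"

lemma coeff_digit_poly:
  "poly.coeff (digit_poly m p h) i = (if i < m then residue p (Polynomial.monom 1 i * h) else 0)"
  by (simp add: digit_poly_def coeff_sum)

lemma digit_poly_in_G [simp]: "digit_poly m p h \<in> G m"
  by (simp add: G_iff_coeff coeff_digit_poly)

text \<open>A character of the digits of h/p depends only on the product \<open>K * h\<close>. This
  symmetry merges the characters of all coordinates of a lattice point into one and later exchanges
  the roles of \<open>K\<close> and \<open>n\<close>.\<close>

lemma pairing_digit_poly: "K \<in> G m \<Longrightarrow> pairing m K (digit_poly m p h) = residue p (K * h)"
  by (simp add: residue_poly_mult pairing_def coeff_digit_poly)

lemma residue_dvd:
  assumes "p dvd h" "p \<noteq> 0"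
  shows "residue p h = 0"
proof -
  obtain d where "h = p * d" using assms by blast
  then show ?thesis using assms by (simp add: residue_def fls_nth_laurent_of_poly)
qed

text \<open>Multiples of \<open>p\<close> do not affect the digits after the point, so
  \<open>h\<close> may be replaced by its remainder r. If r is nonzero, r/p has leading exponent deg
  r - m, which lies between -m and -1, so one of the first \<open>m\<close> digits is
  nonzero.\<close>

lemma digit_poly_eq_0_iff:
  assumes p: "degree p = m" "p \<noteq> 0"
  shows "digit_poly m p h = 0 \<longleftrightarrow> p dvd h"
proof
  assume "p dvd h"
  then show "digit_poly m p h = 0"
    by (simp add: digit_poly_def residue_dvd p)
next
  assume 0: "digit_poly m p h = 0"
  define r where "r = h mod p"
  have h: "h = p * (h div p) + r" by (simp add: r_def)
  show "p dvd h"
  proof (rule ccontr)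
    assume "\<not> p dvd h"
    then have r: "r \<noteq> 0" "degree r < m"
      using p degree_mod_less'[of p h] by (auto simp: r_def dvd_eq_mod_eq_0)
    \<comment> \<open>Chosen so that i + 1 = m - deg r is the position of the first nonzero digit of
      r/p.\<close>
    define i where "i = m - 1 - degree r"
    have i: "i < m" using r by (simp add: i_def)
    have "Polynomial.monom 1 i * h = p * (Polynomial.monom 1 i * (h div p)) + Polynomial.monom 1 i * r"
      by (subst h) (simp add: algebra_simps)
    then have "residue p (Polynomial.monom 1 i * h) = residue p (Polynomial.monom 1 i * r)"
      using residue_dvd[of p "p * (Polynomial.monom 1 i * (h div p))"] p by simp
    moreover have "residue p (Polynomial.monom 1 i * r) \<noteq> 0"
    proof -
      let ?f = "laurent_of_poly r / laurent_of_poly p"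
      have "fls_subdegree ?f = int (Suc i)"
        using r p by (simp add: fls_divide_subdegree fls_subdegree_laurent_of_poly i_def)
      then show ?thesis
        using r p nth_fls_subdegree_nonzero[of ?f] by (simp add: residue_monom_mult)
    qed
    moreover have "residue p (Polynomial.monom 1 i * h) = 0"
      using arg_cong[OF 0, of "\<lambda>f. poly.coeff f i"] i by (simp add: coeff_digit_poly)
    ultimately show False by simp
  qed
qed

section \<open>Local discrepancy and the dual net\<close>

lemma lattice_point_eq: "lattice_point m p q n j = digit_val m (digit_poly m p (n * q j))"
  unfolding lattice_point_def nu_def digit_val_def
  by (simp add: sum.atLeast1_atMost_eq coeff_digit_poly residue_monom_mult)

text \<open>The dual net as seen by the Walsh expansion: entries are polynomials of degree below
  \<open>m\<close> and may vanish, whereas \<open>dual_net\<close> has positive integers without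
  upper bound.\<close>

definition dual_polys ::
  "nat \<Rightarrow> 'a::prime_card mod_ring poly \<Rightarrow> (nat \<Rightarrow> 'a mod_ring poly) \<Rightarrow> nat set \<Rightarrow>
    (nat \<Rightarrow> 'a mod_ring poly) set" where
  "dual_polys m p q u = {K \<in> PiE u (\<lambda>_. G m). p dvd (\<Sum>j\<in>u. K j * q j)}"

lemma finite_dual_polys [simp]: "finite u \<Longrightarrow> finite (dual_polys m p q u)"
  unfolding dual_polys_def by (rule finite_subset[of _ "PiE u (\<lambda>_. G m)"]) (auto intro: finite_PiE)

lemma zero_in_dual_polys: "(\<lambda>j\<in>u. 0) \<in> dual_polys m p q u"
  by (simp add: dual_polys_def)

text \<open>Poisson summation for the lattice: after expanding every indicator, the sum over
  \<open>n\<close> is a full character sum and keeps exactly the dual vectors.\<close>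

lemma sum_lattice_box:
  fixes p :: "'a::prime_card mod_ring poly"
  assumes u: "finite u" and p: "degree p = m" "p \<noteq> 0"
  shows "(\<Sum>n\<in>G m. \<Prod>j\<in>u. of_bool (lattice_point m p q n j < y j)) =
    of_nat CARD('a) ^ m * (\<Sum>K\<in>dual_polys m p q u. \<Prod>j\<in>u. walsh_coeff m (y j) (K j))"
proof -
  let ?b = "of_nat CARD('a) :: complex"
  let ?c = "\<lambda>K. \<Prod>j\<in>u. walsh_coeff m (y j) (K j)"
  let ?S = "\<lambda>K. \<Sum>j\<in>u. K j * q j"
  have "(\<Prod>j\<in>u. of_bool (lattice_point m p q n j < y j)) =
      (\<Sum>K\<in>PiE u (\<lambda>_. G m). ?c K * add_char (residue p (n * ?S K)))" for n
  proof -
    have "(\<Prod>j\<in>u. of_bool (lattice_point m p q n j < y j) :: complex) =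
        (\<Prod>j\<in>u. \<Sum>K\<in>G m. walsh_coeff m (y j) K * add_char (residue p (K * (n * q j))))"
      by (intro prod.cong refl)
        (simp add: lattice_point_eq walsh_expansion[symmetric] pairing_digit_poly)
    also have "\<dots> = (\<Sum>K\<in>PiE u (\<lambda>_. G m). \<Prod>j\<in>u. walsh_coeff m (y j) (K j) * add_char (residue p (K j * (n * q j))))"
      using u by (intro prod_sum_PiE) auto
    also have "\<dots> = (\<Sum>K\<in>PiE u (\<lambda>_. G m). ?c K * add_char (residue p (n * ?S K)))"
      by (intro sum.cong refl)
        (simp add: prod.distrib sum_distrib_left residue_sum add_char_sum mult.left_commute)
    finally show ?thesis .
  qed
  then have "(\<Sum>n\<in>G m. \<Prod>j\<in>u. of_bool (lattice_point m p q n j < y j)) =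
      (\<Sum>K\<in>PiE u (\<lambda>_. G m). ?c K * (\<Sum>n\<in>G m. add_char (residue p (n * ?S K))))"
    by (simp only: sum_distrib_left) (rule sum.swap)
  also have "\<dots> = (\<Sum>K\<in>PiE u (\<lambda>_. G m). ?c K * (if p dvd ?S K then ?b ^ m else 0))"
  proof (intro sum.cong refl)
    fix K
    \<comment> \<open>By symmetry of the product, \<open>n\<close> now acts as the character index
      on the digits of S/p, where S is the linear combination of the entries of
      \<open>K\<close>.\<close>
    have "(\<Sum>n\<in>G m. add_char (residue p (n * ?S K))) =
        (\<Sum>n\<in>G m. add_char (pairing m (digit_poly m p (?S K)) n))"
      by (intro sum.cong refl) (simp add: pairing_commute pairing_digit_poly)
    also have "\<dots> = (if p dvd ?S K then ?b ^ m else 0)"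
      by (simp add: sum_add_char_pairing digit_poly_eq_0_iff[OF p])
    finally show "?c K * (\<Sum>n\<in>G m. add_char (residue p (n * ?S K))) = ?c K * (if p dvd ?S K then ?b ^ m else 0)"
      by simp
  qed
  also have "\<dots> = (\<Sum>K\<in>dual_polys m p q u. ?b ^ m * ?c K)"
    unfolding dual_polys_def using u
    by (subst sum.inter_filter) (auto intro!: sum.cong finite_PiE)
  finally show ?thesis by (simp add: sum_distrib_left)
qed

section \<open>Counting dual vectors by their weights\<close>

lemma exists_sum_eq_below:
  fixes a :: "'i \<Rightarrow> nat"
  assumes "finite u" "A \<le> sum a u"
  shows "\<exists>a'. (\<forall>j\<in>u. a' j \<le> a j) \<and> sum a' u = A"
  using assms
proof (induction u arbitrary: A rule: finite_induct)
  case (insert x F)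
  have "A - min A (a x) \<le> sum a F" using insert by auto
  then obtain a' where a': "\<forall>j\<in>F. a' j \<le> a j" "sum a' F = A - min A (a x)"
    using insert.IH by blast
  have "sum (a'(x := min A (a x))) F = sum a' F"
    using insert.hyps by (intro sum.cong) auto
  then have "sum (a'(x := min A (a x))) (insert x F) = A"
    using insert.hyps a'(2) by simp
  then show ?case using a'(1) insert.hyps by (intro exI[of _ "a'(x := min A (a x))"]) auto
qed simp

text \<open>
  Two dual vectors in one box that agree in their leading digits differ by a dual vector of
  weight at most \<open>A\<close>, hence coincide.
\<close>

lemma card_dual_polys_box:
  fixes p :: "'a::prime_card mod_ring poly"
  assumes u: "finite u"
    and A: "\<And>K. K \<in> dual_polys m p q u \<Longrightarrow> K \<noteq> (\<lambda>j\<in>u. 0) \<Longrightarrow> A < (\<Sum>j\<in>u. mu_poly (K j))"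
    and a: "A \<le> sum a u"
  shows "card {K \<in> dual_polys m p q u. \<forall>j\<in>u. mu_poly (K j) = a j} \<le> CARD('a) ^ (sum a u - A)"
proof -
  obtain a' where a': "\<forall>j\<in>u. a' j \<le> a j" "sum a' u = A"
    using exists_sum_eq_below[OF u a] by blast
  let ?B = "{K \<in> dual_polys m p q u. \<forall>j\<in>u. mu_poly (K j) = a j}"
  \<comment> \<open>Forgets the lowest a' j coefficients in coordinate j. Since the a' j add up to
    \<open>A\<close>, exactly \<open>sum a u - A\<close> coefficients survive, which is the exponent
    of the bound.\<close>
  let ?f = "\<lambda>K. \<lambda>j\<in>u. poly_shift (a' j) (K j)"
  let ?T = "PiE u (\<lambda>j. G (a j - a' j) :: 'a mod_ring poly set)"
  have "inj_on ?f ?B"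
  proof (rule inj_onI)
    fix K L assume K: "K \<in> ?B" and L: "L \<in> ?B" and eq: "?f K = ?f L"
    let ?D = "\<lambda>j\<in>u. K j - L j"
    have "p dvd (\<Sum>j\<in>u. K j * q j) - (\<Sum>j\<in>u. L j * q j)"
      using K L by (intro dvd_diff) (auto simp: dual_polys_def)
    then have D: "?D \<in> dual_polys m p q u"
      using K L by (auto simp: dual_polys_def left_diff_distrib sum_subtractf intro!: G_diff)
    have "mu_poly (K j - L j) \<le> a' j" if "j \<in> u" for j
      unfolding mu_poly_le_iff G_iff_coeff
    proof (intro allI impI)
      fix i assume "a' j \<le> i"
      moreover have "poly_shift (a' j) (K j) = poly_shift (a' j) (L j)"
        using fun_cong[OF eq, of j] that by simp
      then have "poly.coeff (K j) (i - a' j + a' j) = poly.coeff (L j) (i - a' j + a' j)"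
        by (metis coeff_poly_shift)
      ultimately show "poly.coeff (K j - L j) i = 0" by simp
    qed
    then have "(\<Sum>j\<in>u. mu_poly (?D j)) \<le> A"
      unfolding a'(2)[symmetric] by (intro sum_mono) simp
    then have D0: "?D = (\<lambda>j\<in>u. 0)" using A[OF D] by linarith
    show "K = L"
    proof (rule PiE_ext)
      show "K \<in> PiE u (\<lambda>_. G m)" "L \<in> PiE u (\<lambda>_. G m)"
        using K L by (simp_all add: dual_polys_def)
      show "K j = L j" if "j \<in> u" for j using fun_cong[OF D0, of j] that by simp
    qed
  qed
  moreover have "?f ` ?B \<subseteq> ?T"
  proof (intro image_subsetI PiE_I)
    fix K j assume K: "K \<in> ?B" and j: "j \<in> u"
    then have "K j \<in> G (a j)" unfolding mu_poly_le_iff[symmetric] by simp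
    then show "?f K j \<in> G (a j - a' j)" using j by (simp add: G_iff_coeff coeff_poly_shift)
  qed simp
  moreover have "finite ?T" using u by (simp add: finite_PiE)
  ultimately have "card ?B \<le> card ?T" by (rule card_inj_on_le)
  also have "card ?T = (\<Prod>j\<in>u. CARD('a) ^ (a j - a' j))"
    by (simp add: card_PiE[OF u] card_G)
  also have "\<dots> = CARD('a) ^ (sum a u - A)"
    using a' by (simp add: power_sum[symmetric] sum_subtractf_nat)
  finally show ?thesis .
qed

lemma sum_dual_polys_le:
  fixes p :: "'a::prime_card mod_ring poly"
  assumes u: "finite u"
    and A: "\<And>K. K \<in> dual_polys m p q u \<Longrightarrow> K \<noteq> (\<lambda>j\<in>u. 0) \<Longrightarrow> A < (\<Sum>j\<in>u. mu_poly (K j))"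
  shows "(\<Sum>K\<in>dual_polys m p q u - {\<lambda>j\<in>u. 0}. 1 / real CARD('a) ^ (\<Sum>j\<in>u. mu_poly (K j))) \<le>
    (real m + 1) ^ card u / real CARD('a) ^ A"
proof -
  let ?b = "real CARD('a)"
  have b: "0 < ?b" using two_le_card[where 'a='a] by simp
  let ?S = "dual_polys m p q u - {\<lambda>j\<in>u. 0}"
  let ?T = "PiE u (\<lambda>_. {..m})"
  let ?g = "\<lambda>K. \<lambda>j\<in>u. mu_poly (K j)"
  let ?h = "\<lambda>K. 1 / ?b ^ (\<Sum>j\<in>u. mu_poly (K j))"
  have "?g ` ?S \<subseteq> ?T"
    by (auto simp: dual_polys_def mu_poly_le_iff)
  then have "sum ?h ?S = (\<Sum>a\<in>?T. \<Sum>K\<in>{K \<in> ?S. ?g K = a}. ?h K)"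
    using u by (intro sum.group[symmetric]) (auto intro: finite_PiE)
  also have "\<dots> \<le> (\<Sum>a\<in>?T. 1 / ?b ^ A)"
  proof (rule sum_mono)
    fix a
    let ?Sa = "{K \<in> ?S. ?g K = a}"
    have h: "?h K = 1 / ?b ^ sum a u" if "K \<in> ?Sa" for K
      using that by (auto intro!: arg_cong[of _ _ "\<lambda>e. 1 / ?b ^ e"] sum.cong)
    show "(\<Sum>K\<in>?Sa. ?h K) \<le> 1 / ?b ^ A"
    proof (cases "?Sa = {}")
      case False
      then obtain K where K: "K \<in> ?Sa" by blast
      \<comment> \<open>A nonempty class has total weight above \<open>A\<close>, as the counting
        lemma requires; its b^(sum a u - A) members each weigh b^(-sum a u).\<close>
      then have "A < (\<Sum>j\<in>u. mu_poly (K j))" using A by auto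
      also have "\<dots> = sum a u" using K by (auto intro!: sum.cong)
      finally have Aa: "A \<le> sum a u" by simp
      have "card ?Sa \<le> card {K \<in> dual_polys m p q u. \<forall>j\<in>u. mu_poly (K j) = a j}"
        using u by (intro card_mono) auto
      also have "\<dots> \<le> CARD('a) ^ (sum a u - A)"
        by (rule card_dual_polys_box[OF u A Aa])
      finally have "real (card ?Sa) \<le> ?b ^ (sum a u - A)" by (simp flip: of_nat_power)
      moreover have "(\<Sum>K\<in>?Sa. ?h K) = real (card ?Sa) / ?b ^ sum a u"
        by (subst sum.cong[OF refl h]) auto
      ultimately have "(\<Sum>K\<in>?Sa. ?h K) \<le> ?b ^ (sum a u - A) / ?b ^ sum a u"
        by (simp add: divide_right_mono)
      also have "\<dots> = 1 / ?b ^ A" using b Aa by (simp add: power_diff)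
      finally show ?thesis .
    next
      case True
      show ?thesis unfolding True using b by simp
    qed
  qed
  also have "\<dots> = (real m + 1) ^ card u / ?b ^ A"
    using u by (simp add: card_PiE add.commute)
  finally show ?thesis .
qed

section \<open>Estimates of the local discrepancy\<close>

lemma local_disc_lattice_point:
  fixes p :: "'a::prime_card mod_ring poly"
  assumes "finite u"
  shows "local_disc (G m) (lattice_point m p q) u y =
    (\<Sum>n\<in>G m. \<Prod>j\<in>u. of_bool (lattice_point m p q n j < y j)) / real CARD('a) ^ m - (\<Prod>j\<in>u. y j)"
proof -
  have "indicator (PiE u (\<lambda>j. {0..<y j})) (restrict (lattice_point m p q n) u) =
      (\<Prod>j\<in>u. of_bool (lattice_point m p q n j < y j) :: real)" for n
  proof (cases "\<forall>j\<in>u. lattice_point m p q n j < y j")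
    case True
    have "0 \<le> lattice_point m p q n j" for j
      unfolding lattice_point_eq using digit_val_bounds[OF digit_poly_in_G] by blast
    then have "restrict (lattice_point m p q n) u \<in> PiE u (\<lambda>j. {0..<y j})" using True by simp
    then show ?thesis using True by simp
  next
    case False
    then have "(\<Prod>j\<in>u. of_bool (lattice_point m p q n j < y j) :: real) = 0"
      using assms by (intro prod_zero) auto
    moreover have "restrict (lattice_point m p q n) u \<notin> PiE u (\<lambda>j. {0..<y j})"
      using False by (auto simp: PiE_def Pi_def)
    ultimately show ?thesis by simp
  qed
  then show ?thesis by (simp add: local_disc_def card_G)
qed

lemma abs_local_disc_le:
  fixes p :: "'a::prime_card mod_ring poly"
  assumes u: "finite u" and p: "degree p = m" "p \<noteq> 0"
    and A: "\<And>K. K \<in> dual_polys m p q u \<Longrightarrow> K \<noteq> (\<lambda>j\<in>u. 0) \<Longrightarrow> A < (\<Sum>j\<in>u. mu_poly (K j))"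
    and y: "\<And>j. j \<in> u \<Longrightarrow> 0 \<le> y j \<and> y j < 1"
  shows "\<bar>local_disc (G m) (lattice_point m p q) u y\<bar> \<le>
    card u / real CARD('a) ^ m + (k_const CARD('a) * (real m + 1)) ^ card u / real CARD('a) ^ A"
proof -
  let ?b = "real CARD('a)" and ?k = "k_const CARD('a)"
  let ?D = "dual_polys m p q u" and ?z = "\<lambda>j\<in>u. 0"
  let ?c = "\<lambda>K. \<Prod>j\<in>u. walsh_coeff m (y j) (K j :: 'a mod_ring poly)"
  have b: "0 < ?b" using two_le_card[where 'a='a] by simp
  have of_bool: "complex_of_real (of_bool P) = of_bool P" for P
    by (cases P) simp_all
  have "complex_of_real (local_disc (G m) (lattice_point m p q) u y) =
      (\<Sum>n\<in>G m. \<Prod>j\<in>u. of_bool (lattice_point m p q n j < y j)) / of_nat CARD('a) ^ m - (\<Prod>j\<in>u. of_real (y j))"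
    by (simp add: local_disc_lattice_point[OF u] of_bool)
  also have "\<dots> = (\<Sum>K\<in>?D. ?c K) - (\<Prod>j\<in>u. of_real (y j))"
    using b by (simp add: sum_lattice_box[OF u p])
  also have "\<dots> = (?c ?z - (\<Prod>j\<in>u. of_real (y j))) + (\<Sum>K\<in>?D - {?z}. ?c K)"
    using u by (simp add: sum.remove[OF _ zero_in_dual_polys])
  finally have "\<bar>local_disc (G m) (lattice_point m p q) u y\<bar> =
      norm ((?c ?z - (\<Prod>j\<in>u. of_real (y j))) + (\<Sum>K\<in>?D - {?z}. ?c K))"
    by (metis norm_of_real)
  also have "\<dots> \<le> norm (?c ?z - (\<Prod>j\<in>u. of_real (y j))) + (\<Sum>K\<in>?D - {?z}. norm (?c K))"
    by (rule order.trans[OF norm_triangle_ineq add_left_mono[OF norm_sum]])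
  finally have disc: "\<bar>local_disc (G m) (lattice_point m p q) u y\<bar> \<le>
      norm (?c ?z - (\<Prod>j\<in>u. of_real (y j))) + (\<Sum>K\<in>?D - {?z}. norm (?c K))" .
  \<comment> \<open>The difference of two products with factors of norm at most one telescopes into
    the sum of the differences of the factors.\<close>
  have "norm (?c ?z - (\<Prod>j\<in>u. of_real (y j))) \<le>
      (\<Sum>j\<in>u. norm (walsh_coeff m (y j) (0 :: 'a mod_ring poly) - of_real (y j)))"
    using y norm_walsh_coeff_0(2)[where 'a='a]
    by (subst prod.cong[OF refl, of u _ "\<lambda>j. walsh_coeff m (y j) 0"]) (auto intro!: norm_prod_diff simp: less_imp_le)
  also have "\<dots> \<le> (\<Sum>j\<in>u. 1 / ?b ^ m)"
    using y by (intro sum_mono norm_walsh_coeff_0(1)) auto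
  finally have zero: "norm (?c ?z - (\<Prod>j\<in>u. of_real (y j))) \<le> card u / ?b ^ m" by simp
  have "(\<Sum>K\<in>?D - {?z}. norm (?c K)) \<le> (\<Sum>K\<in>?D - {?z}. ?k ^ card u * (1 / ?b ^ (\<Sum>j\<in>u. mu_poly (K j))))"
  proof (rule sum_mono)
    fix K assume "K \<in> ?D - {?z}"
    then have "norm (?c K) \<le> (\<Prod>j\<in>u. ?k / ?b ^ mu_poly (K j))"
      unfolding prod_norm[symmetric] using y
      by (intro prod_mono) (auto simp: dual_polys_def intro!: norm_walsh_coeff)
    then show "norm (?c K) \<le> ?k ^ card u * (1 / ?b ^ (\<Sum>j\<in>u. mu_poly (K j)))"
      by (simp add: prod_dividef power_sum)
  qed
  also have "\<dots> = ?k ^ card u * (\<Sum>K\<in>?D - {?z}. 1 / ?b ^ (\<Sum>j\<in>u. mu_poly (K j)))"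
    by (simp only: sum_distrib_left)
  also have "\<dots> \<le> ?k ^ card u * ((real m + 1) ^ card u / ?b ^ A)"
    using k_const_ge_1[where 'a='a] by (intro mult_left_mono sum_dual_polys_le[OF u A]) auto
  also have "\<dots> = (?k * (real m + 1)) ^ card u / ?b ^ A"
    by (simp add: power_mult_distrib)
  finally show ?thesis using disc zero by linarith
qed

lemma abs_local_disc_le_1:
  fixes p :: "'a::prime_card mod_ring poly"
  assumes u: "finite u" and y: "\<And>j. j \<in> u \<Longrightarrow> 0 \<le> y j \<and> y j < 1"
  shows "\<bar>local_disc (G m) (lattice_point m p q) u y\<bar> \<le> 1"
proof -
  let ?b = "real CARD('a)"
  let ?S = "\<Sum>n\<in>G m. \<Prod>j\<in>u. of_bool (lattice_point m p q n j < y j) :: real"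
  have b: "0 < ?b" using two_le_card[where 'a='a] by simp
  have "?S \<le> (\<Sum>n\<in>(G m :: 'a mod_ring poly set). 1)"
    by (intro sum_mono prod_le_1) auto
  then have "?S / ?b ^ m \<le> 1" using b by (simp add: card_G)
  moreover have "0 \<le> ?S / ?b ^ m" by (intro divide_nonneg_nonneg sum_nonneg prod_nonneg) auto
  moreover have "0 \<le> (\<Prod>j\<in>u. y j)" "(\<Prod>j\<in>u. y j) \<le> 1"
    using y by (auto intro!: prod_nonneg prod_le_1 simp: less_imp_le)
  ultimately show ?thesis unfolding local_disc_lattice_point[OF u] by linarith
qed

section \<open>Digit expansions of integers\<close>

text \<open>Replaces the maximum by a function with usable bounds and recursion. The restriction to
  k > 0 matters: at 0 \<open>mu\<close> takes the maximum of an empty set, while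
  \<open>floorlog\<close> is 0.\<close>

lemma mu_eq_floorlog:
  assumes "1 < b" "0 < k"
  shows "mu b k = floorlog b k"
proof -
  define i where "i = floorlog b k - 1"
  have i: "floorlog b k = Suc i"
    using assms by (simp add: i_def floorlog_def)
  then have k: "b ^ i \<le> k" "k < b ^ Suc i"
    using floorlog_bounds[OF assms(2,1)] by simp_all
  have "digit b k i \<noteq> 0"
  proof -
    have "k div b ^ i < b" using k(2) assms by (simp add: less_mult_imp_div_less)
    moreover have "0 < k div b ^ i" using k(1) assms by (simp add: div_greater_zero_iff)
    ultimately show ?thesis by (simp add: digit_def)
  qed
  moreover have "j \<le> i" if "digit b k j \<noteq> 0" for j
  proof (rule ccontr)
    assume "\<not> j \<le> i"
    then have "b ^ Suc i \<le> b ^ j" using assms by (intro power_increasing) auto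
    then show False using that k(2) by (simp add: digit_def)
  qed
  ultimately have "Max {i. digit b k i \<noteq> 0} = i"
    by (intro Max_eqI) (auto intro: finite_subset[of _ "{..i}"])
  then show ?thesis by (simp add: mu_def i)
qed

lemma coeff_tr:
  "poly.coeff (tr m k :: 'a::prime_card mod_ring poly) i = (if i < m then of_nat (digit CARD('a) k i) else 0)"
  by (simp add: tr_def coeff_sum)

lemma tr_in_G [simp]: "tr m k \<in> G m"
  by (simp add: G_iff_coeff coeff_tr)

lemma tr_Suc:
  "(tr (Suc m) k :: 'a::prime_card mod_ring poly) = pCons (of_nat (k mod CARD('a))) (tr m (k div CARD('a)))"
  by (rule poly_eqI) (auto simp: coeff_tr coeff_pCons digit_def div_mult2_eq split: nat.splits)

lemma tr_eq_0_iff: "(tr m k :: 'a::prime_card mod_ring poly) = 0 \<longleftrightarrow> CARD('a) ^ m dvd k"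
proof (induction m arbitrary: k)
  case (Suc m)
  let ?b = "CARD('a)"
  have "(of_nat (k mod ?b) :: 'a mod_ring) = 0 \<longleftrightarrow> ?b dvd k"
    using to_int_mod_ring_of_nat[of "k mod ?b", where 'a='a] two_le_card[where 'a='a]
    by (auto simp: mod_eq_0_iff_dvd simp flip: to_int_mod_ring_hom.hom_0_iff)
  moreover have "?b * ?b ^ m dvd k \<longleftrightarrow> ?b dvd k \<and> ?b ^ m dvd k div ?b"
    using two_le_card[where 'a='a] by (auto simp: dvd_mult_imp_div elim!: dvdE)
  ultimately show ?case by (simp add: tr_Suc Suc.IH)
qed (simp add: tr_def)

text \<open>The coefficients of \<open>K\<close> are read as base-b digits. Stating the size through
  \<open>floorlog\<close> also covers \<open>K = 0\<close>, where k = 0.\<close>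

lemma exists_tr_eq:
  fixes K :: "'a::prime_card mod_ring poly"
  assumes "K \<in> G m"
  shows "\<exists>k. tr m k = K \<and> floorlog CARD('a) k = mu_poly K"
  using assms
proof (induction m arbitrary: K)
  case 0
  then show ?case by (intro exI[of _ 0]) (simp add: G_0 tr_def floorlog_def)
next
  case (Suc m)
  let ?b = "CARD('a)"
  have b: "1 < ?b" using two_le_card[where 'a='a] by simp
  obtain c K' where K: "K = pCons c K'" "K' \<in> G m"
    using Suc.prems unfolding G_Suc by fast
  obtain k' where k': "tr m k' = K'" "floorlog ?b k' = mu_poly K'"
    using Suc.IH[OF K(2)] by blast
  obtain d where d: "d < ?b" "c = of_nat d"
    using surj_of_nat_mod_ring by blast
  have c0: "c = 0 \<longleftrightarrow> d = 0"
    using to_int_mod_ring_of_nat[OF d(1)] d(2) by (auto simp flip: to_int_mod_ring_hom.hom_0_iff)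
  have k0: "k' = 0 \<longleftrightarrow> K' = 0"
  proof -
    have "k' = 0 \<longleftrightarrow> floorlog ?b k' = 0" using b by (simp add: floorlog_eq_zero_iff)
    then show ?thesis unfolding k'(2) by (simp add: mu_poly_def)
  qed
  then have k1: "0 < k' \<longleftrightarrow> K' \<noteq> 0" by (metis neq0_conv)
  show ?case
  proof (intro exI conjI)
    show "tr (Suc m) (d + ?b * k') = K"
      using d(1) b by (simp add: tr_Suc K(1) k'(1) d(2))
    show "floorlog ?b (d + ?b * k') = mu_poly K"
      using d(1) b by (subst compute_floorlog) (auto simp: K(1) mu_poly_pCons k'(2) c0 k0 k1)
  qed
qed

section \<open>One-dimensional sums\<close>

definition mu_weight :: "nat \<Rightarrow> real \<Rightarrow> nat \<Rightarrow> real" where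
  "mu_weight b \<sigma> k = real b powr (- \<sigma> * real (mu b k))"

text \<open>The value of the sum of \<open>mu_weight b \<sigma> k\<close> over all k >= 1, for
  \<sigma> > 1.\<close>

definition mu_series :: "nat \<Rightarrow> real \<Rightarrow> real" where
  "mu_series b \<sigma> = (real b - 1) / (real b powr \<sigma> - real b)"

lemma mu_weight_nonneg: "0 \<le> mu_weight b \<sigma> k"
  by (simp add: mu_weight_def)

lemma mu_series_pos:
  assumes "1 < b" "1 < \<sigma>"
  shows "0 < mu_series b \<sigma>"
proof -
  have "real b powr 1 < real b powr \<sigma>" using assms by (intro powr_less_mono) auto
  then show ?thesis using assms by (simp add: mu_series_def)
qed

text \<open>Grouped by number of digits, the series is geometric with ratio b^(1 - \<sigma>): there
  are (b - 1) b^L integers with L + 1 digits, each of weight b^(-\<sigma>(L + 1)).\<close>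

lemma sum_mu_weight_power:
  assumes b: "1 < b" and \<sigma>: "1 < \<sigma>"
  shows "(\<Sum>k\<in>{1..<b ^ L}. mu_weight b \<sigma> k) = mu_series b \<sigma> * (1 - (real b powr (1 - \<sigma>)) ^ L)"
proof (induction L)
  case (Suc L)
  let ?x = "real b powr (1 - \<sigma>)"
  have w: "mu_weight b \<sigma> k = real b powr (- \<sigma>) * (real b powr (- \<sigma>)) ^ L" if "k \<in> {b ^ L..<b ^ Suc L}" for k
  proof -
    have "0 < k" using that b by (auto intro: less_le_trans[of 0 "b ^ L"])
    moreover have "floorlog b k = Suc L"
      using that b floorlog_le_iff[of b k "Suc L"] floorlog_ge_SucI[of b L k] by auto
    ultimately show ?thesis using b
      by (simp add: mu_weight_def mu_eq_floorlog powr_power algebra_simps flip: powr_add)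
  qed
  have "real b powr 1 < real b powr \<sigma>" using b \<sigma> by (intro powr_less_mono) auto
  \<comment> \<open>Identifies the block of L + 1 digits as the increment Z (1 - x) x^L of Z (1 -
    x^L).\<close>
  then have Z: "mu_series b \<sigma> * (1 - ?x) = (real b - 1) * real b powr (- \<sigma>)"
    using b by (simp add: mu_series_def powr_diff powr_minus field_simps)
  have x: "?x ^ L = real b ^ L * (real b powr (- \<sigma>)) ^ L"
    using b by (simp add: powr_diff powr_minus power_mult_distrib[symmetric] field_simps)
  have "{1..<b ^ Suc L} = {1..<b ^ L} \<union> {b ^ L..<b ^ Suc L}"
    using b by (intro ivl_disj_un_two(3)[symmetric]) auto
  then have "(\<Sum>k\<in>{1..<b ^ Suc L}. mu_weight b \<sigma> k) =
      (\<Sum>k\<in>{1..<b ^ L}. mu_weight b \<sigma> k) + (\<Sum>k\<in>{b ^ L..<b ^ Suc L}. mu_weight b \<sigma> k)"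
    by (simp only:) (rule sum.union_disjoint, auto)
  also have "(\<Sum>k\<in>{b ^ L..<b ^ Suc L}. mu_weight b \<sigma> k) = (real b - 1) * real b powr (- \<sigma>) * ?x ^ L"
    using b by (subst sum.cong[OF refl w]) (auto simp: x of_nat_diff algebra_simps)
  also have "\<dots> = mu_series b \<sigma> * (1 - ?x) * ?x ^ L" by (simp only: Z)
  finally show ?case unfolding Suc.IH power_Suc by (simp add: algebra_simps)
qed simp

lemma sum_mu_weight_le:
  assumes b: "1 < b" and \<sigma>: "1 < \<sigma>"
  shows "(\<Sum>k\<in>{1..M}. mu_weight b \<sigma> k) \<le> mu_series b \<sigma>"
proof -
  have "M < b ^ M" using b by (intro power_gt_expt) simp
  then have "(\<Sum>k\<in>{1..M}. mu_weight b \<sigma> k) \<le> (\<Sum>k\<in>{1..<b ^ M}. mu_weight b \<sigma> k)"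
    by (intro sum_mono2) (auto simp: mu_weight_nonneg)
  also have "\<dots> \<le> mu_series b \<sigma> * 1"
    unfolding sum_mu_weight_power[OF assms]
    using mu_series_pos[OF assms] by (intro mult_left_mono) auto
  finally show ?thesis by simp
qed

text \<open>Multiplication by b^m adds \<open>m\<close> to \<open>mu\<close> and so costs a factor
  b^(-\<sigma> m) <= b^(-m). This compensates the b^m - 1 candidates, all of which are admissible
  for such an entry when the other coordinates already satisfy the congruence.\<close>

lemma sum_mu_weight_multiples_le:
  assumes b: "1 < b" and \<sigma>: "1 < \<sigma>"
  shows "(real b ^ m - 1) * (\<Sum>k\<in>{k \<in> {1..M}. b ^ m dvd k}. mu_weight b \<sigma> k) \<le> mu_series b \<sigma>"
proof -
  let ?t = "real b powr (- \<sigma> * real m)"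
  have bm: "0 < b ^ m" using b by simp
  have inj: "inj_on (\<lambda>k. k * b ^ m) {1..M div b ^ m}" using b by (auto simp: inj_on_def)
  have "{k \<in> {1..M}. b ^ m dvd k} = (\<lambda>k. k * b ^ m) ` {1..M div b ^ m}"
    using bm by (auto simp: image_iff less_eq_div_iff_mult_less_eq Suc_le_eq mult.commute elim!: dvdE)
  then have "(\<Sum>k\<in>{k \<in> {1..M}. b ^ m dvd k}. mu_weight b \<sigma> k) =
      (\<Sum>k\<in>{1..M div b ^ m}. mu_weight b \<sigma> (k * b ^ m))"
    by (simp only: sum.reindex[OF inj] o_def)
  also have "\<dots> = ?t * (\<Sum>k\<in>{1..M div b ^ m}. mu_weight b \<sigma> k)"
    unfolding sum_distrib_left using b
    by (intro sum.cong refl)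
      (simp add: mu_weight_def mu_eq_floorlog algebra_simps flip: powr_add)
  finally have "(real b ^ m - 1) * (\<Sum>k\<in>{k \<in> {1..M}. b ^ m dvd k}. mu_weight b \<sigma> k) =
      ((real b ^ m - 1) * ?t) * (\<Sum>k\<in>{1..M div b ^ m}. mu_weight b \<sigma> k)" by simp
  also have "\<dots> \<le> 1 * mu_series b \<sigma>"
  proof (intro mult_mono sum_mu_weight_le assms sum_nonneg mu_weight_nonneg)
    have "?t \<le> real b powr (- real m)"
      using b \<sigma> by (intro powr_mono) (auto simp: mult_le_cancel_right1)
    then have "(real b ^ m - 1) * ?t \<le> (real b ^ m - 1) * real b powr (- real m)"
      using b by (intro mult_left_mono) auto
    also have "\<dots> \<le> 1" using b by (simp add: powr_minus powr_realpow field_simps)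
    finally show "(real b ^ m - 1) * ?t \<le> 1" .
  qed simp
  finally show ?thesis by simp
qed

section \<open>Jensen's inequality for sums of powers\<close>

text \<open>After normalising to x + y = 1 it suffices that z <= z^r on [0, 1].\<close>

lemma powr_add_le:
  fixes x y :: real
  assumes "0 \<le> x" "0 \<le> y" "0 < r" "r \<le> 1"
  shows "(x + y) powr r \<le> x powr r + y powr r"
proof (cases "x + y = 0")
  case False
  then have s: "0 < x + y" using assms by linarith
  have le: "z / (x + y) \<le> (z / (x + y)) powr r" if "0 \<le> z" "z \<le> x + y" for z
  proof (cases "z = 0")
    case False
    then have "(z / (x + y)) powr 1 \<le> (z / (x + y)) powr r"
      using that s assms by (intro powr_mono') auto
    then show ?thesis using that s by simp
  qed simp
  have "1 = x / (x + y) + y / (x + y)" using s by (simp flip: add_divide_distrib)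
  also have "\<dots> \<le> (x / (x + y)) powr r + (y / (x + y)) powr r"
    using assms by (intro add_mono le) auto
  also have "\<dots> = (x powr r + y powr r) / (x + y) powr r"
    using assms s by (simp add: powr_divide add_divide_distrib)
  finally show ?thesis using s by (simp add: le_divide_eq)
qed (use assms in auto)

lemma powr_sum_le:
  fixes f :: "'i \<Rightarrow> real"
  assumes "\<And>i. i \<in> A \<Longrightarrow> 0 \<le> f i" "0 < r" "r \<le> 1"
  shows "sum f A powr r \<le> (\<Sum>i\<in>A. f i powr r)"
  using assms(1)
proof (induction A rule: infinite_finite_induct)
  case (insert x F)
  then have "(f x + sum f F) powr r \<le> f x powr r + sum f F powr r"
    using assms(2,3) by (intro powr_add_le) (auto intro: sum_nonneg)
  then show ?case using insert by force
qed (use assms in auto)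

lemma nonneg_summable_on_infsum_le:
  fixes f :: "'i \<Rightarrow> real"
  assumes "\<And>i. i \<in> A \<Longrightarrow> 0 \<le> f i"
    and "\<And>F. finite F \<Longrightarrow> F \<subseteq> A \<Longrightarrow> sum f F \<le> B"
  shows "f summable_on A" "infsum f A \<le> B"
proof -
  show s: "f summable_on A"
    using assms by (intro nonneg_bdd_above_summable_on) (auto intro!: bdd_aboveI[of _ B])
  show "infsum f A \<le> B"
    using assms(2) by (intro infsum_le_finite_sums[OF s])
qed

text \<open>The finite inequality bounds every finite sum of \<open>f\<close> by T^(1/r), where T is
  the sum of the powers; the bound passes to the infinite sum and is raised to the power r.\<close>

lemma powr_infsum_le:
  fixes f :: "'i \<Rightarrow> real"
  assumes f: "\<And>i. i \<in> A \<Longrightarrow> 0 \<le> f i" and r: "0 < r" "r \<le> 1"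
    and s: "(\<lambda>i. f i powr r) summable_on A"
  shows "infsum f A powr r \<le> infsum (\<lambda>i. f i powr r) A"
proof -
  let ?T = "infsum (\<lambda>i. f i powr r) A"
  have T: "0 \<le> ?T" by (rule infsum_nonneg) simp
  have "sum f F \<le> ?T powr (1 / r)" if "finite F" "F \<subseteq> A" for F
  proof -
    have F: "0 \<le> sum f F" using that f by (auto intro: sum_nonneg)
    have "sum f F powr r \<le> (\<Sum>i\<in>F. f i powr r)"
      using that f r by (intro powr_sum_le) auto
    also have "\<dots> \<le> ?T" using that by (intro finite_sum_le_infsum s) auto
    finally have "(sum f F powr r) powr (1 / r) \<le> ?T powr (1 / r)"
      using r by (intro powr_mono2) auto
    then show ?thesis using r F by (simp add: powr_powr)
  qed
  then have "infsum f A \<le> ?T powr (1 / r)"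
    using f by (intro nonneg_summable_on_infsum_le(2))
  then have "infsum f A powr r \<le> (?T powr (1 / r)) powr r"
    using r f by (intro powr_mono2) (auto intro: infsum_nonneg)
  then show ?thesis using r T by (simp add: powr_powr)
qed

section \<open>The component-by-component bound\<close>

text \<open>The exponent \<sigma> is a parameter because Jensen's inequality replaces 2\<alpha> by
  2\<alpha>r.\<close>

definition dual_weight :: "nat \<Rightarrow> real \<Rightarrow> nat set \<Rightarrow> (nat \<Rightarrow> nat) \<Rightarrow> real" where
  "dual_weight b \<sigma> u k = real b powr (- \<sigma> * real (\<Sum>j\<in>u. mu b (k j)))"

lemma dual_weight_nonneg [simp]: "0 \<le> dual_weight b \<sigma> u k"
  by (simp add: dual_weight_def)

lemma dual_weight_eq_prod:
  assumes "0 < b" "finite u"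
  shows "dual_weight b \<sigma> u k = (\<Prod>j\<in>u. mu_weight b \<sigma> (k j))"
  using assms by (simp add: dual_weight_def mu_weight_def powr_sum sum_distrib_left flip: sum_negf)

lemma sum_PiE_insert:
  assumes "finite v" "x \<notin> v"
  shows "sum F (PiE (insert x v) (\<lambda>_. B)) = (\<Sum>k\<in>PiE v (\<lambda>_. B). \<Sum>\<kappa>\<in>B. F (k(x := \<kappa>)))"
proof -
  have "sum F (PiE (insert x v) (\<lambda>_. B)) = (\<Sum>(\<kappa>, k)\<in>B \<times> PiE v (\<lambda>_. B). F (k(x := \<kappa>)))"
    unfolding PiE_insert_eq using inj_combinator[OF assms(2), of "\<lambda>_. B"]
    by (subst sum.reindex) (auto simp: case_prod_unfold)
  also have "\<dots> = (\<Sum>k\<in>PiE v (\<lambda>_. B). \<Sum>\<kappa>\<in>B. F (k(x := \<kappa>)))"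
    unfolding sum.cartesian_product[symmetric] by (rule sum.swap)
  finally show ?thesis .
qed

lemma sum_dual_weight_box_le:
  assumes "1 < b" "1 < \<sigma>" "finite u"
  shows "(\<Sum>k\<in>PiE u (\<lambda>_. {1..M}). dual_weight b \<sigma> u k) \<le> mu_series b \<sigma> ^ card u"
proof -
  have "(\<Sum>k\<in>PiE u (\<lambda>_. {1..M}). dual_weight b \<sigma> u k) =
      (\<Prod>j\<in>u. \<Sum>k\<in>{1..M}. mu_weight b \<sigma> k)"
    using assms by (subst prod_sum_PiE) (auto simp: dual_weight_eq_prod)
  also have "\<dots> \<le> mu_series b \<sigma> ^ card u"
    using sum_mu_weight_le[OF assms(1,2)]
    by (simp add: power_mono sum_nonneg mu_weight_nonneg)
  finally show ?thesis .
qed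

text \<open>Reduces infinite sums over positive vectors to boxes, where they factor over the
  coordinates. The sum of all entries of all vectors serves as the common side length.\<close>

lemma finite_subset_box:
  fixes u :: "nat set" and F :: "(nat \<Rightarrow> nat) set"
  assumes "finite F" "finite u" "F \<subseteq> PiE u (\<lambda>_. {1..})"
  shows "\<exists>M. F \<subseteq> PiE u (\<lambda>_. {1..M})"
proof (intro exI subsetI PiE_I)
  fix k j assume k: "k \<in> F" and j: "j \<in> u"
  have "k j \<le> (\<Sum>j\<in>u. k j)" using assms(2) j by (intro member_le_sum) auto
  also have "\<dots> \<le> (\<Sum>k\<in>F. \<Sum>j\<in>u. k j)"
    using assms(1) k by (intro member_le_sum[of k F "\<lambda>k. \<Sum>j\<in>u. k j"]) auto
  finally show "k j \<in> {1..\<Sum>k\<in>F. \<Sum>j\<in>u. k j}" using assms(3) k j by (auto simp: PiE_def Pi_def)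
qed (use assms(3) in \<open>auto simp: PiE_def extensional_def\<close>)

lemma summable_on_dual_weight:
  assumes b: "1 < b" "1 < \<sigma>" and u: "finite u" and S: "S \<subseteq> PiE u (\<lambda>_. {1..})"
  shows "dual_weight b \<sigma> u summable_on S"
proof (rule nonneg_summable_on_infsum_le(1))
  fix F assume F: "finite F" "F \<subseteq> S"
  then obtain M where "F \<subseteq> PiE u (\<lambda>_. {1..M})"
    using finite_subset_box[OF F(1) u] S by blast
  then have "sum (dual_weight b \<sigma> u) F \<le> sum (dual_weight b \<sigma> u) (PiE u (\<lambda>_. {1..M}))"
    using u by (intro sum_mono2) (auto intro: finite_PiE)
  also have "\<dots> \<le> mu_series b \<sigma> ^ card u" by (rule sum_dual_weight_box_le[OF b u])
  finally show "sum (dual_weight b \<sigma> u) F \<le> mu_series b \<sigma> ^ card u" .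
qed simp

section \<open>Averaging over the candidates for one component\<close>

lemma dual_net_iff:
  "k \<in> dual_net m p q u \<longleftrightarrow> k \<in> PiE u (\<lambda>_. {1..}) \<and> p dvd (\<Sum>j\<in>u. tr m (k j) * q j)"
  by (simp add: dual_net_def cong_0_iff)

lemma dual_net_cong:
  assumes "\<And>j. j \<in> u \<Longrightarrow> q j = q' j"
  shows "dual_net m p q u = dual_net m p q' u"
  unfolding dual_net_def using assms by (simp cong: sum.cong)

lemma dvd_G_imp_zero:
  assumes "degree p = m" "p dvd g" "g \<in> G m"
  shows "g = 0"
  using assms by (metis (mono_tags, lifting) G_def dvd_imp_degree_le leD mem_Collect_eq)

text \<open>A nonzero \<open>t\<close> of degree below \<open>m\<close> is invertible modulo
  \<open>p\<close>, so the congruence has one solution modulo \<open>p\<close>. If \<open>p\<close>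
  divides \<open>S\<close>, that solution is 0, which is not a candidate; this case therefore
  contributes only for \<open>t = 0\<close>.\<close>

lemma card_solutions_le:
  fixes p :: "'a::prime_card mod_ring poly"
  assumes p: "irreducible p" "degree p = m" and t: "t \<in> G m"
  shows "card {g \<in> G m - {0}. p dvd t * g + S} \<le>
    (if p dvd S then (if t = 0 then CARD('a) ^ m - 1 else 0) else (if t = 0 then 0 else 1))"
proof -
  let ?A = "{g \<in> G m - {0}. p dvd t * g + S}"
  have pr: "prime_elem p" using p(1) by (rule irreducible_imp_prime_elem)
  have nt: "\<not> p dvd t" if "t \<noteq> 0" using dvd_G_imp_zero[OF p(2) _ t] that by blast
  consider "p dvd S" "t = 0" | "p dvd S" "t \<noteq> 0" | "\<not> p dvd S" "t = 0" | "\<not> p dvd S" "t \<noteq> 0" by blast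
  then show ?thesis
  proof cases
    case 1
    have "card ?A \<le> card (G m - {0} :: 'a mod_ring poly set)" by (intro card_mono) auto
    then show ?thesis using 1 by (simp add: card_G)
  next
    case 2
    have "?A = {}"
    proof (rule ccontr)
      assume "?A \<noteq> {}"
      then obtain g where g: "g \<in> G m" "g \<noteq> 0" "p dvd t * g + S" by blast
      then have "p dvd t * g" using 2(1) by (simp add: dvd_add_left_iff)
      then have "p dvd g" using nt[OF 2(2)] prime_elem_dvd_multD[OF pr] by blast
      then show False using dvd_G_imp_zero[OF p(2) _ g(1)] g(2) by blast
    qed
    then show ?thesis using 2 by simp
  next
    case 3
    then show ?thesis by simp
  next
    case 4
    have "g = h" if gh: "g \<in> ?A" "h \<in> ?A" for g h
    proof -
      have "p dvd (t * g + S) - (t * h + S)" using gh by (intro dvd_diff) auto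
      then have "p dvd t * (g - h)" by (simp add: algebra_simps)
      then have "p dvd g - h" using nt[OF 4(2)] prime_elem_dvd_multD[OF pr] by blast
      then have "g - h = 0" using gh by (intro dvd_G_imp_zero[OF p(2)] G_diff) auto
      then show ?thesis by simp
    qed
    then have "card ?A \<le> 1" by (auto simp: card_le_Suc0_iff_eq)
    then show ?thesis using 4 by simp
  qed
qed

text \<open>If \<open>p\<close> divides \<open>S\<close>, only multiples of b^m count, each with all
  b^m - 1 candidates; otherwise each entry counts at most once. Both cases give the same bound, so
  the fixed coordinates can be summed separately afterwards.\<close>

lemma sum_mu_weight_solutions_le:
  fixes p :: "'a::prime_card mod_ring poly"
  assumes p: "irreducible p" "degree p = m" and \<sigma>: "1 < \<sigma>"
  shows "(\<Sum>\<kappa>\<in>{1..M}. mu_weight CARD('a) \<sigma> \<kappa> * real (card {g \<in> G m - {0}. p dvd tr m \<kappa> * g + S}))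
    \<le> mu_series CARD('a) \<sigma>"
proof -
  let ?b = "CARD('a)"
  let ?c = "\<lambda>\<kappa>. card {g \<in> G m - {0}. p dvd tr m \<kappa> * g + S}"
  have b: "1 < ?b" using two_le_card[where 'a='a] by simp
  have c: "?c \<kappa> \<le> (if p dvd S then (if ?b ^ m dvd \<kappa> then ?b ^ m - 1 else 0) else (if ?b ^ m dvd \<kappa> then 0 else 1))" for \<kappa>
    using card_solutions_le[OF p tr_in_G[of m \<kappa>], of S] unfolding tr_eq_0_iff .
  show ?thesis
  proof (cases "p dvd S")
    case True
    have "(\<Sum>\<kappa>\<in>{1..M}. mu_weight ?b \<sigma> \<kappa> * real (?c \<kappa>)) \<le>
        (\<Sum>\<kappa>\<in>{1..M}. if ?b ^ m dvd \<kappa> then (real ?b ^ m - 1) * mu_weight ?b \<sigma> \<kappa> else 0)"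
    proof (rule sum_mono)
      fix \<kappa>
      have "real (?c \<kappa>) \<le> (if ?b ^ m dvd \<kappa> then real ?b ^ m - 1 else 0)"
      proof -
        have "?c \<kappa> \<le> (if ?b ^ m dvd \<kappa> then ?b ^ m - 1 else 0)" using c[of \<kappa>] True by simp
        then have "real (?c \<kappa>) \<le> real (if ?b ^ m dvd \<kappa> then ?b ^ m - 1 else 0)" by (simp only: of_nat_le_iff)
        also have "\<dots> = (if ?b ^ m dvd \<kappa> then real ?b ^ m - 1 else 0)" using b by (simp add: of_nat_diff)
        finally show ?thesis .
      qed
      then have "mu_weight ?b \<sigma> \<kappa> * real (?c \<kappa>) \<le> mu_weight ?b \<sigma> \<kappa> * (if ?b ^ m dvd \<kappa> then real ?b ^ m - 1 else 0)"
        by (intro mult_left_mono mu_weight_nonneg)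
      then show "mu_weight ?b \<sigma> \<kappa> * real (?c \<kappa>) \<le> (if ?b ^ m dvd \<kappa> then (real ?b ^ m - 1) * mu_weight ?b \<sigma> \<kappa> else 0)"
        by (simp add: mult.commute split: if_splits)
    qed
    also have "\<dots> = (real ?b ^ m - 1) * (\<Sum>\<kappa>\<in>{\<kappa> \<in> {1..M}. ?b ^ m dvd \<kappa>}. mu_weight ?b \<sigma> \<kappa>)"
      unfolding sum_distrib_left by (rule sum.inter_filter[symmetric]) simp
    also have "\<dots> \<le> mu_series ?b \<sigma>" by (rule sum_mu_weight_multiples_le[OF b \<sigma>])
    finally show ?thesis .
  next
    case False
    have "(\<Sum>\<kappa>\<in>{1..M}. mu_weight ?b \<sigma> \<kappa> * real (?c \<kappa>)) \<le> (\<Sum>\<kappa>\<in>{1..M}. mu_weight ?b \<sigma> \<kappa> * 1)"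
    proof (intro sum_mono mult_left_mono mu_weight_nonneg)
      fix \<kappa>
      have "?c \<kappa> \<le> (if ?b ^ m dvd \<kappa> then 0 else 1)" using c[of \<kappa>] False by (simp only: if_False)
      also have "\<dots> \<le> 1" by simp
      finally show "real (?c \<kappa>) \<le> 1" by linarith
    qed
    then show ?thesis using sum_mu_weight_le[OF b \<sigma>, of M] by simp
  qed
qed

text \<open>The sums over candidates and vectors are exchanged and the entry at \<open>x\<close> is
  split off: for fixed other entries, the sum over this entry and the candidates is at most
  \<open>mu_series\<close>.\<close>

lemma sum_dual_net_box_le:
  fixes p :: "'a::prime_card mod_ring poly"
  assumes p: "irreducible p" "degree p = m" and \<sigma>: "1 < \<sigma>" and v: "finite v" "x \<notin> v"
  shows "(\<Sum>g\<in>G m - {0}. \<Sum>k\<in>dual_net m p (q(x := g)) (insert x v) \<inter> PiE (insert x v) (\<lambda>_. {1..M}).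
      dual_weight CARD('a) \<sigma> (insert x v) k) \<le> mu_series CARD('a) \<sigma> ^ card (insert x v)"
proof -
  let ?b = "CARD('a)" and ?u = "insert x v"
  let ?B = "\<lambda>u. PiE u (\<lambda>_. {1..M})"
  let ?W = "dual_weight ?b \<sigma> ?u"
  let ?S = "\<lambda>k. \<Sum>j\<in>v. tr m (k j) * q j"
  have b: "1 < ?b" using two_le_card[where 'a='a] by simp
  have fin: "finite (?B ?u)" using v by (auto intro: finite_PiE)
  have mem: "k \<in> dual_net m p (q(x := g)) ?u \<longleftrightarrow> p dvd tr m (k x) * g + ?S k" if "k \<in> ?B ?u" for k g
  proof -
    have "(\<Sum>j\<in>v. tr m (k j) * (q(x := g)) j) = ?S k" using v by (intro sum.cong) auto
    moreover have "k \<in> PiE ?u (\<lambda>_. {1..})" using that by (auto simp: PiE_def Pi_def)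
    ultimately show ?thesis using v by (simp add: dual_net_iff)
  qed
  have "(\<Sum>g\<in>G m - {0}. \<Sum>k\<in>dual_net m p (q(x := g)) ?u \<inter> ?B ?u. ?W k) =
      (\<Sum>g\<in>G m - {0}. \<Sum>k\<in>?B ?u. if p dvd tr m (k x) * g + ?S k then ?W k else 0)"
  proof (rule sum.cong[OF refl])
    fix g
    have "dual_net m p (q(x := g)) ?u \<inter> ?B ?u = {k \<in> ?B ?u. p dvd tr m (k x) * g + ?S k}"
      using mem by blast
    then show "(\<Sum>k\<in>dual_net m p (q(x := g)) ?u \<inter> ?B ?u. ?W k) =
        (\<Sum>k\<in>?B ?u. if p dvd tr m (k x) * g + ?S k then ?W k else 0)"
      using sum.inter_filter[OF fin] by simp
  qed
  also have "\<dots> = (\<Sum>k\<in>?B ?u. \<Sum>g\<in>G m - {0}. if p dvd tr m (k x) * g + ?S k then ?W k else 0)"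
    by (rule sum.swap)
  also have "\<dots> = (\<Sum>k\<in>?B ?u. ?W k * real (card {g \<in> G m - {0}. p dvd tr m (k x) * g + ?S k}))"
  proof (rule sum.cong[OF refl])
    fix k
    have "(\<Sum>g\<in>G m - {0}. if p dvd tr m (k x) * g + ?S k then ?W k else 0) =
        (\<Sum>g\<in>{g \<in> G m - {0}. p dvd tr m (k x) * g + ?S k}. ?W k)"
      by (rule sum.inter_filter[symmetric]) simp
    then show "(\<Sum>g\<in>G m - {0}. if p dvd tr m (k x) * g + ?S k then ?W k else 0) =
        ?W k * real (card {g \<in> G m - {0}. p dvd tr m (k x) * g + ?S k})"
      by (simp add: mult.commute)
  qed
  also have "\<dots> = (\<Sum>k\<in>?B v. \<Sum>\<kappa>\<in>{1..M}. ?W (k(x := \<kappa>)) *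
      real (card {g \<in> G m - {0}. p dvd tr m ((k(x := \<kappa>)) x) * g + ?S (k(x := \<kappa>))}))"
    by (rule sum_PiE_insert[OF v])
  also have "\<dots> = (\<Sum>k\<in>?B v. dual_weight ?b \<sigma> v k *
      (\<Sum>\<kappa>\<in>{1..M}. mu_weight ?b \<sigma> \<kappa> * real (card {g \<in> G m - {0}. p dvd tr m \<kappa> * g + ?S k})))"
  proof (intro sum.cong refl)
    fix k
    have S: "?S (k(x := \<kappa>)) = ?S k" for \<kappa> using v by (intro sum.cong) auto
    have W: "?W (k(x := \<kappa>)) = dual_weight ?b \<sigma> v k * mu_weight ?b \<sigma> \<kappa>" for \<kappa>
    proof -
      have "(\<Prod>j\<in>v. mu_weight ?b \<sigma> ((k(x := \<kappa>)) j)) = (\<Prod>j\<in>v. mu_weight ?b \<sigma> (k j))"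
        using v by (intro prod.cong) auto
      then show ?thesis using v b by (simp add: dual_weight_eq_prod)
    qed
    show "(\<Sum>\<kappa>\<in>{1..M}. ?W (k(x := \<kappa>)) *
        real (card {g \<in> G m - {0}. p dvd tr m ((k(x := \<kappa>)) x) * g + ?S (k(x := \<kappa>))})) =
      dual_weight ?b \<sigma> v k *
      (\<Sum>\<kappa>\<in>{1..M}. mu_weight ?b \<sigma> \<kappa> * real (card {g \<in> G m - {0}. p dvd tr m \<kappa> * g + ?S k}))"
      unfolding S W sum_distrib_left by (simp add: mult.assoc)
  qed
  also have "\<dots> \<le> (\<Sum>k\<in>?B v. dual_weight ?b \<sigma> v k * mu_series ?b \<sigma>)"
    by (intro sum_mono mult_left_mono sum_mu_weight_solutions_le[OF p \<sigma>] dual_weight_nonneg)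
  also have "\<dots> = (\<Sum>k\<in>?B v. dual_weight ?b \<sigma> v k) * mu_series ?b \<sigma>"
    by (simp add: sum_distrib_right)
  also have "\<dots> \<le> mu_series ?b \<sigma> ^ card v * mu_series ?b \<sigma>"
    using mu_series_pos[OF b \<sigma>] by (intro mult_right_mono sum_dual_weight_box_le b \<sigma> v) auto
  also have "\<dots> = mu_series ?b \<sigma> ^ card ?u" using v by simp
  finally show ?thesis .
qed

text \<open>Candidates and dual vectors are treated as one infinite sum over pairs. Each finite set
  of pairs lies over a common box, which gives summability and the bound together.\<close>

lemma sum_dual_net_le:
  fixes p :: "'a::prime_card mod_ring poly"
  assumes p: "irreducible p" "degree p = m" and \<sigma>: "1 < \<sigma>" and v: "finite v" "x \<notin> v"
  shows "(\<Sum>g\<in>G m - {0}. infsum (dual_weight CARD('a) \<sigma> (insert x v)) (dual_net m p (q(x := g)) (insert x v)))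
    \<le> mu_series CARD('a) \<sigma> ^ card (insert x v)"
proof -
  let ?u = "insert x v"
  let ?W = "dual_weight CARD('a) \<sigma> ?u" and ?D = "\<lambda>g. dual_net m p (q(x := g)) ?u"
  let ?S = "SIGMA g:G m - {0}. ?D g"
  have bound: "(\<Sum>(g, k)\<in>F. ?W k) \<le> mu_series CARD('a) \<sigma> ^ card ?u"
    if F: "finite F" "F \<subseteq> ?S" for F
  proof -
    have "snd ` F \<subseteq> PiE ?u (\<lambda>_. {1..})"
    proof
      fix k assume "k \<in> snd ` F"
      then obtain g where "(g, k) \<in> F" by auto
      then have "k \<in> ?D g" using F(2) by blast
      then show "k \<in> PiE ?u (\<lambda>_. {1..})" by (simp only: dual_net_iff)
    qed
    then obtain M where M: "snd ` F \<subseteq> PiE ?u (\<lambda>_. {1..M})"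
      using finite_subset_box[of "snd ` F" ?u] F(1) v by auto
    have fin: "finite (?D g \<inter> PiE ?u (\<lambda>_. {1..M}))" for g
      using v by (intro finite_Int disjI2 finite_PiE) auto
    have "(\<Sum>(g, k)\<in>F. ?W k) \<le> (\<Sum>(g, k)\<in>(SIGMA g:G m - {0}. ?D g \<inter> PiE ?u (\<lambda>_. {1..M})). ?W k)"
    proof (intro sum_mono2 finite_SigmaI subsetI)
      fix z assume z: "z \<in> F"
      then have "snd z \<in> PiE ?u (\<lambda>_. {1..M})" using M by blast
      then show "z \<in> (SIGMA g:G m - {0}. ?D g \<inter> PiE ?u (\<lambda>_. {1..M}))"
        using z F(2) by (cases z) (simp only: snd_conv, blast)
    qed (use fin in auto)
    also have "\<dots> = (\<Sum>g\<in>G m - {0}. \<Sum>k\<in>?D g \<inter> PiE ?u (\<lambda>_. {1..M}). ?W k)"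
      using fin by (subst sum.Sigma) auto
    also have "\<dots> \<le> mu_series CARD('a) \<sigma> ^ card ?u"
      by (rule sum_dual_net_box_le[OF assms])
    finally show ?thesis .
  qed
  have nonneg: "0 \<le> (\<lambda>(g, k). ?W k) z" for z :: "'a mod_ring poly \<times> (nat \<Rightarrow> nat)"
    by (simp add: case_prod_unfold)
  note * = nonneg_summable_on_infsum_le[of ?S, OF nonneg bound]
  have "(\<Sum>g\<in>G m - {0}. infsum ?W (?D g)) = (\<Sum>\<^sub>\<infinity>g\<in>G m - {0}. \<Sum>\<^sub>\<infinity>k\<in>?D g. ?W k)"
    by simp
  also have "\<dots> = (\<Sum>\<^sub>\<infinity>(g, k)\<in>?S. ?W k)"
    using *(1) by (rule infsum_Sigma'_banach)
  finally show ?thesis using *(2) by simp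
qed

section \<open>The criterion along the component-by-component construction\<close>

lemma finite_nonempty_subsets [simp]: "finite (nonempty_subsets s)"
  by (simp add: nonempty_subsets_def)

lemma nonempty_subsetsD:
  assumes "u \<in> nonempty_subsets s"
  shows "finite u" "u \<noteq> {}" "u \<in> weight_index"
  using assms finite_subset[of u "{1..s}"] by (auto simp: nonempty_subsets_def weight_index_def)

lemma nonempty_subsets_mono:
  "v \<subseteq> u \<Longrightarrow> v \<noteq> {} \<Longrightarrow> u \<in> nonempty_subsets s \<Longrightarrow> v \<in> nonempty_subsets s"
  by (auto simp: nonempty_subsets_def)

lemma sum_nonempty_subsets_Suc:
  "sum f (nonempty_subsets (Suc l)) = sum f (nonempty_subsets l) + (\<Sum>v\<in>Pow {1..l}. f (insert (Suc l) v))"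
proof -
  have "nonempty_subsets (Suc l) = nonempty_subsets l \<union> insert (Suc l) ` Pow {1..l}"
  proof (intro equalityI subsetI)
    fix u assume u: "u \<in> nonempty_subsets (Suc l)"
    show "u \<in> nonempty_subsets l \<union> insert (Suc l) ` Pow {1..l}"
    proof (cases "Suc l \<in> u")
      case True
      then have "u = insert (Suc l) (u - {Suc l})" by blast
      moreover have "u - {Suc l} \<in> Pow {1..l}"
        using u by (auto simp: nonempty_subsets_def le_Suc_eq)
      ultimately show ?thesis by blast
    next
      case False
      then show ?thesis using u by (auto simp: nonempty_subsets_def le_Suc_eq)
    qed
  qed (auto simp: nonempty_subsets_def)
  moreover have "nonempty_subsets l \<inter> insert (Suc l) ` Pow {1..l} = {}"
    by (auto simp: nonempty_subsets_def)
  moreover have "inj_on (insert (Suc l)) (Pow {1..l})"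
    by (intro inj_onI) (metis Pow_iff atLeastAtMost_iff insert_ident not_less_eq_eq order_refl subsetD)
  ultimately show ?thesis
    by (simp add: sum.union_disjoint sum.reindex)
qed

lemma criterion_eq:
  fixes p :: "'a::prime_card mod_ring poly"
  shows "criterion \<alpha> \<gamma> m p l q =
    (\<Sum>u\<in>nonempty_subsets l. \<gamma> u * infsum (dual_weight CARD('a) (2 * \<alpha>) u) (dual_net m p q u))"
proof -
  have "dual_weight b (2 * \<alpha>) u = (\<lambda>k. real b powr (- 2 * \<alpha> * real (\<Sum>j\<in>u. mu b (k j))))" for b u
    by (rule ext) (simp add: dual_weight_def)
  then show ?thesis by (simp only: criterion_def infsum_cmult_right')
qed

lemma criterion_Suc_fun_upd:
  fixes p :: "'a::prime_card mod_ring poly"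
  shows "criterion \<alpha> \<gamma> m p (Suc l) (q(Suc l := g)) = criterion \<alpha> \<gamma> m p l q +
    (\<Sum>v\<in>Pow {1..l}. \<gamma> (insert (Suc l) v) * infsum (dual_weight CARD('a) (2 * \<alpha>) (insert (Suc l) v))
      (dual_net m p (q(Suc l := g)) (insert (Suc l) v)))"
proof -
  have "dual_net m p (q(Suc l := g)) u = dual_net m p q u" if "u \<in> nonempty_subsets l" for u
    using that by (intro dual_net_cong) (auto simp: nonempty_subsets_def)
  then show ?thesis unfolding criterion_eq sum_nonempty_subsets_Suc by simp
qed

lemma dual_weight_powr:
  "dual_weight b \<sigma> u k powr r = dual_weight b (\<sigma> * r) u k"
  by (simp add: dual_weight_def powr_powr algebra_simps)

text \<open>A new component adds the sets containing its index. For the minimizer, the r-th power of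
  this addition is at most the average over all candidates; subadditivity then adds it to the bound
  for the earlier components.\<close>

lemma criterion_cbc_le:
  fixes p :: "'a::prime_card mod_ring poly"
  assumes p: "irreducible p" "degree p = m"
    and \<alpha>: "1 / 2 < \<alpha>" and r: "1 / (2 * \<alpha>) < r" "r \<le> 1"
    and nonneg: "\<And>u. u \<in> weight_index \<Longrightarrow> 0 \<le> \<gamma> u"
    and cbc: "cbc_vector \<alpha> \<gamma> m p s q" and l: "l \<le> s"
  shows "criterion \<alpha> \<gamma> m p l q powr r \<le>
    (\<Sum>u\<in>nonempty_subsets l. \<gamma> u powr r * mu_series CARD('a) (2 * \<alpha> * r) ^ card u) / (real CARD('a) ^ m - 1)"
  using l
proof (induction l)
  case 0
  then show ?case by (simp add: criterion_eq nonempty_subsets_def)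
next
  case (Suc l)
  let ?b = "CARD('a)" and ?u = "\<lambda>v. insert (Suc l) v" and ?H = "G m - {0} :: 'a mod_ring poly set"
  let ?Z = "mu_series ?b (2 * \<alpha> * r)"
  let ?I = "\<lambda>\<sigma> g v. infsum (dual_weight ?b \<sigma> (?u v)) (dual_net m p (q(Suc l := g)) (?u v))"
  \<comment> \<open>The part of the criterion that the new component influences; minimizing the
    criterion is minimizing \<open>T\<close>.\<close>
  define T where "T = (\<lambda>g. \<Sum>v\<in>Pow {1..l}. \<gamma> (?u v) * ?I (2 * \<alpha>) g v)"
  have b: "1 < ?b" using two_le_card[where 'a='a] by simp
  have m: "0 < m" using p is_unit_iff_degree[of p] by (auto simp: irreducible_def intro: gr0I)
  have bm: "0 < real ?b ^ m - 1" using b m by simp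
  have r0: "0 < r" using \<alpha> r(1) by (smt (verit) divide_pos_pos)
  have \<sigma>: "1 < 2 * \<alpha> * r" using \<alpha> r(1) by (simp add: field_simps)
  have \<gamma>: "0 \<le> \<gamma> (?u v)" if "v \<in> Pow {1..l}" for v
    using that finite_subset[of v "{1..l}"] by (intro nonneg) (auto simp: weight_index_def)
  have crit: "criterion \<alpha> \<gamma> m p (Suc l) (q(Suc l := g)) = criterion \<alpha> \<gamma> m p l q + T g" for g
    unfolding T_def by (rule criterion_Suc_fun_upd)
  have min: "T (q (Suc l)) \<le> T g" if g: "g \<in> ?H" for g
  proof (cases "l = 0")
    case False
    then have "is_arg_min (\<lambda>h. criterion \<alpha> \<gamma> m p (Suc l) (q(Suc l := h))) (\<lambda>h. h \<in> ?H) (q (Suc l))"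
      using cbc Suc.prems by (simp add: cbc_vector_def)
    then have "criterion \<alpha> \<gamma> m p (Suc l) (q(Suc l := q (Suc l))) \<le> criterion \<alpha> \<gamma> m p (Suc l) (q(Suc l := g))"
      using g unfolding is_arg_min_linorder by blast
    then show ?thesis unfolding crit by simp
  next
    case True
    \<comment> \<open>The first component is prescribed, not chosen. It is still a minimizer: in one
      dimension the dual net is the same for every nonzero candidate, because such a candidate is
      invertible modulo \<open>p\<close>.\<close>
    have q1: "q (Suc 0) = 1" using cbc by (simp add: cbc_vector_def)
    have "p dvd t * g \<longleftrightarrow> p dvd t" for t
      using g dvd_G_imp_zero[OF p(2)] prime_elem_dvd_mult_iff[OF irreducible_imp_prime_elem[OF p(1)]] by blast
    then have "dual_net m p (q(Suc 0 := g)) {Suc 0} = dual_net m p q {Suc 0}"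
      by (auto simp: dual_net_iff q1)
    then show ?thesis unfolding T_def using True by simp
  qed
  have Tpowr: "T g powr r \<le> (\<Sum>v\<in>Pow {1..l}. \<gamma> (?u v) powr r * ?I (2 * \<alpha> * r) g v)" for g
  proof -
    have I: "0 \<le> ?I (2 * \<alpha>) g v" for v by (intro infsum_nonneg) simp
    have "T g powr r \<le> (\<Sum>v\<in>Pow {1..l}. (\<gamma> (?u v) * ?I (2 * \<alpha>) g v) powr r)"
      unfolding T_def using \<gamma> I r0 r(2) by (intro powr_sum_le) auto
    also have "\<dots> \<le> (\<Sum>v\<in>Pow {1..l}. \<gamma> (?u v) powr r * ?I (2 * \<alpha> * r) g v)"
    proof (rule sum_mono)
      fix v assume v: "v \<in> Pow {1..l}"
      then have "finite (?u v)" using finite_subset[of v "{1..l}"] by auto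
      then have "dual_weight ?b (2 * \<alpha> * r) (?u v) summable_on dual_net m p (q(Suc l := g)) (?u v)"
        using b \<sigma> by (intro summable_on_dual_weight) (auto simp: dual_net_iff)
      then have "?I (2 * \<alpha>) g v powr r \<le> ?I (2 * \<alpha> * r) g v"
        using powr_infsum_le[of "dual_net m p (q(Suc l := g)) (?u v)" "dual_weight ?b (2 * \<alpha>) (?u v)" r] r0 r(2)
        by (simp add: dual_weight_powr)
      then show "(\<gamma> (?u v) * ?I (2 * \<alpha>) g v) powr r \<le> \<gamma> (?u v) powr r * ?I (2 * \<alpha> * r) g v"
        using \<gamma>[OF v] I[of v] by (simp add: powr_mult mult_left_mono)
    qed
    finally show ?thesis .
  qed
  have T0: "0 \<le> T g" for g
    unfolding T_def using \<gamma> by (intro sum_nonneg mult_nonneg_nonneg infsum_nonneg) auto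
  have "real ?b ^ m - 1 = real (card ?H)"
    using b by (simp add: card_G of_nat_diff)
  then have "(real ?b ^ m - 1) * T (q (Suc l)) powr r = (\<Sum>g\<in>?H. T (q (Suc l)) powr r)"
    by simp
  also have "\<dots> \<le> (\<Sum>g\<in>?H. T g powr r)"
    using min T0 r0 by (intro sum_mono powr_mono2) auto
  also have "\<dots> \<le> (\<Sum>g\<in>?H. \<Sum>v\<in>Pow {1..l}. \<gamma> (?u v) powr r * ?I (2 * \<alpha> * r) g v)"
    by (intro sum_mono Tpowr)
  also have "\<dots> = (\<Sum>v\<in>Pow {1..l}. \<Sum>g\<in>?H. \<gamma> (?u v) powr r * ?I (2 * \<alpha> * r) g v)"
    by (rule sum.swap)
  also have "\<dots> \<le> (\<Sum>v\<in>Pow {1..l}. \<gamma> (?u v) powr r * ?Z ^ card (?u v))"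
    unfolding sum_distrib_left[symmetric]
    using finite_subset[of _ "{1..l}"]
    by (intro sum_mono mult_left_mono sum_dual_net_le[OF p \<sigma>]) auto
  finally have "T (q (Suc l)) powr r \<le> (\<Sum>v\<in>Pow {1..l}. \<gamma> (?u v) powr r * ?Z ^ card (?u v)) / (real ?b ^ m - 1)"
    using bm by (simp add: le_divide_eq mult.commute)
  moreover have "criterion \<alpha> \<gamma> m p (Suc l) q powr r \<le> criterion \<alpha> \<gamma> m p l q powr r + T (q (Suc l)) powr r"
  proof -
    have "0 \<le> criterion \<alpha> \<gamma> m p l q"
      unfolding criterion_eq
      by (intro sum_nonneg mult_nonneg_nonneg infsum_nonneg nonneg) (auto dest: nonempty_subsetsD)
    then show ?thesis
      using crit[of "q (Suc l)"] T0 r0 r(2) powr_add_le by (simp add: fun_upd_idem)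
  qed
  ultimately show ?case
    using Suc by (simp add: sum_nonempty_subsets_Suc add_divide_distrib)
qed

lemma criterion_ge_term:
  fixes p :: "'a::prime_card mod_ring poly"
  assumes \<alpha>: "1 / 2 < \<alpha>" and nonneg: "\<And>u. u \<in> weight_index \<Longrightarrow> 0 \<le> \<gamma> u"
    and v: "v \<in> nonempty_subsets s" and k: "k \<in> dual_net m p q v"
  shows "\<gamma> v * dual_weight CARD('a) (2 * \<alpha>) v k \<le> criterion \<alpha> \<gamma> m p s q"
proof -
  have b: "1 < CARD('a)" using two_le_card[where 'a='a] by simp
  let ?I = "\<lambda>u. infsum (dual_weight CARD('a) (2 * \<alpha>) u) (dual_net m p q u)"
  have "dual_weight CARD('a) (2 * \<alpha>) v summable_on dual_net m p q v"
    using b \<alpha> nonempty_subsetsD(1)[OF v] by (intro summable_on_dual_weight) (auto simp: dual_net_iff)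
  from finite_sum_le_infsum[OF this, of "{k}"] have "dual_weight CARD('a) (2 * \<alpha>) v k \<le> ?I v"
    using k by simp
  then have "\<gamma> v * dual_weight CARD('a) (2 * \<alpha>) v k \<le> \<gamma> v * ?I v"
    using nonneg nonempty_subsetsD[OF v] by (intro mult_left_mono) auto
  also have "\<dots> \<le> (\<Sum>u\<in>nonempty_subsets s. \<gamma> u * ?I u)"
    using v nonneg nonempty_subsetsD(3)
    by (intro member_le_sum[of v _ "\<lambda>u. \<gamma> u * ?I u"]) (auto intro!: mult_nonneg_nonneg infsum_nonneg)
  finally show ?thesis by (simp add: criterion_eq)
qed

section \<open>From the criterion to the weighted star discrepancy\<close>

lemma criterion_ge_mu_poly:
  fixes p :: "'a::prime_card mod_ring poly"
  assumes \<alpha>: "1 / 2 < \<alpha>" and nonneg: "\<And>u. u \<in> weight_index \<Longrightarrow> 0 \<le> \<gamma> u"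
    and mono: "\<And>u v. u \<in> weight_index \<Longrightarrow> v \<in> weight_index \<Longrightarrow> v \<subseteq> u \<Longrightarrow> \<gamma> u \<le> \<gamma> v"
    and u: "u \<in> nonempty_subsets s"
    and K: "K \<in> dual_polys m p q u" "K \<noteq> (\<lambda>j\<in>u. 0)"
  shows "\<gamma> u * real CARD('a) powr (- 2 * \<alpha> * real (\<Sum>j\<in>u. mu_poly (K j))) \<le> criterion \<alpha> \<gamma> m p s q"
proof -
  let ?b = "CARD('a)"
  have b: "1 < ?b" using two_le_card[where 'a='a] by simp
  have KG: "K \<in> PiE u (\<lambda>_. G m)" and Kp: "p dvd (\<Sum>j\<in>u. K j * q j)"
    using K(1) by (simp_all add: dual_polys_def)
  \<comment> \<open>Entries of \<open>dual_net\<close> must be positive, so the criterion sees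
    \<open>K\<close> only on its support, as a term with weight \<gamma> v.\<close>
  define v where "v = {j \<in> u. K j \<noteq> 0}"
  have fin: "finite u" using u by (rule nonempty_subsetsD)
  have "v \<noteq> {}"
  proof
    assume "v = {}"
    then have "K = (\<lambda>j\<in>u. 0)" using KG by (intro PiE_ext[of K u "\<lambda>_. G m" "\<lambda>j\<in>u. 0"]) (auto simp: v_def)
    then show False using K(2) by simp
  qed
  then have v: "v \<in> nonempty_subsets s" "v \<subseteq> u"
    using u nonempty_subsets_mono[of v u s] by (auto simp: v_def)
  have "\<forall>j\<in>u. \<exists>k. tr m k = K j \<and> floorlog ?b k = mu_poly (K j)"
    using KG exists_tr_eq by (metis PiE_mem)
  then obtain k where k: "\<forall>j\<in>u. tr m (k j) = K j \<and> floorlog ?b (k j) = mu_poly (K j)"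
    by (auto dest: bchoice)
  have kpos: "0 < k j" if "j \<in> v" for j
  proof (rule ccontr)
    assume "\<not> 0 < k j"
    then have "mu_poly (K j) = 0" using k that by (auto simp: v_def floorlog_def)
    then show False using that by (simp add: v_def mu_poly_def)
  qed
  have "(\<Sum>j\<in>v. tr m (k j) * q j) = (\<Sum>j\<in>v. K j * q j)"
    using k by (intro sum.cong) (auto simp: v_def)
  also have "\<dots> = (\<Sum>j\<in>u. K j * q j)"
    using fin by (intro sum.mono_neutral_left) (auto simp: v_def)
  finally have kv: "(\<lambda>j\<in>v. k j) \<in> dual_net m p q v"
    using kpos Kp by (auto simp: dual_net_iff Suc_le_eq)
  have "(\<Sum>j\<in>v. mu ?b ((\<lambda>j\<in>v. k j) j)) = (\<Sum>j\<in>v. mu_poly (K j))"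
    using k kpos b by (intro sum.cong) (auto simp: v_def mu_eq_floorlog)
  also have "\<dots> = (\<Sum>j\<in>u. mu_poly (K j))"
    using fin by (intro sum.mono_neutral_left) (auto simp: v_def)
  finally have "\<gamma> v * real ?b powr (- 2 * \<alpha> * real (\<Sum>j\<in>u. mu_poly (K j))) \<le> criterion \<alpha> \<gamma> m p s q"
    using criterion_ge_term[OF \<alpha> nonneg v(1) kv] by (simp add: dual_weight_def)
  moreover have "\<gamma> u \<le> \<gamma> v"
    using u v by (intro mono nonempty_subsetsD)
  then have "\<gamma> u * real ?b powr (- 2 * \<alpha> * real (\<Sum>j\<in>u. mu_poly (K j))) \<le>
      \<gamma> v * real ?b powr (- 2 * \<alpha> * real (\<Sum>j\<in>u. mu_poly (K j)))"
    by (rule mult_right_mono) simp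
  ultimately show ?thesis by linarith
qed

text \<open>The vector with all entries b^m truncates to zero and hence lies in every dual
  net.\<close>

lemma criterion_pos:
  fixes p :: "'a::prime_card mod_ring poly"
  assumes \<alpha>: "1 / 2 < \<alpha>" and nonneg: "\<And>u. u \<in> weight_index \<Longrightarrow> 0 \<le> \<gamma> u"
    and u: "u \<in> nonempty_subsets s" "0 < \<gamma> u"
  shows "0 < criterion \<alpha> \<gamma> m p s q"
proof -
  have "tr m (CARD('a) ^ m) = (0 :: 'a mod_ring poly)" by (simp add: tr_eq_0_iff)
  then have "(\<lambda>j\<in>u. CARD('a) ^ m) \<in> dual_net m p q u"
    using two_le_card[where 'a='a] by (auto simp: dual_net_iff Suc_le_eq)
  from criterion_ge_term[OF \<alpha> nonneg u(1) this]
  have "\<gamma> u * dual_weight CARD('a) (2 * \<alpha>) u (\<lambda>j\<in>u. CARD('a) ^ m) \<le> criterion \<alpha> \<gamma> m p s q" .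
  moreover have "0 < \<gamma> u * dual_weight CARD('a) (2 * \<alpha>) u (\<lambda>j\<in>u. CARD('a) ^ m)"
    using u(2) two_le_card[where 'a='a] by (auto simp: dual_weight_def)
  ultimately show ?thesis by linarith
qed

lemma abs_local_disc_le_criterion:
  fixes p :: "'a::prime_card mod_ring poly"
  assumes p: "degree p = m" "p \<noteq> 0"
    and \<alpha>: "1 / 2 < \<alpha>" and nonneg: "\<And>u. u \<in> weight_index \<Longrightarrow> 0 \<le> \<gamma> u"
    and mono: "\<And>u v. u \<in> weight_index \<Longrightarrow> v \<in> weight_index \<Longrightarrow> v \<subseteq> u \<Longrightarrow> \<gamma> u \<le> \<gamma> v"
    and u: "u \<in> nonempty_subsets s" "0 < \<gamma> u"
    and y: "\<And>j. j \<in> u \<Longrightarrow> 0 \<le> y j \<and> y j < 1"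
  shows "\<bar>local_disc (G m) (lattice_point m p q) u y\<bar> \<le> card u / real CARD('a) ^ m +
    CARD('a) * (k_const CARD('a) * (real m + 1)) ^ card u * (criterion \<alpha> \<gamma> m p s q / \<gamma> u) powr (1 / (2 * \<alpha>))"
proof -
  let ?b = "real CARD('a)"
  let ?k = "(k_const CARD('a) * (real m + 1)) ^ card u"
  define R where "R = (criterion \<alpha> \<gamma> m p s q / \<gamma> u) powr (1 / (2 * \<alpha>))"
  have b: "2 \<le> ?b" using two_le_card[where 'a='a] by simp
  have fin: "finite u" using u(1) by (rule nonempty_subsetsD)
  have P: "0 < criterion \<alpha> \<gamma> m p s q" by (rule criterion_pos[where \<gamma> = \<gamma>, OF \<alpha> nonneg u])
  then have R: "0 < R" using u(2) by (simp add: R_def)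
  have "1 * 1 \<le> k_const CARD('a) * (real m + 1)"
    using k_const_ge_1[where 'a='a] by (intro mult_mono) auto
  then have k: "1 \<le> ?k" by (intro one_le_power) simp
  have "\<bar>local_disc (G m) (lattice_point m p q) u y\<bar> \<le> card u / ?b ^ m + ?b * ?k * R"
  proof (cases "1 \<le> R")
    case True
    \<comment> \<open>For R >= 1 the right-hand side is at least 1, so the trivial bound on the
      local discrepancy suffices.\<close>
    have "1 * 1 * 1 \<le> ?b * ?k * R" using b k True by (intro mult_mono) auto
    moreover have "0 \<le> card u / ?b ^ m" by simp
    moreover have "\<bar>local_disc (G m) (lattice_point m p q) u y\<bar> \<le> 1"
      by (rule abs_local_disc_le_1[OF fin y])
    ultimately show ?thesis by linarith
  next
    case False
    have "\<exists>n. (1 / ?b) ^ n < R"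
      using b R by (intro real_arch_pow_inv) auto
    then have ex: "\<exists>n. (1 / ?b) ^ Suc n \<le> R"
    proof
      fix n assume "(1 / ?b) ^ n < R"
      moreover have "(1 / ?b) ^ Suc n \<le> (1 / ?b) ^ n" using b by (intro power_decreasing) auto
      ultimately show ?thesis by (intro exI[of _ n]) linarith
    qed
    \<comment> \<open>Minimality gives b^-(A+1) <= R < b^-A. The right half forces every nonzero
      dual vector to have weight above \<open>A\<close>; the left half reads b^-A <= b R and
      produces the factor \<open>b\<close>.\<close>
    define A where "A = (LEAST n. (1 / ?b) ^ Suc n \<le> R)"
    have A1: "(1 / ?b) ^ Suc A \<le> R" unfolding A_def by (rule LeastI_ex[OF ex])
    have A2: "R < (1 / ?b) ^ A"
    proof (cases A)
      case (Suc n)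
      then have "\<not> (1 / ?b) ^ Suc n \<le> R" unfolding A_def by (intro not_less_Least) simp
      then show ?thesis by (simp add: Suc)
    qed (use False in simp)
    have mu: "A < (\<Sum>j\<in>u. mu_poly (K j))"
      if K: "K \<in> dual_polys m p q u" "K \<noteq> (\<lambda>j\<in>u. 0)" for K
    proof -
      let ?n = "\<Sum>j\<in>u. mu_poly (K j)"
      have "?b powr (- 2 * \<alpha> * real ?n) \<le> criterion \<alpha> \<gamma> m p s q / \<gamma> u"
        using criterion_ge_mu_poly[OF \<alpha> nonneg mono u(1) K] u(2) by (simp add: field_simps)
      then have "(?b powr (- 2 * \<alpha> * real ?n)) powr (1 / (2 * \<alpha>)) \<le> R"
        unfolding R_def using \<alpha> by (intro powr_mono2) auto
      then have "?b powr (- real ?n) \<le> R" using \<alpha> by (simp add: powr_powr)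
      moreover have "?b powr (- real n) = (1 / ?b) ^ n" for n
        using b by (simp add: powr_minus powr_realpow power_one_over divide_inverse power_inverse)
      ultimately have "(1 / ?b) ^ ?n \<le> R" by (simp only:)
      then have "(1 / ?b) ^ ?n < (1 / ?b) ^ A" using A2 by linarith
      then show ?thesis using b by (simp add: power_strict_decreasing_iff)
    qed
    have "\<bar>local_disc (G m) (lattice_point m p q) u y\<bar> \<le> card u / ?b ^ m + ?k / ?b ^ A"
      by (rule abs_local_disc_le[OF fin p mu y])
    moreover have "1 / ?b ^ A \<le> ?b * R"
      using A1 b by (simp add: power_one_over field_simps)
    then have "?k * (1 / ?b ^ A) \<le> ?k * (?b * R)" using k by (intro mult_left_mono) auto
    ultimately show ?thesis by (simp add: mult_ac)
  qed
  then show ?thesis by (simp add: R_def)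
qed

lemma singleton_in_nonempty_subsets: "1 \<le> s \<Longrightarrow> {1} \<in> nonempty_subsets s"
  by (simp add: nonempty_subsets_def)

text \<open>A maximum of nonnegative terms is at most their sum. Bounds are demanded only for sets
  of nonzero weight, since the estimate by the criterion is available only where \<gamma> is
  positive.\<close>

lemma weighted_star_disc_le_sum:
  assumes s: "1 \<le> s"
    and nonneg: "\<And>u. u \<in> nonempty_subsets s \<Longrightarrow> 0 \<le> w u"
    and B: "\<And>u. u \<in> nonempty_subsets s \<Longrightarrow> 0 \<le> B u"
    and bound: "\<And>u y. u \<in> nonempty_subsets s \<Longrightarrow> w u \<noteq> 0 \<Longrightarrow> y \<in> PiE u (\<lambda>_. {0..<1}) \<Longrightarrow>
      \<bar>local_disc I x u y\<bar> \<le> B u"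
  shows "weighted_star_disc w s I x \<le> (\<Sum>u\<in>nonempty_subsets s. w u * B u)"
  unfolding weighted_star_disc_def
proof (rule Max.boundedI)
  fix d assume "d \<in> (\<lambda>u. w u * (SUP y\<in>PiE u (\<lambda>_. {0..<1}). \<bar>local_disc I x u y\<bar>)) ` nonempty_subsets s"
  then obtain u where u: "u \<in> nonempty_subsets s"
    and d: "d = w u * (SUP y\<in>PiE u (\<lambda>_. {0..<1}). \<bar>local_disc I x u y\<bar>)" by blast
  have "d \<le> w u * B u"
  proof (cases "w u = 0")
    case False
    have "(SUP y\<in>PiE u (\<lambda>_. {0..<1::real}). \<bar>local_disc I x u y\<bar>) \<le> B u"
      using bound[OF u False] by (intro cSUP_least) (auto simp: PiE_eq_empty_iff)
    then show ?thesis unfolding d using nonneg[OF u] by (intro mult_left_mono)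
  qed (simp add: d)
  also have "\<dots> \<le> (\<Sum>u\<in>nonempty_subsets s. w u * B u)"
    using nonneg B u by (intro member_le_sum[of u _ "\<lambda>u. w u * B u"]) auto
  finally show "d \<le> (\<Sum>u\<in>nonempty_subsets s. w u * B u)" .
qed (use singleton_in_nonempty_subsets[OF s] in auto)

text \<open>The local discrepancy is at most 1, hence at most |u|; this yields a bound that involves
  neither \<open>m\<close> nor the criterion.\<close>

lemma lattice_star_disc_le_sum_weights:
  fixes p :: "'a::prime_card mod_ring poly"
  assumes "1 \<le> s" and nonneg': "\<And>u. u \<in> weight_index \<Longrightarrow> 0 \<le> \<gamma>' u"
  shows "lattice_star_disc \<gamma>' s m p q \<le> (\<Sum>u\<in>nonempty_subsets s. \<gamma>' u * real (card u))"
  unfolding lattice_star_disc_def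
proof (rule weighted_star_disc_le_sum)
  fix u y assume u: "u \<in> nonempty_subsets s" and y: "y \<in> PiE u (\<lambda>_. {0..<1::real})"
  have "\<bar>local_disc (G m) (lattice_point m p q) u y\<bar> \<le> 1"
    using u y by (intro abs_local_disc_le_1) (auto dest: nonempty_subsetsD)
  moreover have "0 < card u" using nonempty_subsetsD[OF u] by (simp add: card_gt_0_iff)
  ultimately show "\<bar>local_disc (G m) (lattice_point m p q) u y\<bar> \<le> real (card u)" by linarith
qed (use assms in \<open>auto dest: nonempty_subsetsD\<close>)

text \<open>Where \<gamma> u = 0, the assumption \<open>zero\<close> gives \<gamma>' u = 0, so the
  real quotient, which is 0 there, agrees with the convention 0/0 = 0.\<close>

lemma lattice_star_disc_le_criterion:
  fixes p :: "'a::prime_card mod_ring poly"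
  assumes p: "degree p = m" "p \<noteq> 0" and s: "1 \<le> s"
    and \<alpha>: "1 / 2 < \<alpha>" and nonneg: "\<And>u. u \<in> weight_index \<Longrightarrow> 0 \<le> \<gamma> u"
    and nonneg': "\<And>u. u \<in> weight_index \<Longrightarrow> 0 \<le> \<gamma>' u"
    and mono: "\<And>u v. u \<in> weight_index \<Longrightarrow> v \<in> weight_index \<Longrightarrow> v \<subseteq> u \<Longrightarrow> \<gamma> u \<le> \<gamma> v"
    and zero: "\<And>u. u \<in> nonempty_subsets s \<Longrightarrow> \<gamma> u = 0 \<Longrightarrow> \<gamma>' u = 0"
  shows "lattice_star_disc \<gamma>' s m p q \<le>
    (\<Sum>u\<in>nonempty_subsets s. \<gamma>' u * real (card u)) / real CARD('a) ^ m +
    CARD('a) * criterion \<alpha> \<gamma> m p s q powr (1 / (2 * \<alpha>)) *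
      (\<Sum>u\<in>nonempty_subsets s. \<gamma>' u / \<gamma> u powr (1 / (2 * \<alpha>)) * (k_const CARD('a) * (real m + 1)) ^ card u)"
proof -
  let ?P = "criterion \<alpha> \<gamma> m p s q"
  let ?k = "k_const CARD('a) * (real m + 1)"
  let ?B = "\<lambda>u. card u / real CARD('a) ^ m + CARD('a) * ?k ^ card u * (?P / \<gamma> u) powr (1 / (2 * \<alpha>))"
  have k: "0 \<le> ?k" using k_const_ge_1[where 'a='a] by simp
  have "lattice_star_disc \<gamma>' s m p q \<le> (\<Sum>u\<in>nonempty_subsets s. \<gamma>' u * ?B u)"
    unfolding lattice_star_disc_def
  proof (rule weighted_star_disc_le_sum[OF s])
    fix u y assume u: "u \<in> nonempty_subsets s" and "\<gamma>' u \<noteq> 0" and y: "y \<in> PiE u (\<lambda>_. {0..<1::real})"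
    then have "0 < \<gamma> u" using zero nonneg nonempty_subsetsD(3) by (metis order_less_le)
    then show "\<bar>local_disc (G m) (lattice_point m p q) u y\<bar> \<le> ?B u"
      using y by (intro abs_local_disc_le_criterion[OF p \<alpha> nonneg mono u]) auto
  qed (use k nonneg' in \<open>auto dest: nonempty_subsetsD\<close>)
  also have "\<dots> = (\<Sum>u\<in>nonempty_subsets s. \<gamma>' u * real (card u)) / real CARD('a) ^ m +
      CARD('a) * ?P powr (1 / (2 * \<alpha>)) * (\<Sum>u\<in>nonempty_subsets s. \<gamma>' u / \<gamma> u powr (1 / (2 * \<alpha>)) * ?k ^ card u)"
    unfolding sum_divide_distrib sum_distrib_left sum.distrib[symmetric]
  proof (rule sum.cong[OF refl])
    fix u assume u: "u \<in> nonempty_subsets s"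
    have "(?P / \<gamma> u) powr (1 / (2 * \<alpha>)) = ?P powr (1 / (2 * \<alpha>)) / \<gamma> u powr (1 / (2 * \<alpha>))"
      by (rule powr_divide)
    then show "\<gamma>' u * ?B u = \<gamma>' u * real (card u) / real CARD('a) ^ m +
        CARD('a) * ?P powr (1 / (2 * \<alpha>)) * (\<gamma>' u / \<gamma> u powr (1 / (2 * \<alpha>)) * ?k ^ card u)"
      by (simp add: algebra_simps)
  qed
  finally show ?thesis .
qed

lemma lattice_star_disc_cbc_le:
  fixes p :: "'a::prime_card mod_ring poly"
  assumes p: "irreducible p" "degree p = m" and s: "1 \<le> s" and m: "1 \<le> m"
    and cbc: "cbc_vector \<alpha> \<gamma> m p s q"
    and \<alpha>: "1 / 2 < \<alpha>" and r: "1 / (2 * \<alpha>) < r" "r \<le> 1"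
    and nonneg: "\<And>u. u \<in> weight_index \<Longrightarrow> 0 \<le> \<gamma> u"
    and nonneg': "\<And>u. u \<in> weight_index \<Longrightarrow> 0 \<le> \<gamma>' u"
    and mono: "\<And>u v. u \<in> weight_index \<Longrightarrow> v \<in> weight_index \<Longrightarrow> v \<subseteq> u \<Longrightarrow> \<gamma> u \<le> \<gamma> v"
    and zero: "\<And>u. u \<in> nonempty_subsets s \<Longrightarrow> \<gamma> u = 0 \<Longrightarrow> \<gamma>' u = 0"
    and C1: "(\<Sum>u\<in>nonempty_subsets s. \<gamma> u powr r * mu_series CARD('a) (2 * \<alpha> * r) ^ card u) \<le> C1 * real s powr e"
    and C2: "(\<Sum>u\<in>nonempty_subsets s. \<gamma>' u * real (card u)) \<le> C2 * real s powr e'"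
    and C3: "(\<Sum>u\<in>nonempty_subsets s. \<gamma>' u / \<gamma> u powr (1 / (2 * \<alpha>)) * (k_const CARD('a) * (real m + 1)) ^ card u)
      \<le> C3 * (real s powr e'' * real CARD('a) powr (real m * \<delta>))"
    and C: "0 \<le> C1" "0 \<le> C2" "0 \<le> C3" and \<delta>: "0 < \<delta>"
  shows "lattice_star_disc \<gamma>' s m p q \<le>
    (C2 + CARD('a) * (2 * C1) powr (1 / (2 * \<alpha> * r)) * C3) * real s powr max e' (e / (2 * \<alpha> * r) + e'')
      * real CARD('a) powr (- real m * (1 / (2 * \<alpha> * r) - \<delta>))"
proof -
  let ?b = "real CARD('a)" and ?P = "criterion \<alpha> \<gamma> m p s q"
  let ?T = "(\<Sum>u\<in>nonempty_subsets s. \<gamma>' u / \<gamma> u powr (1 / (2 * \<alpha>)) * (k_const CARD('a) * (real m + 1)) ^ card u)"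
  \<comment> \<open>The exponent that turns a bound on P^r into one on P^(1/(2\<alpha>)), and thus
    the rate of decay in b^m; it is below 1 because 2\<alpha>r > 1.\<close>
  define t where "t = 1 / (2 * \<alpha> * r)"
  define E where "E = max e' (e * t + e'')"
  let ?W = "real s powr E * ?b powr (- real m * (t - \<delta>))"
  have b: "2 \<le> ?b" using two_le_card[where 'a='a] by simp
  have r0: "0 < r" using \<alpha> r(1) by (smt (verit) divide_pos_pos)
  have t: "0 < t" "t < 1" using \<alpha> r r0 by (simp_all add: t_def field_simps)
  have bm: "2 \<le> ?b ^ m"
  proof -
    have "?b ^ 1 \<le> ?b ^ m" using b m by (intro power_increasing) auto
    then show ?thesis using b unfolding power_one_right by linarith
  qed
  have "?P powr r \<le> C1 * real s powr e / (?b ^ m - 1)"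
  proof (rule order.trans[OF criterion_cbc_le[OF p \<alpha> r nonneg cbc order.refl]])
    show "(\<Sum>u\<in>nonempty_subsets s. \<gamma> u powr r * mu_series CARD('a) (2 * \<alpha> * r) ^ card u) / (?b ^ m - 1)
        \<le> C1 * real s powr e / (?b ^ m - 1)"
      using C1 bm by (intro divide_right_mono) auto
  qed
  \<comment> \<open>b^m >= 2 gives b^m - 1 >= b^m / 2, whence the factor 2 next to
    \<open>C1\<close>.\<close>
  also have "\<dots> \<le> C1 * real s powr e / (?b ^ m / 2)"
    using C bm by (intro divide_left_mono) auto
  finally have "(?P powr r) powr t \<le> ((2 * C1) * (real s powr e * ?b powr (- real m))) powr t"
    using t b by (intro powr_mono2) (auto simp: powr_minus powr_realpow field_simps)
  then have "?P powr (1 / (2 * \<alpha>)) \<le> (2 * C1) powr t * (real s powr (e * t) * ?b powr (- real m * t))"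
    using r0 \<alpha> C by (simp add: powr_powr powr_mult t_def)
  then have "?P powr (1 / (2 * \<alpha>)) * ?T \<le>
      (2 * C1) powr t * (real s powr (e * t) * ?b powr (- real m * t)) * (C3 * (real s powr e'' * ?b powr (real m * \<delta>)))"
    using C3 nonneg' k_const_ge_1[where 'a='a]
    by (intro mult_mono) (auto intro!: sum_nonneg mult_nonneg_nonneg divide_nonneg_nonneg dest: nonempty_subsetsD)
  also have "\<dots> = (2 * C1) powr t * C3 * (real s powr (e * t + e'') * ?b powr (- real m * (t - \<delta>)))"
    by (simp add: powr_add[symmetric] mult_ac algebra_simps)
  also have "\<dots> \<le> (2 * C1) powr t * C3 * ?W"
    using s C by (intro mult_left_mono mult_right_mono powr_mono) (auto simp: E_def)
  finally have "?b * (?P powr (1 / (2 * \<alpha>)) * ?T)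
      \<le> ?b * ((2 * C1) powr t * C3 * ?W)"
    using b by (intro mult_left_mono) auto
  moreover have "(\<Sum>u\<in>nonempty_subsets s. \<gamma>' u * real (card u)) / ?b ^ m \<le> C2 * ?W"
  proof -
    have "(\<Sum>u\<in>nonempty_subsets s. \<gamma>' u * real (card u)) / ?b ^ m \<le> C2 * real s powr e' / ?b ^ m"
      using C2 b by (intro divide_right_mono) auto
    also have "\<dots> = C2 * (real s powr e' * ?b powr (- real m))"
      using b by (simp add: powr_minus powr_realpow field_simps)
    \<comment> \<open>The discretisation error decays like b^-m, at least as fast as the main term,
      because t - \<delta> < 1.\<close>
    also have "\<dots> \<le> C2 * ?W"
      using s b C t \<delta> mult_left_mono[of "t - \<delta>" 1 "real m"] by (intro mult_left_mono mult_mono powr_mono) (auto simp: E_def)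
    finally show ?thesis .
  qed
  moreover have "p \<noteq> 0" using p(1) by auto
  then have "lattice_star_disc \<gamma>' s m p q \<le>
      (\<Sum>u\<in>nonempty_subsets s. \<gamma>' u * real (card u)) / ?b ^ m + ?b * ?P powr (1 / (2 * \<alpha>)) * ?T"
    by (rule lattice_star_disc_le_criterion[OF p(2) _ s \<alpha> nonneg nonneg' mono zero])
  ultimately have "lattice_star_disc \<gamma>' s m p q \<le> C2 * ?W + ?b * ((2 * C1) powr t * C3 * ?W)"
    unfolding mult.assoc[of ?b "?P powr _"] by linarith
  also have "\<dots> = (C2 + ?b * (2 * C1) powr t * C3) * real s powr E * ?b powr (- real m * (t - \<delta>))"
    by (simp only: distrib_right mult.assoc)
  finally show ?thesis by (simp only: E_def t_def times_divide_eq_right mult_1_right)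
qed

section \<open>Suprema of extended real families\<close>

lemma SUP_ennreal_finite_bound:
  fixes f :: "nat \<Rightarrow> real"
  assumes "(SUP s\<in>{1::nat..}. ennreal (f s)) < \<infinity>"
  shows "\<exists>C\<ge>0. \<forall>s\<ge>1. f s \<le> C"
proof (intro exI conjI allI impI)
  let ?S = "SUP s\<in>{1::nat..}. ennreal (f s)"
  show "0 \<le> enn2real ?S" by simp
  fix s :: nat assume "1 \<le> s"
  then have "ennreal (f s) \<le> ?S" by (intro SUP_upper) simp
  also have "?S = ennreal (enn2real ?S)" using assms by (simp add: less_top)
  finally show "f s \<le> enn2real ?S" by simp
qed

lemma weight_ratio_finite:
  assumes "0 \<le> c" "weight_ratio \<alpha> c d < \<infinity>"
  shows "d = 0 \<Longrightarrow> c = 0" "weight_ratio \<alpha> c d = ennreal (c / d powr (1 / (2 * \<alpha>)))"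
proof -
  show *: "c = 0" if "d = 0"
    using weight_ratio_top[of c \<alpha>] assms that by (cases "c = 0") auto
  show "weight_ratio \<alpha> c d = ennreal (c / d powr (1 / (2 * \<alpha>)))"
  proof (cases "d = 0")
    case False
    then show ?thesis using assms by (simp add: weight_ratio_def divide_ennreal)
  qed (simp add: * weight_ratio_zero)
qed

text \<open>The factors \<open>a s m\<close> and \<kappa> m are positive, so a single infinite ratio
  would make the supremum infinite. Hence all ratios are finite: \<gamma>' vanishes wherever
  \<gamma> does, and the extended sums are real sums.\<close>

lemma SUP_weight_ratio_finite_bound:
  fixes a :: "nat \<Rightarrow> nat \<Rightarrow> real" and \<kappa> :: "nat \<Rightarrow> real"
  assumes fin: "(SUP s\<in>{1::nat..}. SUP m\<in>{1::nat..}. ennreal (a s m) *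
      (\<Sum>u\<in>nonempty_subsets s. weight_ratio \<alpha> (\<gamma>' u) (\<gamma> u) * ennreal (\<kappa> m ^ card u))) < \<infinity>"
    and a: "\<And>s m. 1 \<le> s \<Longrightarrow> 0 < a s m" and \<kappa>: "\<And>m. 0 < \<kappa> m"
    and nonneg': "\<And>u. u \<in> weight_index \<Longrightarrow> 0 \<le> \<gamma>' u"
  shows "\<forall>s\<ge>1. \<forall>u\<in>nonempty_subsets s. \<gamma> u = 0 \<longrightarrow> \<gamma>' u = 0"
    and "\<exists>C\<ge>0. \<forall>s\<ge>1. \<forall>m\<ge>1. a s m *
      (\<Sum>u\<in>nonempty_subsets s. \<gamma>' u / \<gamma> u powr (1 / (2 * \<alpha>)) * \<kappa> m ^ card u) \<le> C"
proof -
  let ?T = "\<lambda>s m. \<Sum>u\<in>nonempty_subsets s. weight_ratio \<alpha> (\<gamma>' u) (\<gamma> u) * ennreal (\<kappa> m ^ card u)"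
  let ?S = "SUP s\<in>{1::nat..}. SUP m\<in>{1::nat..}. ennreal (a s m) * ?T s m"
  have le: "ennreal (a s m) * ?T s m \<le> ?S" if "1 \<le> s" "1 \<le> m" for s m
    using that by (intro SUP_upper2[of s] SUP_upper) auto
  have ratio: "weight_ratio \<alpha> (\<gamma>' u) (\<gamma> u) < \<infinity>" if s: "1 \<le> s" and u: "u \<in> nonempty_subsets s" for s u
  proof (rule ccontr)
    assume "\<not> weight_ratio \<alpha> (\<gamma>' u) (\<gamma> u) < \<infinity>"
    then have "weight_ratio \<alpha> (\<gamma>' u) (\<gamma> u) = \<infinity>" by (simp add: not_less top_unique)
    then have "weight_ratio \<alpha> (\<gamma>' u) (\<gamma> u) * ennreal (\<kappa> 1 ^ card u) = \<infinity>"
      using \<kappa>[of 1] by (simp add: ennreal_top_mult ennreal_eq_0_iff not_le)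
    then have "\<infinity> \<le> ?T s 1"
      using u by (intro order.trans[OF _ member_le_sum[of u]]) auto
    then have "?T s 1 = \<infinity>" by (simp only: infinity_ennreal_def top_unique)
    then have "ennreal (a s 1) * ?T s 1 = ennreal (a s 1) * \<infinity>" by (simp only:)
    also have "\<dots> = \<infinity>"
      using a[OF s, of 1] by (simp add: ennreal_mult_top ennreal_eq_0_iff not_le)
    finally have "ennreal (a s 1) * ?T s 1 = \<infinity>" .
    then have "?S = \<infinity>" using le[OF s, of 1] by (simp only: infinity_ennreal_def top_unique order.refl)
    then show False using fin by (simp only: less_irrefl)
  qed
  show "\<forall>s\<ge>1. \<forall>u\<in>nonempty_subsets s. \<gamma> u = 0 \<longrightarrow> \<gamma>' u = 0"
  proof (intro allI ballI impI)
    fix s :: nat and u assume s: "1 \<le> s" and u: "u \<in> nonempty_subsets s" and "\<gamma> u = 0"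
    then show "\<gamma>' u = 0"
      using weight_ratio_finite(1)[OF nonneg'[OF nonempty_subsetsD(3)[OF u]] ratio[OF s u]] by simp
  qed
  have real: "ennreal (a s m) * ?T s m =
      ennreal (a s m * (\<Sum>u\<in>nonempty_subsets s. \<gamma>' u / \<gamma> u powr (1 / (2 * \<alpha>)) * \<kappa> m ^ card u))"
    if s: "1 \<le> s" for s m
  proof -
    have "?T s m = (\<Sum>u\<in>nonempty_subsets s. ennreal (\<gamma>' u / \<gamma> u powr (1 / (2 * \<alpha>)) * \<kappa> m ^ card u))"
    proof (rule sum.cong[OF refl])
      fix u assume u: "u \<in> nonempty_subsets s"
      have "0 \<le> \<gamma>' u" using nonneg' nonempty_subsetsD(3)[OF u] .
      then show "weight_ratio \<alpha> (\<gamma>' u) (\<gamma> u) * ennreal (\<kappa> m ^ card u) =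
          ennreal (\<gamma>' u / \<gamma> u powr (1 / (2 * \<alpha>)) * \<kappa> m ^ card u)"
        using \<kappa>[of m]
        by (simp only: weight_ratio_finite(2)[OF _ ratio[OF s u]]) (subst ennreal_mult, simp_all add: less_imp_le)
    qed
    also have "\<dots> = ennreal (\<Sum>u\<in>nonempty_subsets s. \<gamma>' u / \<gamma> u powr (1 / (2 * \<alpha>)) * \<kappa> m ^ card u)"
      using \<kappa>[of m] nonneg' by (intro sum_ennreal) (auto intro!: mult_nonneg_nonneg dest: nonempty_subsetsD simp: less_imp_le)
    finally show ?thesis using a[OF s] by (simp add: ennreal_mult' less_imp_le)
  qed
  show "\<exists>C\<ge>0. \<forall>s\<ge>1. \<forall>m\<ge>1. a s m *
      (\<Sum>u\<in>nonempty_subsets s. \<gamma>' u / \<gamma> u powr (1 / (2 * \<alpha>)) * \<kappa> m ^ card u) \<le> C"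
  proof (intro exI[of _ "enn2real ?S"] conjI allI impI)
    fix s m :: nat assume sm: "1 \<le> s" "1 \<le> m"
    have "ennreal (enn2real ?S) = ?S"
      using fin unfolding infinity_ennreal_def by (rule ennreal_enn2real)
    then show "a s m * (\<Sum>u\<in>nonempty_subsets s. \<gamma>' u / \<gamma> u powr (1 / (2 * \<alpha>)) * \<kappa> m ^ card u) \<le> enn2real ?S"
      using le[OF sm] unfolding real[OF sm(1)]
      by (simp only: ennreal_le_iff[OF enn2real_nonneg, symmetric])
  qed simp
qed

section \<open>Product weights\<close>

text \<open>Expanding the product gives one term per subset; the empty set is dropped.\<close>

lemma sum_nonempty_subsets_prod_le:
  fixes x :: "nat \<Rightarrow> real"
  assumes "\<And>j. 1 \<le> j \<Longrightarrow> 0 \<le> x j"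
  shows "(\<Sum>u\<in>nonempty_subsets s. \<Prod>j\<in>u. x j) \<le> (\<Prod>j\<in>{1..s}. 1 + x j)"
proof -
  have "(\<Sum>u\<in>nonempty_subsets s. \<Prod>j\<in>u. x j) \<le> (\<Sum>u\<in>Pow {1..s}. \<Prod>j\<in>u. x j)"
    using assms by (intro sum_mono2) (auto simp: nonempty_subsets_def intro!: prod_nonneg)
  also have "\<dots> = (\<Prod>j\<in>{1..s}. x j + 1)" by (subst prod_add) auto
  finally show ?thesis by (simp add: add.commute)
qed

lemma prod_le_exp_sum:
  fixes x :: "'i \<Rightarrow> real"
  assumes "finite A" "\<And>j. j \<in> A \<Longrightarrow> 0 \<le> x j"
  shows "(\<Prod>j\<in>A. 1 + x j) \<le> exp (\<Sum>j\<in>A. x j)"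
proof -
  have "(\<Prod>j\<in>A. 1 + x j) \<le> (\<Prod>j\<in>A. exp (x j))"
    using assms(2) by (intro prod_mono) (auto intro: add_nonneg_nonneg)
  then show ?thesis by (simp add: exp_sum[OF assms(1)])
qed

lemma sum_le_suminf_Suc:
  fixes x :: "nat \<Rightarrow> real"
  assumes "summable (\<lambda>j. x (Suc j))" "\<And>j. 1 \<le> j \<Longrightarrow> 0 \<le> x j"
  shows "(\<Sum>j\<in>{1..s}. x j) \<le> (\<Sum>j. x (Suc j))"
proof -
  have "(\<Sum>j\<in>{1..s}. x j) = (\<Sum>j<s. x (Suc j))" by (simp add: sum.atLeast1_atMost_eq)
  also have "\<dots> \<le> (\<Sum>j. x (Suc j))" using assms by (intro sum_le_suminf) auto
  finally show ?thesis .
qed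

lemma sum_nonempty_subsets_prod_le_exp:
  fixes x :: "nat \<Rightarrow> real"
  assumes "summable (\<lambda>j. x (Suc j))" "\<And>j. 1 \<le> j \<Longrightarrow> 0 \<le> x j"
  shows "(\<Sum>u\<in>nonempty_subsets s. \<Prod>j\<in>u. x j) \<le> exp (\<Sum>j. x (Suc j))"
proof -
  have "(\<Sum>u\<in>nonempty_subsets s. \<Prod>j\<in>u. x j) \<le> (\<Prod>j\<in>{1..s}. 1 + x j)"
    by (rule sum_nonempty_subsets_prod_le[OF assms(2)])
  also have "\<dots> \<le> exp (\<Sum>j\<in>{1..s}. x j)" using assms(2) by (intro prod_le_exp_sum) auto
  also have "\<dots> \<le> exp (\<Sum>j. x (Suc j))" using sum_le_suminf_Suc[OF assms] by simp
  finally show ?thesis .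
qed

lemma affine_power_le_exp:
  fixes A c :: real
  assumes "0 \<le> A" "0 < c"
  shows "\<exists>C\<ge>0. \<forall>m::nat. (1 + A * (real m + 1)) ^ J \<le> C * exp (c * real m)"
proof -
  \<comment> \<open>Makes the rate d J of the J-th power at most c; the added 1 covers J =
    0.\<close>
  define d where "d = c / (real J + 1)"
  have d: "0 < d" "d * real J \<le> c" using assms by (simp_all add: d_def field_simps)
  show ?thesis
  proof (intro exI[of _ "((1 + A) / d) ^ J * exp c"] conjI allI)
    show "0 \<le> ((1 + A) / d) ^ J * exp c" using assms d by simp
    fix m :: nat
    have "d * (real m + 1) \<le> exp (d * (real m + 1))"
      using exp_ge_add_one_self[of "d * (real m + 1)"] by linarith
    then have "real m + 1 \<le> exp (d * (real m + 1)) / d" using d by (simp add: field_simps)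
    then have "(1 + A) * (real m + 1) \<le> (1 + A) * (exp (d * (real m + 1)) / d)"
      using assms by (intro mult_left_mono) auto
    then have "1 + A * (real m + 1) \<le> (1 + A) / d * exp (d * (real m + 1))"
      by (simp add: algebra_simps)
    then have "(1 + A * (real m + 1)) ^ J \<le> ((1 + A) / d * exp (d * (real m + 1))) ^ J"
      using assms by (intro power_mono) auto
    also have "\<dots> = ((1 + A) / d) ^ J * exp (d * real J * (real m + 1))"
    proof -
      have "exp (d * (real m + 1)) ^ J = exp (d * real J * (real m + 1))"
        by (simp add: exp_of_nat_mult[symmetric] mult_ac)
      then show ?thesis by (simp only: power_mult_distrib)
    qed
    also have "\<dots> \<le> ((1 + A) / d) ^ J * exp (c * (real m + 1))"
      using d assms by (intro mult_left_mono) (auto intro: mult_right_mono)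
    also have "\<dots> = ((1 + A) / d) ^ J * exp c * exp (c * real m)"
      by (simp add: distrib_left exp_add mult_ac)
    finally show "(1 + A * (real m + 1)) ^ J \<le> ((1 + A) / d) ^ J * exp c * exp (c * real m)" .
  qed
qed

text \<open>
  Finitely many factors grow polynomially in \<open>m\<close>; the remaining ones contribute
  \<open>exp (k (m + 1) \<epsilon>)\<close>, where \<open>\<epsilon>\<close> is the tail of the series.
\<close>

lemma prod_affine_le_exp:
  fixes r :: "nat \<Rightarrow> real" and k c :: real
  assumes sum: "summable (\<lambda>j. r (Suc j))" and r: "\<And>j. 1 \<le> j \<Longrightarrow> 0 \<le> r j"
    and k: "0 < k" and c: "0 < c"
  shows "\<exists>C\<ge>0. \<forall>s m. (\<Prod>j\<in>{1..s}. 1 + k * (real m + 1) * r j) \<le> C * exp (c * real m)"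
proof -
  let ?S = "\<Sum>j. r (Suc j)"
  have rS: "0 \<le> r (Suc j)" for j using r by simp
  have S: "0 \<le> ?S" using sum rS by (intro suminf_nonneg)
  have "(\<lambda>n. \<Sum>j<n. r (Suc j)) \<longlonglongrightarrow> ?S" using sum by (rule summable_LIMSEQ)
  then have "\<forall>\<^sub>F n in sequentially. ?S - c / (2 * k) < (\<Sum>j<n. r (Suc j))"
    using k c by (intro order_tendstoD(1)) auto
  \<comment> \<open>The rate c is shared equally: the tail beyond \<open>J\<close>, at most c/(2k),
    yields exp(c (m + 1)/2), and the first \<open>J\<close> factors are allowed exp(c m/2).\<close>
  then obtain J where J: "?S - c / (2 * k) < (\<Sum>j<J. r (Suc j))"
    by (auto simp: eventually_sequentially)
  obtain C0 where C0: "0 \<le> C0" "\<forall>m::nat. (1 + k * ?S * (real m + 1)) ^ J \<le> C0 * exp (c / 2 * real m)"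
    using affine_power_le_exp[of "k * ?S" "c / 2" J] k S c by auto
  show ?thesis
  proof (intro exI[of _ "C0 * exp (c / 2)"] conjI allI)
    show "0 \<le> C0 * exp (c / 2)" using C0 by simp
    fix s m :: nat
    let ?K = "k * (real m + 1)"
    \<comment> \<open>Padding with further factors, all at least 1, makes the split at
      \<open>J\<close> possible also for s < J.\<close>
    let ?N = "max s J"
    have K: "0 \<le> ?K" using k by simp
    have f: "1 \<le> 1 + ?K * r (Suc j)" for j using K rS[of j] by simp
    have f0: "0 \<le> 1 + ?K * r (Suc j)" for j using f[of j] by linarith
    have "(\<Prod>j\<in>{1..s}. 1 + ?K * r j) = (\<Prod>j<s. 1 + ?K * r (Suc j))"
      by (simp add: prod.atLeast1_atMost_eq)
    also have "\<dots> \<le> (\<Prod>j<?N. 1 + ?K * r (Suc j))"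
      by (rule prod_mono2[OF _ _ f f0]) auto
    also have "\<dots> = (\<Prod>j<J. 1 + ?K * r (Suc j)) * (\<Prod>j\<in>{J..<?N}. 1 + ?K * r (Suc j))"
      by (simp add: lessThan_atLeast0 prod.atLeastLessThan_concat)
    also have "\<dots> \<le> (1 + k * ?S * (real m + 1)) ^ J * exp (c / 2 * (real m + 1))"
    proof (rule mult_mono)
      have "(\<Prod>j<J. 1 + ?K * r (Suc j)) \<le> (\<Prod>j<J. 1 + k * ?S * (real m + 1))"
      proof (rule prod_mono)
        fix j
        have "r (Suc j) \<le> ?S"
          using sum_le_suminf[OF sum, of "{j}"] rS by simp
        then have "?K * r (Suc j) \<le> ?K * ?S" using K by (rule mult_left_mono)
        then show "0 \<le> 1 + ?K * r (Suc j) \<and> 1 + ?K * r (Suc j) \<le> 1 + k * ?S * (real m + 1)"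
          using f[of j] by (simp add: mult_ac)
      qed
      then show "(\<Prod>j<J. 1 + ?K * r (Suc j)) \<le> (1 + k * ?S * (real m + 1)) ^ J" by simp
      have "(\<Sum>j<J. r (Suc j)) + (\<Sum>j\<in>{J..<?N}. r (Suc j)) = (\<Sum>j<?N. r (Suc j))"
        by (simp add: lessThan_atLeast0 sum.atLeastLessThan_concat)
      also have "\<dots> \<le> ?S" using sum rS by (intro sum_le_suminf) auto
      finally have tail: "(\<Sum>j\<in>{J..<?N}. r (Suc j)) \<le> c / (2 * k)" using J by linarith
      have "(\<Prod>j\<in>{J..<?N}. 1 + ?K * r (Suc j)) \<le> exp (\<Sum>j\<in>{J..<?N}. ?K * r (Suc j))"
        using K rS by (intro prod_le_exp_sum) auto
      also have "\<dots> \<le> exp (?K * (c / (2 * k)))"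
        using mult_left_mono[OF tail K] by (simp add: sum_distrib_left)
      also have "?K * (c / (2 * k)) = c / 2 * (real m + 1)" using k by (simp add: field_simps)
      finally show "(\<Prod>j\<in>{J..<?N}. 1 + ?K * r (Suc j)) \<le> exp (c / 2 * (real m + 1))" .
      show "0 \<le> (1 + k * ?S * (real m + 1)) ^ J" using k S by simp
      show "0 \<le> (\<Prod>j\<in>{J..<?N}. 1 + ?K * r (Suc j))" by (rule prod_nonneg) (rule f0)
    qed
    also have "\<dots> \<le> (C0 * exp (c / 2 * real m)) * exp (c / 2 * (real m + 1))"
      using C0 by (intro mult_right_mono) auto
    also have "\<dots> = C0 * exp (c / 2) * exp (c * real m)"
    proof -
      have "c / 2 * real m + c / 2 * (real m + 1) = c / 2 + c * real m" by (simp add: field_simps)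
      then have "exp (c / 2 * real m) * exp (c / 2 * (real m + 1)) = exp (c / 2) * exp (c * real m)"
        by (simp only: exp_add[symmetric])
      then show ?thesis by (simp only: mult.assoc)
    qed
    finally show "(\<Prod>j\<in>{1..s}. 1 + ?K * r j) \<le> C0 * exp (c / 2) * exp (c * real m)" .
  qed
qed

section \<open>Summability conditions on the weights\<close>

text \<open>The constants \<open>C1\<close>, \<open>C2\<close>, \<open>C3\<close> are fixed before
  \<open>s\<close>, \<open>m\<close>, \<open>p\<close> and \<open>q\<close>, so the resulting
  constant depends on none of these.\<close>

lemma lattice_star_disc_cbc_bound:
  fixes \<alpha> r \<delta> e e' e'' C1 C2 C3 :: real and \<gamma> \<gamma>' :: "nat set \<Rightarrow> real"
  assumes \<alpha>: "1 / 2 < \<alpha>" and r: "1 / (2 * \<alpha>) < r" "r \<le> 1" and \<delta>: "0 < \<delta>"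
    and nonneg: "\<And>u. u \<in> weight_index \<Longrightarrow> 0 \<le> \<gamma> u"
    and nonneg': "\<And>u. u \<in> weight_index \<Longrightarrow> 0 \<le> \<gamma>' u"
    and mono: "\<And>u v. u \<in> weight_index \<Longrightarrow> v \<in> weight_index \<Longrightarrow> v \<subseteq> u \<Longrightarrow> \<gamma> u \<le> \<gamma> v"
    and zero: "\<forall>s\<ge>1. \<forall>u\<in>nonempty_subsets s. \<gamma> u = 0 \<longrightarrow> \<gamma>' u = 0"
    and C: "0 \<le> C1" "0 \<le> C2" "0 \<le> C3"
    and C1: "\<forall>s\<ge>1. 1 / real s powr e *
      (\<Sum>u\<in>nonempty_subsets s. \<gamma> u powr r * mu_series CARD('a::prime_card) (2 * \<alpha> * r) ^ card u) \<le> C1"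
    and C2: "\<forall>s\<ge>1. 1 / real s powr e' * (\<Sum>u\<in>nonempty_subsets s. \<gamma>' u * real (card u)) \<le> C2"
    and C3: "\<forall>s\<ge>1. \<forall>m\<ge>1. 1 / (real s powr e'' * real CARD('a) powr (real m * \<delta>)) *
      (\<Sum>u\<in>nonempty_subsets s. \<gamma>' u / \<gamma> u powr (1 / (2 * \<alpha>)) * (k_const CARD('a) * (real m + 1)) ^ card u) \<le> C3"
  shows "\<exists>C>0. \<forall>s\<ge>1. \<forall>m\<ge>1. \<forall>(p :: 'a mod_ring poly) q.
    irreducible p \<and> degree p = m \<and> cbc_vector \<alpha> \<gamma> m p s q \<longrightarrow>
    lattice_star_disc \<gamma>' s m p q \<le> C * real s powr (max e' (e / (2 * \<alpha> * r) + e''))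
      * real CARD('a) powr (- real m * (1 / (2 * \<alpha> * r) - \<delta>))"
proof -
  define D where "D = C2 + CARD('a) * (2 * C1) powr (1 / (2 * \<alpha> * r)) * C3"
  have D: "0 \<le> D" unfolding D_def using C by simp
  \<comment> \<open>\<open>D\<close> may be 0 although a positive constant is required.\<close>
  show ?thesis
  proof (rule exI[of _ "D + 1"], intro conjI allI impI)
    show "0 < D + 1" using D by simp
    fix s m :: nat and p :: "'a mod_ring poly" and q
    assume s: "1 \<le> s" and m: "1 \<le> m"
      and "irreducible p \<and> degree p = m \<and> cbc_vector \<alpha> \<gamma> m p s q"
    then have p: "irreducible p" "degree p = m" and cbc: "cbc_vector \<alpha> \<gamma> m p s q" by auto
    have bound: "x \<le> c * w" if "1 / w * x \<le> c" "0 < w" for x c w :: real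
      using that by (simp add: field_simps)
    let ?W = "real s powr max e' (e / (2 * \<alpha> * r) + e'')"
    let ?B = "real CARD('a) powr (- real m * (1 / (2 * \<alpha> * r) - \<delta>))"
    have "lattice_star_disc \<gamma>' s m p q \<le> D * ?W * ?B"
      unfolding D_def
    proof (rule lattice_star_disc_cbc_le[OF p s m cbc \<alpha> r nonneg nonneg' mono _ _ _ _ C \<delta>])
      show "\<gamma>' u = 0" if "u \<in> nonempty_subsets s" "\<gamma> u = 0" for u using zero s that by blast
      show "(\<Sum>u\<in>nonempty_subsets s. \<gamma> u powr r * mu_series CARD('a) (2 * \<alpha> * r) ^ card u) \<le> C1 * real s powr e"
        using C1 s by (intro bound) auto
      show "(\<Sum>u\<in>nonempty_subsets s. \<gamma>' u * real (card u)) \<le> C2 * real s powr e'"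
        using C2 s by (intro bound) auto
      show "(\<Sum>u\<in>nonempty_subsets s. \<gamma>' u / \<gamma> u powr (1 / (2 * \<alpha>)) * (k_const CARD('a) * (real m + 1)) ^ card u)
          \<le> C3 * (real s powr e'' * real CARD('a) powr (real m * \<delta>))"
        using C3 s m by (intro bound) auto
    qed
    also have "\<dots> \<le> (D + 1) * ?W * ?B"
      by (intro mult_right_mono) auto
    finally show "lattice_star_disc \<gamma>' s m p q \<le> (D + 1) * ?W * ?B" .
  qed
qed

lemma product_weights_bounds:
  fixes g g' :: "nat \<Rightarrow> real" and \<alpha> r \<delta> :: real and \<gamma> \<gamma>' :: "nat set \<Rightarrow> real"
  assumes \<alpha>: "1 / 2 < \<alpha>" and r: "1 / (2 * \<alpha>) < r" "r \<le> 1" and \<delta>: "0 < \<delta>"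
    and g: "\<And>j. 1 \<le> j \<Longrightarrow> 0 \<le> g j \<and> 0 \<le> g' j"
    and \<gamma>: "\<And>u. u \<in> weight_index \<Longrightarrow> \<gamma> u = (\<Prod>j\<in>u. g j) \<and> \<gamma>' u = (\<Prod>j\<in>u. g' j)"
    and sum: "(\<Sum>j. ennreal (g (Suc j) powr r)) < \<infinity>"
    and sum_ratio: "(\<Sum>j. weight_ratio \<alpha> (g' (Suc j)) (g (Suc j))) < \<infinity>"
  shows "\<forall>s\<ge>1. \<forall>u\<in>nonempty_subsets s. \<gamma> u = 0 \<longrightarrow> \<gamma>' u = 0"
    and "\<exists>C\<ge>0. \<forall>s\<ge>1. (\<Sum>u\<in>nonempty_subsets s. \<gamma> u powr r * mu_series CARD('a::prime_card) (2 * \<alpha> * r) ^ card u) \<le> C"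
    and "\<exists>C\<ge>0. \<forall>s\<ge>1. (\<Sum>u\<in>nonempty_subsets s. \<gamma>' u * real (card u)) \<le> C"
    and "\<exists>C\<ge>0. \<forall>s\<ge>1. \<forall>m\<ge>1. (\<Sum>u\<in>nonempty_subsets s.
      \<gamma>' u / \<gamma> u powr (1 / (2 * \<alpha>)) * (k_const CARD('a) * (real m + 1)) ^ card u)
      \<le> C * real CARD('a) powr (real m * \<delta>)"
proof -
  let ?b = "CARD('a)" and ?k = "k_const CARD('a)"
  let ?Z = "mu_series ?b (2 * \<alpha> * r)"
  define \<rho> where "\<rho> = (\<lambda>j. g' j / g j powr (1 / (2 * \<alpha>)))"
  have b: "1 < ?b" using two_le_card[where 'a='a] by simp
  have k: "1 \<le> ?k" by (rule k_const_ge_1)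
  have r0: "0 < r" using \<alpha> r(1) by (smt (verit) divide_pos_pos)
  have \<sigma>: "1 < 2 * \<alpha> * r" using \<alpha> r(1) by (simp add: field_simps)
  have Z: "0 \<le> ?Z" using mu_series_pos[OF b \<sigma>] by simp
  have ge1: "1 \<le> j" if "u \<in> nonempty_subsets s" "j \<in> u" for u s and j :: nat
    using that by (auto simp: nonempty_subsets_def)
  have prod: "\<gamma> u = (\<Prod>j\<in>u. g j)" "\<gamma>' u = (\<Prod>j\<in>u. g' j)" if "u \<in> nonempty_subsets s" for u s
    using \<gamma> nonempty_subsetsD(3)[OF that] by auto
  have fin: "weight_ratio \<alpha> (g' (Suc j)) (g (Suc j)) < \<infinity>" for j
    using sum_ratio by (rule ennreal_suminf_lessD)
  have zero: "g' j = 0" if "1 \<le> j" "g j = 0" for j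
    using weight_ratio_finite(1)[OF _ fin[of "j - 1"]] g that by simp
  have \<rho>: "0 \<le> \<rho> j" if "1 \<le> j" for j using g[OF that] by (simp add: \<rho>_def)
  have sum_\<rho>: "summable (\<lambda>j. \<rho> (Suc j))"
  proof (rule summable_suminf_not_top)
    have "weight_ratio \<alpha> (g' (Suc j)) (g (Suc j)) = ennreal (\<rho> (Suc j))" for j
      unfolding \<rho>_def using g by (intro weight_ratio_finite(2) fin) auto
    then show "(\<Sum>j. ennreal (\<rho> (Suc j))) \<noteq> top_class.top" using sum_ratio by auto
  qed (simp add: \<rho>)
  have sum_g: "summable (\<lambda>j. g (Suc j) powr r)"
    using sum by (intro summable_suminf_not_top) auto
  \<comment> \<open>Summability of the r-th powers bounds all \<open>g j\<close>, which allows the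
    summability of the ratios to be transferred to \<open>g'\<close>.\<close>
  define H where "H = (\<Sum>j. g (Suc j) powr r) powr (1 / r)"
  have gH: "g (Suc j) \<le> H" for j
  proof -
    have "g (Suc j) powr r \<le> (\<Sum>j. g (Suc j) powr r)"
      using sum_le_suminf[OF sum_g, of "{j}"] by simp
    then have "(g (Suc j) powr r) powr (1 / r) \<le> H"
      unfolding H_def using r0 by (intro powr_mono2) auto
    then show ?thesis using r0 g by (simp add: powr_powr)
  qed
  have sum_g': "summable (\<lambda>j. g' (Suc j))"
  proof (rule summable_comparison_test')
    show "summable (\<lambda>j. \<rho> (Suc j) * H powr (1 / (2 * \<alpha>)))"
      using sum_\<rho> by (rule summable_mult2)
    fix j
    \<comment> \<open>At g (Suc j) = 0 both sides vanish, because a finite ratio forces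
      \<open>g'\<close> to vanish there.\<close>
    have "g' (Suc j) = \<rho> (Suc j) * g (Suc j) powr (1 / (2 * \<alpha>))"
      using zero[of "Suc j"] by (auto simp: \<rho>_def)
    also have "\<dots> \<le> \<rho> (Suc j) * H powr (1 / (2 * \<alpha>))"
      using gH[of j] g \<rho> \<alpha> by (intro mult_left_mono powr_mono2) auto
    finally show "norm (g' (Suc j)) \<le> \<rho> (Suc j) * H powr (1 / (2 * \<alpha>))" using g by simp
  qed
  show "\<forall>s\<ge>1. \<forall>u\<in>nonempty_subsets s. \<gamma> u = 0 \<longrightarrow> \<gamma>' u = 0"
  proof (intro allI ballI impI)
    fix s u assume u: "u \<in> nonempty_subsets s" and "\<gamma> u = 0"
    then obtain j where "j \<in> u" "g j = 0"
      using prod(1)[OF u] nonempty_subsetsD(1)[OF u] by (auto simp: prod_zero_iff)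
    then show "\<gamma>' u = 0"
      using prod(2)[OF u] nonempty_subsetsD(1)[OF u] zero ge1[OF u] by (auto simp: prod_zero_iff)
  qed
  show "\<exists>C\<ge>0. \<forall>s\<ge>1. (\<Sum>u\<in>nonempty_subsets s. \<gamma> u powr r * ?Z ^ card u) \<le> C"
  proof (intro exI conjI allI impI)
    fix s :: nat
    have "(\<Sum>u\<in>nonempty_subsets s. \<gamma> u powr r * ?Z ^ card u) =
        (\<Sum>u\<in>nonempty_subsets s. \<Prod>j\<in>u. ?Z * g j powr r)"
      by (intro sum.cong refl) (simp add: prod(1) prod_powr_distrib prod.distrib)
    also have "\<dots> \<le> exp (\<Sum>j. ?Z * g (Suc j) powr r)"
      using sum_g Z by (intro sum_nonempty_subsets_prod_le_exp summable_mult) auto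
    finally show "(\<Sum>u\<in>nonempty_subsets s. \<gamma> u powr r * ?Z ^ card u) \<le> exp (\<Sum>j. ?Z * g (Suc j) powr r)" .
  qed simp
  show "\<exists>C\<ge>0. \<forall>s\<ge>1. (\<Sum>u\<in>nonempty_subsets s. \<gamma>' u * real (card u)) \<le> C"
  proof (intro exI conjI allI impI)
    fix s :: nat
    have "(\<Sum>u\<in>nonempty_subsets s. \<gamma>' u * real (card u)) \<le> (\<Sum>u\<in>nonempty_subsets s. \<Prod>j\<in>u. 2 * g' j)"
    proof (rule sum_mono)
      fix u assume u: "u \<in> nonempty_subsets s"
      \<comment> \<open>The estimate |u| <= 2^|u| turns the factor |u| into a factor 2 per
        coordinate and keeps the product form.\<close>
      have "real (card u) \<le> real (2 ^ card u)" by (simp only: of_nat_le_iff less_imp_le[OF less_exp])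
      then have "(\<Prod>j\<in>u. g' j) * real (card u) \<le> (\<Prod>j\<in>u. g' j) * 2 ^ card u"
        using g ge1[OF u] by (intro mult_left_mono prod_nonneg) auto
      then show "\<gamma>' u * real (card u) \<le> (\<Prod>j\<in>u. 2 * g' j)"
        by (simp add: prod(2)[OF u] prod.distrib mult.commute)
    qed
    also have "\<dots> \<le> exp (\<Sum>j. 2 * g' (Suc j))"
      using sum_g' g by (intro sum_nonempty_subsets_prod_le_exp summable_mult) auto
    finally show "(\<Sum>u\<in>nonempty_subsets s. \<gamma>' u * real (card u)) \<le> exp (\<Sum>j. 2 * g' (Suc j))" .
  qed simp
  have ln_b: "0 < ln (real ?b)" using b by simp
  \<comment> \<open>The rate \<delta> ln b is chosen because exp(\<delta> m ln b) = b^(m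
    \<delta>).\<close>
  obtain C where C: "0 \<le> C" "\<forall>s m. (\<Prod>j\<in>{1..s}. 1 + ?k * (real m + 1) * \<rho> j) \<le> C * exp (\<delta> * ln (real ?b) * real m)"
    using prod_affine_le_exp[of \<rho> ?k "\<delta> * ln (real ?b)"] sum_\<rho> \<rho> k \<delta> ln_b by auto
  show "\<exists>C\<ge>0. \<forall>s\<ge>1. \<forall>m\<ge>1. (\<Sum>u\<in>nonempty_subsets s.
      \<gamma>' u / \<gamma> u powr (1 / (2 * \<alpha>)) * (?k * (real m + 1)) ^ card u) \<le> C * real ?b powr (real m * \<delta>)"
  proof (intro exI[of _ C] conjI allI impI)
    fix s m :: nat
    have "(\<Sum>u\<in>nonempty_subsets s. \<gamma>' u / \<gamma> u powr (1 / (2 * \<alpha>)) * (?k * (real m + 1)) ^ card u) =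
        (\<Sum>u\<in>nonempty_subsets s. \<Prod>j\<in>u. ?k * (real m + 1) * \<rho> j)"
    proof (rule sum.cong[OF refl])
      fix u assume u: "u \<in> nonempty_subsets s"
      have "(\<Prod>j\<in>u. ?k * (real m + 1) * \<rho> j) = (?k * (real m + 1)) ^ card u * (\<Prod>j\<in>u. \<rho> j)"
        by (simp only: prod.distrib prod_constant power_mult_distrib)
      moreover have "(\<Prod>j\<in>u. \<rho> j) = \<gamma>' u / \<gamma> u powr (1 / (2 * \<alpha>))"
        by (simp only: \<rho>_def prod_dividef prod[OF u] prod_powr_distrib)
      ultimately show "\<gamma>' u / \<gamma> u powr (1 / (2 * \<alpha>)) * (?k * (real m + 1)) ^ card u =
          (\<Prod>j\<in>u. ?k * (real m + 1) * \<rho> j)" by (simp only: mult.commute)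
    qed
    also have "\<dots> \<le> (\<Prod>j\<in>{1..s}. 1 + ?k * (real m + 1) * \<rho> j)"
      using k \<rho> by (intro sum_nonempty_subsets_prod_le) auto
    also have "\<dots> \<le> C * exp (\<delta> * ln (real ?b) * real m)" using C(2) by blast
    also have "exp (\<delta> * ln (real ?b) * real m) = real ?b powr (real m * \<delta>)"
      using b by (simp add: powr_def mult_ac)
    finally show "(\<Sum>u\<in>nonempty_subsets s. \<gamma>' u / \<gamma> u powr (1 / (2 * \<alpha>)) * (?k * (real m + 1)) ^ card u)
        \<le> C * real ?b powr (real m * \<delta>)" .
  qed (rule C(1))
qed

text \<open>The decay estimates of all parts come from \<open>lattice_star_disc_cbc_bound\<close>;
  they differ in how its three constants are obtained, from finite suprema or from the convergent
  series of product weights.\<close>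

theorem corollary4:
  fixes \<alpha> b :: real and \<gamma> \<gamma>' :: "nat set \<Rightarrow> real"
  assumes b: "b = real CARD('a::prime_card)"
    and \<alpha>: "\<alpha> > 1 / 2"
    and nonneg: "\<And>u. u \<in> weight_index \<Longrightarrow> \<gamma> u \<ge> 0"
    and nonneg': "\<And>u. u \<in> weight_index \<Longrightarrow> \<gamma>' u \<ge> 0"
    and mono: "\<And>u v. u \<in> weight_index \<Longrightarrow> v \<in> weight_index \<Longrightarrow> v \<subseteq> u \<Longrightarrow> \<gamma> v \<ge> \<gamma> u"
  shows
    "(\<forall>lam \<delta> e e' e'' :: real.
       e \<ge> 0 \<and> e' \<ge> 0 \<and> e'' \<ge> 0 \<and>
       1 / (2 * \<alpha>) < lam \<and> lam < 1 \<and> 0 < \<delta> \<and> \<delta> < 1 / (\<alpha> * lam) \<and>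
       (SUP s\<in>{1::nat..}. ennreal (1 / real s powr e *
          (\<Sum>u\<in>nonempty_subsets s.
             \<gamma> u powr lam * ((b - 1) / (b powr (2 * \<alpha> * lam) - b)) ^ card u))) < \<infinity> \<and>
       (SUP s\<in>{1::nat..}. ennreal (1 / real s powr e' *
          (\<Sum>u\<in>nonempty_subsets s. \<gamma>' u * real (card u)))) < \<infinity> \<and>
       (SUP s\<in>{1::nat..}. SUP m\<in>{1::nat..}.
          ennreal (1 / (real s powr e'' * b powr (real m * \<delta>))) *
          (\<Sum>u\<in>nonempty_subsets s.
             weight_ratio \<alpha> (\<gamma>' u) (\<gamma> u) *
             ennreal ((k_const CARD('a) * (real m + 1)) ^ card u))) < \<infinity>
       \<longrightarrow>
       (\<exists>C>0. \<forall>s\<ge>1. \<forall>m\<ge>1. \<forall>(p :: 'a mod_ring poly) q.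
          irreducible p \<and> degree p = m \<and> cbc_vector \<alpha> \<gamma> m p s q \<longrightarrow>
          lattice_star_disc \<gamma>' s m p q
            \<le> C * real s powr (max e' (e / (2 * \<alpha> * lam) + e''))
                * b powr (- real m * (1 / (2 * \<alpha> * lam) - \<delta>))))
     \<and>
     (\<forall>lam \<delta> :: real.
       1 / (2 * \<alpha>) < lam \<and> lam < 1 \<and> 0 < \<delta> \<and> \<delta> < 1 / (\<alpha> * lam) \<and>
       (SUP s\<in>{1::nat..}. ennreal
          (\<Sum>u\<in>nonempty_subsets s.
             \<gamma> u powr lam * ((b - 1) / (b powr (2 * \<alpha> * lam) - b)) ^ card u)) < \<infinity> \<and>
       (SUP s\<in>{1::nat..}. ennreal
          (\<Sum>u\<in>nonempty_subsets s. \<gamma>' u * real (card u))) < \<infinity> \<and>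
       (SUP s\<in>{1::nat..}. SUP m\<in>{1::nat..}.
          ennreal (1 / b powr (real m * \<delta>)) *
          (\<Sum>u\<in>nonempty_subsets s.
             weight_ratio \<alpha> (\<gamma>' u) (\<gamma> u) *
             ennreal ((k_const CARD('a) * (real m + 1)) ^ card u))) < \<infinity>
       \<longrightarrow>
       (\<exists>C>0. \<forall>s\<ge>1. \<forall>m\<ge>1. \<forall>(p :: 'a mod_ring poly) q.
          irreducible p \<and> degree p = m \<and> cbc_vector \<alpha> \<gamma> m p s q \<longrightarrow>
          lattice_star_disc \<gamma>' s m p q \<le> C \<and>
          lattice_star_disc \<gamma>' s m p q
            \<le> C * b powr (- real m * (1 / (2 * \<alpha> * lam) - \<delta>))))
     \<and>
     (\<forall>(g :: nat \<Rightarrow> real) g' (lam :: real).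
       (\<forall>j\<ge>1. g j \<ge> 0 \<and> g' j \<ge> 0) \<and>
       (\<forall>u\<in>weight_index. \<gamma> u = (\<Prod>j\<in>u. g j) \<and> \<gamma>' u = (\<Prod>j\<in>u. g' j)) \<and>
       1 / (2 * \<alpha>) < lam \<and> lam \<le> 1 \<and>
       (\<Sum>j. ennreal (g (Suc j) powr lam)) < \<infinity> \<and>
       (\<Sum>j. weight_ratio \<alpha> (g' (Suc j)) (g (Suc j))) < \<infinity>
       \<longrightarrow>
       (\<forall>\<delta>>0. \<exists>C>0. \<forall>s\<ge>1. \<forall>m\<ge>1. \<forall>(p :: 'a mod_ring poly) q.
          irreducible p \<and> degree p = m \<and> cbc_vector \<alpha> \<gamma> m p s q \<longrightarrow>
          lattice_star_disc \<gamma>' s m p q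
            \<le> C * b powr (- real m * (1 / (2 * \<alpha> * lam) - \<delta>))))"
  proof (intro conjI allI impI)
  have \<alpha>': "1 / 2 < \<alpha>" using \<alpha> .
  have k: "0 < k_const CARD('a) * (real m + 1)" for m :: nat
    using k_const_ge_1[where 'a='a] by (simp add: less_le_trans[OF zero_less_one])
  have b0: "0 < b" using b two_le_card[where 'a='a] by simp
  have Z: "mu_series CARD('a) (2 * \<alpha> * lam) = (b - 1) / (b powr (2 * \<alpha> * lam) - b)" for lam
    by (simp add: mu_series_def b)
  {
    fix lam \<delta> e e' e'' :: real
    assume asm: "e \<ge> 0 \<and> e' \<ge> 0 \<and> e'' \<ge> 0 \<and>
       1 / (2 * \<alpha>) < lam \<and> lam < 1 \<and> 0 < \<delta> \<and> \<delta> < 1 / (\<alpha> * lam) \<and>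
       (SUP s\<in>{1::nat..}. ennreal (1 / real s powr e *
          (\<Sum>u\<in>nonempty_subsets s.
             \<gamma> u powr lam * ((b - 1) / (b powr (2 * \<alpha> * lam) - b)) ^ card u))) < \<infinity> \<and>
       (SUP s\<in>{1::nat..}. ennreal (1 / real s powr e' *
          (\<Sum>u\<in>nonempty_subsets s. \<gamma>' u * real (card u)))) < \<infinity> \<and>
       (SUP s\<in>{1::nat..}. SUP m\<in>{1::nat..}.
          ennreal (1 / (real s powr e'' * b powr (real m * \<delta>))) *
          (\<Sum>u\<in>nonempty_subsets s.
             weight_ratio \<alpha> (\<gamma>' u) (\<gamma> u) *
             ennreal ((k_const CARD('a) * (real m + 1)) ^ card u))) < \<infinity>"
    then have r: "1 / (2 * \<alpha>) < lam" "lam \<le> 1" and \<delta>: "0 < \<delta>"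
      and S1: "(SUP s\<in>{1::nat..}. ennreal (1 / real s powr e *
          (\<Sum>u\<in>nonempty_subsets s. \<gamma> u powr lam * mu_series CARD('a) (2 * \<alpha> * lam) ^ card u))) < \<infinity>"
      and S2: "(SUP s\<in>{1::nat..}. ennreal (1 / real s powr e' *
          (\<Sum>u\<in>nonempty_subsets s. \<gamma>' u * real (card u)))) < \<infinity>"
      and S3: "(SUP s\<in>{1::nat..}. SUP m\<in>{1::nat..}.
          ennreal (1 / (real s powr e'' * b powr (real m * \<delta>))) *
          (\<Sum>u\<in>nonempty_subsets s. weight_ratio \<alpha> (\<gamma>' u) (\<gamma> u) *
             ennreal ((k_const CARD('a) * (real m + 1)) ^ card u))) < \<infinity>"
      unfolding Z by (elim conjE, simp only: less_imp_le)+
    have pos: "0 < 1 / (real s powr e'' * b powr (real m * \<delta>))" if "1 \<le> s" for s m :: nat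
      using that b0 by simp
    from SUP_ennreal_finite_bound[OF S1] obtain C1 where C1: "0 \<le> C1" "\<forall>s\<ge>1. 1 / real s powr e *
        (\<Sum>u\<in>nonempty_subsets s. \<gamma> u powr lam * mu_series CARD('a) (2 * \<alpha> * lam) ^ card u) \<le> C1" by blast
    from SUP_ennreal_finite_bound[OF S2] obtain C2 where C2: "0 \<le> C2" "\<forall>s\<ge>1. 1 / real s powr e' *
        (\<Sum>u\<in>nonempty_subsets s. \<gamma>' u * real (card u)) \<le> C2" by blast
    note S3' = SUP_weight_ratio_finite_bound[OF S3 pos k nonneg']
    from S3'(2) obtain C3 where C3: "0 \<le> C3" "\<forall>s\<ge>1. \<forall>m\<ge>1. 1 / (real s powr e'' * b powr (real m * \<delta>)) *
        (\<Sum>u\<in>nonempty_subsets s. \<gamma>' u / \<gamma> u powr (1 / (2 * \<alpha>)) * (k_const CARD('a) * (real m + 1)) ^ card u) \<le> C3" by blast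
    show "\<exists>C>0. \<forall>s\<ge>1. \<forall>m\<ge>1. \<forall>(p :: 'a mod_ring poly) q.
          irreducible p \<and> degree p = m \<and> cbc_vector \<alpha> \<gamma> m p s q \<longrightarrow>
          lattice_star_disc \<gamma>' s m p q
            \<le> C * real s powr (max e' (e / (2 * \<alpha> * lam) + e''))
                * b powr (- real m * (1 / (2 * \<alpha> * lam) - \<delta>))"
      unfolding b
      by (rule lattice_star_disc_cbc_bound[OF \<alpha>' r \<delta> nonneg nonneg' mono S3'(1) C1(1) C2(1) C3(1) C1(2) C2(2) C3(2)[unfolded b]])
  }
  note general = this
  {
    fix lam \<delta> :: real
    assume asm: "1 / (2 * \<alpha>) < lam \<and> lam < 1 \<and> 0 < \<delta> \<and> \<delta> < 1 / (\<alpha> * lam) \<and>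
       (SUP s\<in>{1::nat..}. ennreal
          (\<Sum>u\<in>nonempty_subsets s.
             \<gamma> u powr lam * ((b - 1) / (b powr (2 * \<alpha> * lam) - b)) ^ card u)) < \<infinity> \<and>
       (SUP s\<in>{1::nat..}. ennreal
          (\<Sum>u\<in>nonempty_subsets s. \<gamma>' u * real (card u))) < \<infinity> \<and>
       (SUP s\<in>{1::nat..}. SUP m\<in>{1::nat..}.
          ennreal (1 / b powr (real m * \<delta>)) *
          (\<Sum>u\<in>nonempty_subsets s.
             weight_ratio \<alpha> (\<gamma>' u) (\<gamma> u) *
             ennreal ((k_const CARD('a) * (real m + 1)) ^ card u))) < \<infinity>"
    have SUP_powr_0: "(SUP s\<in>{1::nat..}. ennreal (1 / real s powr 0 * f s)) = (SUP s\<in>{1..}. ennreal (f s))" for f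
      by (rule SUP_cong) auto
    have SUP_SUP_powr_0: "(SUP s\<in>{1::nat..}. SUP m\<in>{1::nat..}. ennreal (1 / (real s powr 0 * b powr (real m * \<delta>))) * T s m) =
        (SUP s\<in>{1..}. SUP m\<in>{1..}. ennreal (1 / b powr (real m * \<delta>)) * T s m)" for T
      by (rule SUP_cong) auto
    have "\<exists>C>0. \<forall>s\<ge>1. \<forall>m\<ge>1. \<forall>(p :: 'a mod_ring poly) q.
          irreducible p \<and> degree p = m \<and> cbc_vector \<alpha> \<gamma> m p s q \<longrightarrow>
          lattice_star_disc \<gamma>' s m p q
            \<le> C * real s powr (max 0 (0 / (2 * \<alpha> * lam) + 0))
                * b powr (- real m * (1 / (2 * \<alpha> * lam) - \<delta>))"
      using asm by (intro general) (simp only: SUP_powr_0 SUP_SUP_powr_0 order.refl simp_thms)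
    then obtain C where C: "C > 0" "\<And>s m (p :: 'a mod_ring poly) q. 1 \<le> s \<Longrightarrow> 1 \<le> m \<Longrightarrow>
        irreducible p \<and> degree p = m \<and> cbc_vector \<alpha> \<gamma> m p s q \<Longrightarrow>
        lattice_star_disc \<gamma>' s m p q \<le> C * b powr (- real m * (1 / (2 * \<alpha> * lam) - \<delta>))"
      by auto
    \<comment> \<open>The decay estimate alone does not give boundedness: \<delta> may exceed
      1/(2\<alpha> lam), and then its right-hand side grows with \<open>m\<close>. The uniform bound
      comes from the trivial estimate of the local discrepancy instead.\<close>
    obtain C2 where C2: "0 \<le> C2" "\<forall>s\<ge>1. (\<Sum>u\<in>nonempty_subsets s. \<gamma>' u * real (card u)) \<le> C2"
      using SUP_ennreal_finite_bound asm by meson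
    show "\<exists>C>0. \<forall>s\<ge>1. \<forall>m\<ge>1. \<forall>(p :: 'a mod_ring poly) q.
          irreducible p \<and> degree p = m \<and> cbc_vector \<alpha> \<gamma> m p s q \<longrightarrow>
          lattice_star_disc \<gamma>' s m p q \<le> C \<and>
          lattice_star_disc \<gamma>' s m p q
            \<le> C * b powr (- real m * (1 / (2 * \<alpha> * lam) - \<delta>))"
    proof (rule exI[of _ "max C C2"], intro conjI allI impI)
      show "0 < max C C2" using C(1) by simp
      fix s m :: nat and p :: "'a mod_ring poly" and q
      assume s: "1 \<le> s" and m: "1 \<le> m"
        and pq: "irreducible p \<and> degree p = m \<and> cbc_vector \<alpha> \<gamma> m p s q"
      have "lattice_star_disc \<gamma>' s m p q \<le> (\<Sum>u\<in>nonempty_subsets s. \<gamma>' u * real (card u))"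
        by (rule lattice_star_disc_le_sum_weights[OF s nonneg'])
      also have "\<dots> \<le> C2" using C2(2) s by blast
      finally show "lattice_star_disc \<gamma>' s m p q \<le> max C C2" by simp
      have "lattice_star_disc \<gamma>' s m p q \<le> C * b powr (- real m * (1 / (2 * \<alpha> * lam) - \<delta>))"
        by (rule C(2)[OF s m pq])
      also have "\<dots> \<le> max C C2 * b powr (- real m * (1 / (2 * \<alpha> * lam) - \<delta>))"
        by (intro mult_right_mono) auto
      finally show "lattice_star_disc \<gamma>' s m p q \<le> max C C2 * b powr (- real m * (1 / (2 * \<alpha> * lam) - \<delta>))" .
    qed
  }
  {
    fix g g' :: "nat \<Rightarrow> real" and lam \<delta> :: real
    assume asm: "(\<forall>j\<ge>1. g j \<ge> 0 \<and> g' j \<ge> 0) \<and>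
       (\<forall>u\<in>weight_index. \<gamma> u = (\<Prod>j\<in>u. g j) \<and> \<gamma>' u = (\<Prod>j\<in>u. g' j)) \<and>
       1 / (2 * \<alpha>) < lam \<and> lam \<le> 1 \<and>
       (\<Sum>j. ennreal (g (Suc j) powr lam)) < \<infinity> \<and>
       (\<Sum>j. weight_ratio \<alpha> (g' (Suc j)) (g (Suc j))) < \<infinity>"
      and \<delta>: "\<delta> > 0"
    then have r: "1 / (2 * \<alpha>) < lam" "lam \<le> 1"
      and g: "\<And>j. 1 \<le> j \<Longrightarrow> 0 \<le> g j \<and> 0 \<le> g' j"
      and prod: "\<And>u. u \<in> weight_index \<Longrightarrow> \<gamma> u = (\<Prod>j\<in>u. g j) \<and> \<gamma>' u = (\<Prod>j\<in>u. g' j)"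
      and sum: "(\<Sum>j. ennreal (g (Suc j) powr lam)) < \<infinity>"
      and sum_ratio: "(\<Sum>j. weight_ratio \<alpha> (g' (Suc j)) (g (Suc j))) < \<infinity>"
      by blast+
    note bounds = product_weights_bounds[OF \<alpha>' r \<delta> g prod sum sum_ratio]
    from bounds(2)[where 'a='a] obtain C1 where C1: "0 \<le> C1" "\<forall>s\<ge>1. (\<Sum>u\<in>nonempty_subsets s.
        \<gamma> u powr lam * mu_series CARD('a) (2 * \<alpha> * lam) ^ card u) \<le> C1" by blast
    from bounds(3) obtain C2 where C2: "0 \<le> C2" "\<forall>s\<ge>1. (\<Sum>u\<in>nonempty_subsets s. \<gamma>' u * real (card u)) \<le> C2"
      by blast
    from bounds(4)[where 'a='a] obtain C3 where C3: "0 \<le> C3" "\<forall>s\<ge>1. \<forall>m\<ge>1. (\<Sum>u\<in>nonempty_subsets s.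
        \<gamma>' u / \<gamma> u powr (1 / (2 * \<alpha>)) * (k_const CARD('a) * (real m + 1)) ^ card u)
        \<le> C3 * real CARD('a) powr (real m * \<delta>)" by blast
    have "\<exists>C>0. \<forall>s\<ge>1. \<forall>m\<ge>1. \<forall>(p :: 'a mod_ring poly) q.
          irreducible p \<and> degree p = m \<and> cbc_vector \<alpha> \<gamma> m p s q \<longrightarrow>
          lattice_star_disc \<gamma>' s m p q
            \<le> C * real s powr (max 0 (0 / (2 * \<alpha> * lam) + 0))
                * real CARD('a) powr (- real m * (1 / (2 * \<alpha> * lam) - \<delta>))"
    proof (rule lattice_star_disc_cbc_bound[OF \<alpha>' r \<delta> nonneg nonneg' mono bounds(1) C1(1) C2(1) C3(1)])
      show "\<forall>s\<ge>1. 1 / real s powr 0 * (\<Sum>u\<in>nonempty_subsets s.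
          \<gamma> u powr lam * mu_series CARD('a) (2 * \<alpha> * lam) ^ card u) \<le> C1"
        using C1(2) by simp
      show "\<forall>s\<ge>1. 1 / real s powr 0 * (\<Sum>u\<in>nonempty_subsets s. \<gamma>' u * real (card u)) \<le> C2"
        using C2(2) by simp
      show "\<forall>s\<ge>1. \<forall>m\<ge>1. 1 / (real s powr 0 * real CARD('a) powr (real m * \<delta>)) *
          (\<Sum>u\<in>nonempty_subsets s. \<gamma>' u / \<gamma> u powr (1 / (2 * \<alpha>)) * (k_const CARD('a) * (real m + 1)) ^ card u) \<le> C3"
      proof (intro allI impI)
        fix s m :: nat assume sm: "1 \<le> s" "1 \<le> m"
        let ?S = "\<Sum>u\<in>nonempty_subsets s. \<gamma>' u / \<gamma> u powr (1 / (2 * \<alpha>)) * (k_const CARD('a) * (real m + 1)) ^ card u"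
        have "?S \<le> C3 * real CARD('a) powr (real m * \<delta>)" using C3(2) sm by blast
        then have "?S / real CARD('a) powr (real m * \<delta>) \<le> C3"
          using b0 unfolding b by (subst pos_divide_le_eq) auto
        then show "1 / (real s powr 0 * real CARD('a) powr (real m * \<delta>)) * ?S \<le> C3"
          using sm by simp
      qed
    qed
    then show "\<exists>C>0. \<forall>s\<ge>1. \<forall>m\<ge>1. \<forall>(p :: 'a mod_ring poly) q.
          irreducible p \<and> degree p = m \<and> cbc_vector \<alpha> \<gamma> m p s q \<longrightarrow>
          lattice_star_disc \<gamma>' s m p q
            \<le> C * b powr (- real m * (1 / (2 * \<alpha> * lam) - \<delta>))"
      unfolding b by simp
  }
qed

end
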